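(* Let $n=1$ and let $u$ be the least solution of $$\begin{cases} u_t-u_{xx}=\chi_{\{u>0\}} & \text{in } (-1,1)\times(0,\infty),\\ u(x,0)=2x^2-1 & \text{for } x\in(-1,1),\\ u(\pm1,t)=t+1 & \text{for } t\in(0,\infty).\end{cases}$$ Then the time derivative $u_t$ is unbounded, i.e. $u_t\notin L^\infty((-1,1)\times(0,\infty))$.
   Context: A solution of $u_t-u_{xx}=\chi_{\{u>0\}}$ is a strong solution: $u$ is continuous, $u_t,u_x,u_{xx}\in L^p_{\rm loc}$ for every $1\le p<\infty$, and the equation holds almost everywhere. The least solution is constructed as follows. For $\epsilon>0$ let $f_\epsilon(z)=0$ for $z<0$, $f_\epsilon(z)=z/\epsilon$ for $0\le z\le\epsilon$, and $f_\epsilon(z)=1$ for $z>\epsilon$. Let $u^\epsilon$ be the unique solution of $u^\epsilon_t-u^\epsilon_{xx}=f_\epsilon(u^\epsilon)$ with the same initial and lateral boundary data. The functions $u^\epsilon$ increase as $\epsilon\downarrow0$, and the least solution is $u=\lim_{\epsilon\to0}u^\epsilon$. *)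

theory Defs
  imports "HOL-Analysis.Analysis"
begin

text \<open>Points of space-time are pairs \<open>(x, t)\<close>.\<close>

definition Dx :: "(real \<times> real \<Rightarrow> real) \<Rightarrow> real \<times> real \<Rightarrow> real" where
  "Dx \<phi> = (\<lambda>(x, t). deriv (\<lambda>y. \<phi> (y, t)) x)"

definition Dt :: "(real \<times> real \<Rightarrow> real) \<Rightarrow> real \<times> real \<Rightarrow> real" where
  "Dt \<phi> = (\<lambda>(x, t). deriv (\<lambda>s. \<phi> (x, s)) t)"

primrec Ck :: "nat \<Rightarrow> (real \<times> real \<Rightarrow> real) \<Rightarrow> bool" where
  "Ck 0 \<phi> \<longleftrightarrow> continuous_on UNIV \<phi>"
| "Ck (Suc k) \<phi> \<longleftrightarrow> (\<forall>z. \<phi> differentiable (at z)) \<and> Ck k (Dx \<phi>) \<and> Ck k (Dt \<phi>)"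

definition test_functions :: "(real \<times> real) set \<Rightarrow> (real \<times> real \<Rightarrow> real) set" where
  "test_functions \<Omega> = {\<phi>. (\<forall>k. Ck k \<phi>) \<and>
     compact (closure {z. \<phi> z \<noteq> 0}) \<and> closure {z. \<phi> z \<noteq> 0} \<subseteq> \<Omega>}"

definition Lp_loc :: "real \<Rightarrow> (real \<times> real) set \<Rightarrow> (real \<times> real \<Rightarrow> real) set" where
  "Lp_loc p \<Omega> = {g. \<forall>K. compact K \<and> K \<subseteq> \<Omega> \<longrightarrow>
     g \<in> borel_measurable (lebesgue_on K) \<and>
     integrable (lebesgue_on K) (\<lambda>z. \<bar>g z\<bar> powr p)}"

definition Linf :: "(real \<times> real) set \<Rightarrow> (real \<times> real \<Rightarrow> real) set" where
  "Linf \<Omega> = {g. g \<in> borel_measurable (lebesgue_on \<Omega>) \<and>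
     (\<exists>C. AE z in lebesgue_on \<Omega>. \<bar>g z\<bar> \<le> C)}"

text \<open>\<open>g\<close> is the weak derivative of \<open>v\<close> in \<open>\<Omega>\<close>, in the direction
  given by \<open>D\<close>, which is \<open>Dx\<close> or \<open>Dt\<close>.\<close>

definition weak_deriv ::
  "((real \<times> real \<Rightarrow> real) \<Rightarrow> real \<times> real \<Rightarrow> real) \<Rightarrow> (real \<times> real) set \<Rightarrow>
   (real \<times> real \<Rightarrow> real) \<Rightarrow> (real \<times> real \<Rightarrow> real) \<Rightarrow> bool" where
  "weak_deriv D \<Omega> v g \<longleftrightarrow> v \<in> Lp_loc 1 \<Omega> \<and> g \<in> Lp_loc 1 \<Omega> \<and>
     (\<forall>\<phi>\<in>test_functions \<Omega>.
        (LINT z|lebesgue_on \<Omega>. v z * D \<phi> z) = - (LINT z|lebesgue_on \<Omega>. g z * \<phi> z))"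

text \<open>Strong solutions of \<open>u\<^sub>t - u\<^sub>x\<^sub>x = F(u)\<close> in an open set \<open>\<Omega>\<close>.\<close>

definition strong_solution ::
  "(real \<Rightarrow> real) \<Rightarrow> (real \<times> real) set \<Rightarrow> (real \<times> real \<Rightarrow> real) \<Rightarrow> bool" where
  "strong_solution F \<Omega> u \<longleftrightarrow> continuous_on \<Omega> u \<and>
     (\<exists>ut ux uxx. weak_deriv Dt \<Omega> u ut \<and> weak_deriv Dx \<Omega> u ux \<and> weak_deriv Dx \<Omega> ux uxx \<and>
        (\<forall>p\<ge>1. ut \<in> Lp_loc p \<Omega> \<and> ux \<in> Lp_loc p \<Omega> \<and> uxx \<in> Lp_loc p \<Omega>) \<and>
        (AE z in lebesgue_on \<Omega>. ut z - uxx z = F (u z)))"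

definition Q :: "(real \<times> real) set" where
  "Q = {-1<..<1} \<times> {0<..}"

text \<open>Initial and lateral data are attained in the classical sense, by continuity of \<open>u\<close>
  up to the boundary; values of \<open>u\<close> outside \<open>closure Q\<close> are irrelevant.\<close>

definition solves_ibvp ::
  "(real \<Rightarrow> real) \<Rightarrow> (real \<Rightarrow> real) \<Rightarrow> (real \<Rightarrow> real \<Rightarrow> real) \<Rightarrow> (real \<times> real \<Rightarrow> real) \<Rightarrow> bool" where
  "solves_ibvp F u0 b u \<longleftrightarrow>
     strong_solution F Q u \<and> continuous_on (closure Q) u \<and>
     (\<forall>x\<in>{-1<..<1}. u (x, 0) = u0 x) \<and>
     (\<forall>x\<in>{-1, 1}. \<forall>t>0. u (x, t) = b x t)"

definition f_reg :: "real \<Rightarrow> real \<Rightarrow> real" where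
  "f_reg \<epsilon> z = (if z < 0 then 0 else if z \<le> \<epsilon> then z / \<epsilon> else 1)"

text \<open>Each \<open>U \<epsilon>\<close> is determined on \<open>closure Q\<close> by the regularized problem,
  because \<open>f_reg \<epsilon>\<close> is Lipschitz.\<close>

definition least_solution ::
  "(real \<Rightarrow> real) \<Rightarrow> (real \<Rightarrow> real \<Rightarrow> real) \<Rightarrow> (real \<times> real \<Rightarrow> real) \<Rightarrow> bool" where
  "least_solution u0 b u \<longleftrightarrow>
     solves_ibvp (indicat_real {0<..}) u0 b u \<and>
     (\<exists>U. (\<forall>\<epsilon>>0. solves_ibvp (f_reg \<epsilon>) u0 b (U \<epsilon>)) \<and>
          (\<forall>z\<in>closure Q. ((\<lambda>\<epsilon>. U \<epsilon> z) \<longlongrightarrow> u z) (at_right 0)))"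

end

theory Submission
  imports Defs
begin

text \<open>
  Comparison for the regularized problems gives \<open>u (x, t + s) \<ge> u (x, t) + s\<close>, so \<open>u\<^sub>t \<ge> 1\<close> and
  \<open>u\<^sub>x\<^sub>x = u\<^sub>t - \<chi> \<ge> 0\<close>. Suppose also \<open>u\<^sub>t \<le> C\<close>. Let \<open>T\<close> be the last time at which \<open>u\<close> has a zero
  or negative value, \<open>u (a, T) = 0\<close>, and put \<open>\<tau> = T - t\<close>. By convexity \<open>{u \<le> 0}\<close> is at each time \<open>t < T\<close>
  an interval around \<open>a\<close>; as \<open>u\<^sub>x\<^sub>x \<le> C\<close> everywhere and \<open>u\<^sub>x\<^sub>x \<ge> 1\<close> where \<open>u < 0\<close>, its end points are at
  distance comparable to \<open>\<surd>\<tau>\<close> from \<open>a\<close>. Now test \<open>w = u\<^sub>x\<^sub>x\<close>, which solves \<open>w\<^sub>t - w\<^sub>x\<^sub>x = \<chi>\<^sub>x\<^sub>x\<close>, with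
  the backward heat kernel \<open>G\<close> centred at \<open>(a, T)\<close>: the integral \<open>\<integral>w G\<close> is bounded by \<open>C \<integral>G\<close>, but its time
  derivative \<open>- \<integral>\<chi>\<^sub>x G\<^sub>x\<close> is at least \<open>c / \<tau>\<close>, so that it grows like \<open>ln (1 / \<tau>)\<close>. All of this is done for
  mollifications of \<open>u\<close> and \<open>\<chi>\<close>, with constants independent of the mollification parameter.
\<close>

section \<open>Smooth mollifiers\<close>

text \<open>For \<open>f_reg\<close> it holds with constant 1 / \<epsilon>; this constant enters the
  proof of the growth inequality but not the inequality, so the limit inherits it. This is where
  leastness is used. The rate 1 / \<tau> comes from parabolic scaling: where |x - a| is of order
  sqrt \<tau>, the derivative of the Gaussian is (x - a) / (2 \<tau>) times a value of order 1 /
  sqrt \<tau>, and \<chi> rises by 1 across each end of the interval. Its integral in \<tau>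
  diverges at 0. An interval of any other width would lose this rate, hence the need for both an
  inner and an outer bound. Since u_xx, u_tx and \<chi>_x are only distributions, they are
  mollified, and a mollification of radius \<delta> sees the interval only while \<delta> is small
  against sqrt \<tau>. So the time window is fixed first, ending before T but long enough for the
  logarithm to beat the bound on the mass; \<delta> is chosen afterwards.\<close>

primrec differentiable_upto :: "nat \<Rightarrow> (real \<Rightarrow> real) \<Rightarrow> bool" where
  "differentiable_upto 0 f \<longleftrightarrow> True"
| "differentiable_upto (Suc n) f \<longleftrightarrow>
     (\<forall>x. (f has_real_derivative deriv f x) (at x)) \<and> differentiable_upto n (deriv f)"

lemma differentiable_uptoI:
  assumes "\<And>n x. (F n has_real_derivative F (Suc n) x) (at x)"
  shows "differentiable_upto n (F k)"
proof (induction n arbitrary: k)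
  case (Suc n)
  have "deriv (F k) = F (Suc k)"
    using assms by (auto intro!: ext DERIV_imp_deriv)
  with Suc assms show ?case by auto
qed simp

lemma differentiable_upto_SucD: "differentiable_upto (Suc n) f \<Longrightarrow> differentiable_upto n f"
  by (induction n arbitrary: f) auto

lemma differentiable_upto_add:
  "differentiable_upto n f \<Longrightarrow> differentiable_upto n g \<Longrightarrow> differentiable_upto n (\<lambda>x. f x + g x)"
proof (induction n arbitrary: f g)
  case (Suc n)
  have D: "((\<lambda>x. f x + g x) has_real_derivative deriv f x + deriv g x) (at x)" for x
    using Suc.prems by (auto intro!: derivative_eq_intros)
  hence "deriv (\<lambda>x. f x + g x) = (\<lambda>x. deriv f x + deriv g x)"
    by (auto intro!: ext DERIV_imp_deriv)
  with Suc D show ?case by simp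
qed simp

lemma differentiable_upto_mult:
  "differentiable_upto n f \<Longrightarrow> differentiable_upto n g \<Longrightarrow> differentiable_upto n (\<lambda>x. f x * g x)"
proof (induction n arbitrary: f g)
  case (Suc n)
  have D: "((\<lambda>x. f x * g x) has_real_derivative deriv f x * g x + f x * deriv g x) (at x)" for x
    using Suc.prems by (auto intro!: derivative_eq_intros)
  hence *: "deriv (\<lambda>x. f x * g x) = (\<lambda>x. deriv f x * g x + f x * deriv g x)"
    by (auto intro!: ext DERIV_imp_deriv)
  have "differentiable_upto n f" "differentiable_upto n g"
    using Suc.prems differentiable_upto_SucD by blast+
  with Suc D * show ?case by (simp add: differentiable_upto_add)
qed simp

text \<open>The factor \<open>c\<close> lets the induction close: each differentiation turns it into
  \<open>c * b\<close>.\<close>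

lemma differentiable_upto_affine:
  "differentiable_upto n f \<Longrightarrow> differentiable_upto n (\<lambda>x. c * f (a + b * x))"
proof (induction n arbitrary: f c)
  case (Suc n)
  have D: "((\<lambda>x. c * f (a + b * x)) has_real_derivative (c * b) * deriv f (a + b * x)) (at x)" for x
  proof -
    have "((\<lambda>x. f (a + b * x)) has_real_derivative deriv f (a + b * x) * b) (at x)"
      by (rule DERIV_chain2[where f = f and g = "\<lambda>x. a + b * x"])
        (use Suc.prems in \<open>auto intro!: derivative_eq_intros\<close>)
    from DERIV_cmult[OF this, of c] show ?thesis by (simp add: mult_ac)
  qed
  hence "deriv (\<lambda>x. c * f (a + b * x)) = (\<lambda>x. (c * b) * deriv f (a + b * x))"
    by (auto intro!: ext DERIV_imp_deriv)
  with Suc D show ?case by simp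
qed simp

lemma differentiable_upto_iterate:
  assumes "\<And>n. differentiable_upto n f"
  shows "((deriv ^^ n) f has_real_derivative (deriv ^^ Suc n) f x) (at x)"
proof -
  have "\<forall>m. differentiable_upto m ((deriv ^^ n) f)"
  proof (induction n)
    case (Suc n)
    have "differentiable_upto (Suc m) ((deriv ^^ n) f)" for m
      using Suc by blast
    thus ?case by simp
  qed (use assms in simp)
  hence "differentiable_upto (Suc 0) ((deriv ^^ n) f)" by blast
  thus ?thesis by simp
qed

text \<open>This family, p(1/x) exp(-1/x) continued by 0, is closed under differentiation, which
  yields smoothness at 0 to all orders at once.\<close>

definition flat :: "real poly \<Rightarrow> real \<Rightarrow> real" where
  "flat p x = (if x > 0 then poly p (1 / x) * exp (- (1 / x)) else 0)"

lemma poly_div_exp_tendsto_0: "((\<lambda>y. poly p y / exp y) \<longlongrightarrow> 0) at_top" for p :: "real poly"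
proof -
  have "((\<lambda>y. \<Sum>i\<le>degree p. coeff p i * (y ^ i / exp y)) \<longlongrightarrow> (\<Sum>i\<le>degree p. coeff p i * 0)) at_top"
    by (intro tendsto_intros tendsto_power_div_exp_0)
  thus ?thesis by (simp add: poly_altdef sum_divide_distrib)
qed

lemma flat_tendsto_0: "(flat p \<longlongrightarrow> 0) (at 0)"
proof -
  have "((\<lambda>x. poly p (inverse x) / exp (inverse x)) \<longlongrightarrow> 0) (at_right 0)"
    by (rule filterlim_compose[OF poly_div_exp_tendsto_0 filterlim_inverse_at_top_right])
  hence R: "(flat p \<longlongrightarrow> 0) (at_right 0)"
    by (rule Lim_transform_eventually)
      (auto simp: eventually_at_right_field flat_def exp_minus field_simps intro!: exI[of _ 1])
  have "(flat p \<longlongrightarrow> 0) (at_left 0)"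
    by (rule tendsto_eventually) (auto simp: eventually_at_left_field flat_def intro!: exI[of _ "-1"])
  with R show ?thesis by (simp add: filterlim_split_at)
qed

text \<open>The polynomial is X^2 (p - p'): the chain rule produces -1/x^2 from p(1/x) and 1/x^2
  from exp(-1/x). At 0 the difference quotient is again in the family, with polynomial X p, and
  tends to 0.\<close>

lemma flat_DERIV: "(flat p has_real_derivative flat ([:0, 0, 1:] * (p - pderiv p)) x) (at x)"
proof -
  consider "x > 0" | "x < 0" | "x = 0" by linarith
  thus ?thesis
  proof cases
    case 1
    have "((\<lambda>x. poly p (1 / x) * exp (- (1 / x))) has_real_derivative
            flat ([:0, 0, 1:] * (p - pderiv p)) x) (at x)"
      using 1 by (auto intro!: derivative_eq_intros poly_DERIV DERIV_chain2[where f = "poly p"]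
          simp: flat_def field_simps power2_eq_square)
    moreover have "eventually (\<lambda>y. y > 0) (nhds x)"
      using eventually_nhds_in_open[of "{0<..}" x] 1 by simp
    hence "eventually (\<lambda>y. flat p y = poly p (1 / y) * exp (- (1 / y))) (nhds x)"
      by eventually_elim (simp add: flat_def)
    ultimately show ?thesis
      by (subst DERIV_cong_ev[OF refl _ refl])
  next
    case 2
    have "eventually (\<lambda>y. y < 0) (nhds x)"
      using eventually_nhds_in_open[of "{..<0}" x] 2 by simp
    hence "eventually (\<lambda>y. flat p y = 0) (nhds x)"
      by eventually_elim (simp add: flat_def)
    moreover have "((\<lambda>_. 0) has_real_derivative flat ([:0, 0, 1:] * (p - pderiv p)) x) (at x)"
      using 2 by (simp add: flat_def)
    ultimately show ?thesis
      by (subst DERIV_cong_ev[OF refl _ refl])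
  next
    case 3
    have "(\<lambda>h. (flat p (0 + h) - flat p 0) / h) = flat ([:0, 1:] * p)"
      by (auto simp: flat_def)
    hence "(flat p has_real_derivative 0) (at 0)"
      by (simp add: DERIV_def flat_tendsto_0)
    with 3 show ?thesis by (simp add: flat_def)
  qed
qed

lemma differentiable_upto_flat: "differentiable_upto n (flat 1)"
  using differentiable_uptoI[of "\<lambda>n. flat (((\<lambda>p. [:0, 0, 1:] * (p - pderiv p)) ^^ n) 1)" n 0] flat_DERIV
  by simp

text \<open>The function \<open>\<alpha> 0\<close> comes with all its derivatives, so that a
  derivative of a convolution is the convolution with a later member of the sequence.\<close>

definition mollifier :: "real \<Rightarrow> (nat \<Rightarrow> real \<Rightarrow> real) \<Rightarrow> bool" where
  "mollifier \<delta> \<alpha> \<longleftrightarrow>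
     (\<forall>n x. (\<alpha> n has_real_derivative \<alpha> (Suc n) x) (at x)) \<and>
     (\<forall>n x. \<delta> \<le> \<bar>x\<bar> \<longrightarrow> \<alpha> n x = 0) \<and> (\<forall>x. 0 \<le> \<alpha> 0 x) \<and> (LBINT x. \<alpha> 0 x) = 1"

text \<open>Where |x| > \<delta>, the preceding member is 0 in a neighbourhood. At the end points
  the value is a limit from outside; the direction \<open>sgn x\<close> points outwards at either
  end.\<close>

lemma DERIV_chain_vanishes_outside:
  fixes F :: "nat \<Rightarrow> real \<Rightarrow> real"
  assumes D: "\<And>n x. (F n has_real_derivative F (Suc n) x) (at x)"
    and z: "\<And>x. \<delta> \<le> \<bar>x\<bar> \<Longrightarrow> F 0 x = 0"
  shows "\<delta> \<le> \<bar>x\<bar> \<Longrightarrow> F n x = 0"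
proof (induction n arbitrary: x)
  case (Suc n)
  have cont: "isCont (F (Suc n)) y" for y
    using D DERIV_isCont by blast
  have "F (Suc n) y = 0" if "\<delta> < \<bar>y\<bar>" for y
  proof -
    have "open {y. \<delta> < \<bar>y\<bar>}"
      by (intro open_Collect_less continuous_intros)
    hence "eventually (\<lambda>y. \<delta> < \<bar>y\<bar>) (nhds y)"
      using that eventually_nhds_in_open[of "{y. \<delta> < \<bar>y\<bar>}" y] by simp
    hence "eventually (\<lambda>y. F n y = 0) (nhds y)"
      by eventually_elim (use Suc.IH in simp)
    moreover have "((\<lambda>_. 0) has_real_derivative 0) (at y)" by simp
    ultimately have "(F n has_real_derivative 0) (at y)"
      using DERIV_cong_ev[of y y "F n" "\<lambda>_. 0" 0 0] by simp
    thus ?thesis using D DERIV_unique by blast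
  qed
  hence R: "F (Suc n) (x + sgn x * h) = 0" if "h > 0" "x \<noteq> 0" for h
    using Suc.prems that by (auto simp: sgn_if abs_if split: if_splits)
  show ?case
  proof (cases "\<delta> < \<bar>x\<bar> \<or> x = 0")
    case True
    show ?thesis
    proof (cases "\<delta> < \<bar>x\<bar>")
      case False
      with True Suc.prems have "\<delta> \<le> 0" "x = 0" by auto
      have "F n = (\<lambda>_. 0)" using Suc.IH \<open>\<delta> \<le> 0\<close> by (auto intro!: ext)
      hence "(F n has_real_derivative 0) (at x)" by simp
      thus ?thesis using D DERIV_unique by blast
    qed (use \<open>\<And>y. \<delta> < \<bar>y\<bar> \<Longrightarrow> F (Suc n) y = 0\<close> in blast)
  next
    case False
    have "((\<lambda>h. F (Suc n) (x + sgn x * h)) \<longlongrightarrow> F (Suc n) (x + sgn x * 0)) (at_right 0)"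
      by (intro isCont_tendsto_compose[OF cont] tendsto_intros)
    moreover have "((\<lambda>h. F (Suc n) (x + sgn x * h)) \<longlongrightarrow> 0) (at_right 0)"
      by (rule tendsto_eventually) (use R False in \<open>auto simp: eventually_at_right_field intro!: exI[of _ 1]\<close>)
    ultimately show ?thesis
      using tendsto_unique[OF trivial_limit_at_right_real] by fastforce
  qed
qed (use z in simp)

lemma continuous_compact_support_integrable:
  fixes f :: "'a::euclidean_space \<Rightarrow> real"
  assumes "continuous_on UNIV f" "compact K" "\<And>x. x \<notin> K \<Longrightarrow> f x = 0"
  shows "integrable lborel f"
proof -
  have "integrable lborel (\<lambda>x. indicator K x *\<^sub>R f x)"
    using borel_integrable_compact[OF assms(2) continuous_on_subset[OF assms(1)]]
    by (simp add: set_integrable_def)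
  moreover have "(\<lambda>x. indicator K x *\<^sub>R f x) = f"
    using assms(3) by (intro ext) (auto simp: indicator_def)
  ultimately show ?thesis by simp
qed

lemma mollifier_exists:
  assumes "\<delta> > 0"
  obtains \<alpha> where "mollifier \<delta> \<alpha>"
proof -
  define b where "b x = flat 1 (\<delta> + x) * flat 1 (\<delta> - x)" for x
  have sm: "differentiable_upto n b" for n
    unfolding b_def[abs_def]
    using differentiable_upto_mult[OF differentiable_upto_affine[OF differentiable_upto_flat, of n 1 \<delta> 1]
      differentiable_upto_affine[OF differentiable_upto_flat, of n 1 \<delta> "-1"]] by simp
  have b0: "b x = 0" if "\<delta> \<le> \<bar>x\<bar>" for x
    using that by (auto simp: b_def flat_def abs_if split: if_splits)
  have bn: "b x \<ge> 0" for x by (auto simp: b_def flat_def)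
  have bc: "continuous_on UNIV b"
    using differentiable_upto_iterate[OF sm, of 0]
    by (auto intro!: continuous_at_imp_continuous_on DERIV_isCont)
  have bi: "integrable lborel b"
    by (rule continuous_compact_support_integrable[OF bc compact_Icc[of "-\<delta>" \<delta>]])
      (use b0 in auto)
  \<comment> \<open>On the middle half both 1 / (\<delta> + x) and 1 / (\<delta> - x) are at most 2
    / \<delta>, so \<open>b\<close> is at least \<open>c\<close> there. This makes the normalizing
    integral positive.\<close>
  define c where "c = exp (- (2 / \<delta>)) * exp (- (2 / \<delta>))"
  have low: "b x \<ge> c * indicator {-\<delta>/2..\<delta>/2} x" for x
  proof (cases "x \<in> {-\<delta>/2..\<delta>/2}")
    case True
    hence "1 / (\<delta> + x) \<le> 2 / \<delta>" "1 / (\<delta> - x) \<le> 2 / \<delta>" "\<delta> + x > 0" "\<delta> - x > 0"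
      using assms by (auto simp: divide_simps)
    thus ?thesis using True
      by (auto simp: b_def flat_def c_def intro!: mult_mono)
  qed (simp add: bn)
  have "0 < c * \<delta>" using assms by (simp add: c_def)
  also have "c * \<delta> = (LBINT x. c * indicator {-\<delta>/2..\<delta>/2} x)"
    using assms by simp
  also have "\<dots> \<le> (LBINT x. b x)"
    proof (rule integral_mono[OF _ bi low])
    show "integrable lborel (\<lambda>x. c * indicat_real {-\<delta>/2..\<delta>/2} x)"
      by (intro integrable_mult_right integrable_real_indicator) (auto simp: emeasure_lborel_Icc_eq)
  qed
  finally have I: "(LBINT x. b x) > 0" .
  define \<alpha> where "\<alpha> n x = (deriv ^^ n) b x / (LBINT x. b x)" for n x
  have D: "(\<alpha> n has_real_derivative \<alpha> (Suc n) x) (at x)" for n x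
    unfolding \<alpha>_def using differentiable_upto_iterate[OF sm, of n x] by (rule DERIV_cdivide)
  have "mollifier \<delta> \<alpha>"
    unfolding mollifier_def
  proof (intro conjI allI impI)
    show "\<alpha> n x = 0" if "\<delta> \<le> \<bar>x\<bar>" for n x
      by (rule DERIV_chain_vanishes_outside[where F = \<alpha>, OF D _ that]) (simp add: \<alpha>_def b0)
    show "0 \<le> \<alpha> 0 x" for x using bn I by (simp add: \<alpha>_def)
    show "(LBINT x. \<alpha> 0 x) = 1" using I by (simp add: \<alpha>_def)
  qed (rule D)
  thus ?thesis by (rule that)
qed

lemma mollifier_bounded:
  assumes "mollifier \<delta> \<alpha>"
  obtains B where "\<And>x. \<bar>\<alpha> n x\<bar> \<le> B" "B \<ge> 0"
proof -
  have "continuous_on {-\<delta>..\<delta>} (\<alpha> n)"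
    using assms by (auto simp: mollifier_def intro!: continuous_at_imp_continuous_on DERIV_isCont)
  hence "bounded (\<alpha> n ` {-\<delta>..\<delta>})"
    by (intro compact_imp_bounded compact_continuous_image) auto
  then obtain B where "\<forall>y\<in>\<alpha> n ` {-\<delta>..\<delta>}. norm y \<le> B" unfolding bounded_iff ..
  hence B: "\<bar>\<alpha> n x\<bar> \<le> B" if "x \<in> {-\<delta>..\<delta>}" for x using that by simp
  have "\<bar>\<alpha> n x\<bar> \<le> max B 0" for x
  proof (cases "x \<in> {-\<delta>..\<delta>}")
    case False
    hence "\<alpha> n x = 0" using assms by (auto simp: mollifier_def)
    thus ?thesis by simp
  qed (use B in fastforce)
  thus ?thesis by (rule that) simp
qed

section \<open>Mollification\<close>

text \<open>The mean value bound is applied to f' and then to f minus its linear part. The remainder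
  is uniform in the base point, so it can be integrated against |w|; convolutions are differentiated
  in this way.\<close>

lemma DERIV_Taylor2_bound:
  fixes f :: "real \<Rightarrow> real"
  assumes f: "\<And>x. (f has_real_derivative f' x) (at x)"
    and f': "\<And>x. (f' has_real_derivative f'' x) (at x)"
    and B: "\<And>x. \<bar>f'' x\<bar> \<le> B"
  shows "\<bar>f (a + h) - f a - h * f' a\<bar> \<le> B * h\<^sup>2"
proof -
  have L: "\<bar>f' (a + k) - f' a\<bar> \<le> B * \<bar>k\<bar>" for k
    using field_differentiable_bound[of UNIV f' f'' B "a + k" a] f' B by simp
  define g where "g k = f (a + k) - k * f' a" for k
  have g: "(g has_real_derivative f' (a + k) - f' a) (at k)" for k
  proof -
    have "((\<lambda>k. f (a + k)) has_real_derivative f' (a + k) * 1) (at k)"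
      by (rule DERIV_chain2[where f = f]) (auto intro!: f derivative_eq_intros)
    thus ?thesis unfolding g_def by (auto intro!: derivative_eq_intros)
  qed
  have "norm (g h - g 0) \<le> (B * \<bar>h\<bar>) * norm (h - 0)"
  proof (rule field_differentiable_bound[of "cball 0 \<bar>h\<bar>" g "\<lambda>k. f' (a + k) - f' a"])
    show "norm (f' (a + k) - f' a) \<le> B * \<bar>h\<bar>" if "k \<in> cball 0 \<bar>h\<bar>" for k
    proof -
      have "B \<ge> 0" using B[of 0] by linarith
      hence "B * \<bar>k\<bar> \<le> B * \<bar>h\<bar>" using that by (intro mult_left_mono) auto
      thus ?thesis using L[of k] by simp
    qed
  qed (auto intro: has_field_derivative_at_within[OF g])
  thus ?thesis by (simp add: g_def power2_eq_square algebra_simps)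
qed

lemma DERIV_from_quadratic_bound:
  fixes f :: "real \<Rightarrow> real"
  assumes "\<And>h. \<bar>f (x + h) - f x - h * D\<bar> \<le> C * h\<^sup>2"
  shows "(f has_real_derivative D) (at x)"
proof -
  have "((\<lambda>h. (f (x + h) - f x) / h - D) \<longlongrightarrow> 0) (at 0)"
  proof (rule Lim_null_comparison)
    have "norm ((f (x + h) - f x) / h - D) \<le> C * \<bar>h\<bar>" if "h \<noteq> 0" for h
    proof -
      have "\<bar>(f (x + h) - f x) / h - D\<bar> = \<bar>f (x + h) - f x - h * D\<bar> / \<bar>h\<bar>"
        using that by (simp add: field_simps flip: abs_divide)
      also have "\<dots> \<le> C * h\<^sup>2 / \<bar>h\<bar>" using assms by (intro divide_right_mono) auto
      also have "\<dots> = C * \<bar>h\<bar>" using that by (simp add: power2_eq_square abs_if)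
      finally show ?thesis by simp
    qed
    thus "\<forall>\<^sub>F h in at 0. norm ((f (x + h) - f x) / h - D) \<le> C * \<bar>h\<bar>"
      by (auto simp: eventually_at_filter)
    have "((\<lambda>h. C * \<bar>h\<bar>) \<longlongrightarrow> C * \<bar>0\<bar>) (at 0)" by (intro tendsto_intros)
    thus "((\<lambda>h. C * \<bar>h\<bar>) \<longlongrightarrow> 0) (at 0)" by simp
  qed
  thus ?thesis unfolding DERIV_def by (rule LIM_zero_cancel)
qed

text \<open>This is the derivative of order i in x and j in t of the mollified w: all derivatives
  fall on the kernel.\<close>

definition conv :: "(nat \<Rightarrow> real \<Rightarrow> real) \<Rightarrow> (real \<times> real \<Rightarrow> real) \<Rightarrow> nat \<Rightarrow> nat \<Rightarrow> real \<Rightarrow> real \<Rightarrow> real" where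
  "conv \<alpha> w i j x t = (LBINT z. w z * (\<alpha> i (x - fst z) * \<alpha> j (t - snd z)))"

lemma lborel_distr_minus: "distr lborel borel (\<lambda>z. p - z) = (lborel :: 'a::euclidean_space measure)"
  using lborel_affine[of "-1" p] by (simp add: density_1)

context
  fixes \<delta> :: real and \<alpha> :: "nat \<Rightarrow> real \<Rightarrow> real"
  assumes M: "mollifier \<delta> \<alpha>"
begin

lemma mollifier_DERIV: "(\<alpha> n has_real_derivative \<alpha> (Suc n) x) (at x)"
  and mollifier_vanishes: "\<delta> \<le> \<bar>x\<bar> \<Longrightarrow> \<alpha> n x = 0"
  and mollifier_nonneg: "0 \<le> \<alpha> 0 x"
  and mollifier_integral: "(LBINT x. \<alpha> 0 x) = 1"
  using M by (auto simp: mollifier_def)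

lemma mollifier_continuous: "continuous_on S (\<alpha> n)"
  by (auto intro!: continuous_at_imp_continuous_on DERIV_isCont mollifier_DERIV)

lemma mollifier_continuous_compose:
  "continuous_on S f \<Longrightarrow> continuous_on S (\<lambda>z. \<alpha> n (f z))"
  by (rule continuous_on_compose2[OF mollifier_continuous[of UNIV]]) auto

lemma conv_integrable:
  assumes "integrable lborel w"
  shows "integrable lborel (\<lambda>z. w z * (\<alpha> i (x - fst z) * \<alpha> j (t - snd z)))"
proof -
  obtain B1 where B1: "\<And>x. \<bar>\<alpha> i x\<bar> \<le> B1" "B1 \<ge> 0" using mollifier_bounded[OF M, of i] by blast
  obtain B2 where B2: "\<And>x. \<bar>\<alpha> j x\<bar> \<le> B2" "B2 \<ge> 0" using mollifier_bounded[OF M, of j] by blast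
  show ?thesis
  proof (rule Bochner_Integration.integrable_bound)
    show "integrable lborel (\<lambda>z. (B1 * B2) * w z)" using assms by simp
    show "(\<lambda>z. w z * (\<alpha> i (x - fst z) * \<alpha> j (t - snd z))) \<in> borel_measurable lborel"
    proof (rule borel_measurable_times)
      show "w \<in> borel_measurable lborel" using assms by (rule borel_measurable_integrable)
      show "(\<lambda>z::real\<times>real. \<alpha> i (x - fst z) * \<alpha> j (t - snd z)) \<in> borel_measurable lborel"
        unfolding measurable_lborel2
        by (intro borel_measurable_continuous_onI continuous_intros mollifier_continuous_compose)
    qed
    have "\<bar>\<alpha> i (x - fst z) * \<alpha> j (t - snd z)\<bar> \<le> B1 * B2" for z :: "real \<times> real"
      unfolding abs_mult by (intro mult_mono) (use B1 B2 in auto)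
    from mult_left_mono[OF this, of "\<bar>w _\<bar>"]
    show "AE z in lborel. norm (w z * (\<alpha> i (x - fst z) * \<alpha> j (t - snd z))) \<le> norm ((B1 * B2) * w z)"
      using B1 B2 by (simp add: abs_mult mult_ac)
  qed
qed

text \<open>The Taylor remainder of the kernel is integrated against |w|. A single constant,
  independent of (x, t), serves three purposes: the expansions identify the derivatives, and the
  bound makes the convolutions Lipschitz.\<close>

lemma conv_diff_bound:
  assumes w: "integrable lborel w"
  shows "\<exists>C. \<forall>x t. \<bar>conv \<alpha> w i j x t\<bar> \<le> C \<and>
    (\<forall>h. \<bar>conv \<alpha> w i j (x + h) t - conv \<alpha> w i j x t - h * conv \<alpha> w (Suc i) j x t\<bar> \<le> C * h\<^sup>2) \<and>
    (\<forall>h. \<bar>conv \<alpha> w i j x (t + h) - conv \<alpha> w i j x t - h * conv \<alpha> w i (Suc j) x t\<bar> \<le> C * h\<^sup>2)"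
proof -
  obtain A0 where A0: "\<And>x. \<bar>\<alpha> i x\<bar> \<le> A0" "A0 \<ge> 0" using mollifier_bounded[OF M, of i] by blast
  obtain B0 where B0: "\<And>x. \<bar>\<alpha> j x\<bar> \<le> B0" "B0 \<ge> 0" using mollifier_bounded[OF M, of j] by blast
  obtain A2 where A2: "\<And>x. \<bar>\<alpha> (Suc (Suc i)) x\<bar> \<le> A2" "A2 \<ge> 0" using mollifier_bounded[OF M] by blast
  obtain B2 where B2: "\<And>x. \<bar>\<alpha> (Suc (Suc j)) x\<bar> \<le> B2" "B2 \<ge> 0" using mollifier_bounded[OF M] by blast
  define I where "I = (LBINT z. \<bar>w z\<bar>)"
  have I0: "I \<ge> 0" unfolding I_def by simp
  have bnd: "\<bar>LBINT z. w z * k z\<bar> \<le> c * I"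
    if "integrable lborel (\<lambda>z. w z * k z)" "\<And>z. \<bar>k z\<bar> \<le> c" for k c
  proof -
    have "\<bar>LBINT z. w z * k z\<bar> \<le> (LBINT z. \<bar>w z * k z\<bar>)" by simp
    also have "\<dots> \<le> (LBINT z. c * \<bar>w z\<bar>)"
    proof (rule integral_mono)
      show "\<bar>w z * k z\<bar> \<le> c * \<bar>w z\<bar>" for z
        using mult_right_mono[OF that(2), of "\<bar>w z\<bar>" z] by (simp add: abs_mult mult.commute)
    qed (intro integrable_abs integrable_mult_right that w)+
    finally show ?thesis by (simp add: I_def)
  qed
  have 1: "\<bar>conv \<alpha> w i j x t\<bar> \<le> (A0 * B0) * I" for x t
    unfolding conv_def
    by (rule bnd[OF conv_integrable[OF w]]) (unfold abs_mult, intro mult_mono, use A0 B0 in auto)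
  have 2: "\<bar>conv \<alpha> w i j (x + h) t - conv \<alpha> w i j x t - h * conv \<alpha> w (Suc i) j x t\<bar> \<le> (A2 * h\<^sup>2 * B0) * I"
    for x t h
  proof -
    define k where "k z = (\<alpha> i ((x - fst z) + h) - \<alpha> i (x - fst z) - h * \<alpha> (Suc i) (x - fst z)) * \<alpha> j (t - snd z)"
      for z :: "real \<times> real"
    have eq: "w z * k z = w z * (\<alpha> i (x + h - fst z) * \<alpha> j (t - snd z))
        - w z * (\<alpha> i (x - fst z) * \<alpha> j (t - snd z)) - h * (w z * (\<alpha> (Suc i) (x - fst z) * \<alpha> j (t - snd z)))" for z
      by (simp add: k_def algebra_simps)
    have int: "integrable lborel (\<lambda>z. w z * k z)"
      unfolding eq by (intro Bochner_Integration.integrable_diff integrable_mult_right conv_integrable w)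
    have "(LBINT z. w z * k z) = conv \<alpha> w i j (x + h) t - conv \<alpha> w i j x t - h * conv \<alpha> w (Suc i) j x t"
      unfolding eq conv_def
      by (simp add: conv_integrable[OF w] Bochner_Integration.integrable_diff)
    moreover have "\<bar>k z\<bar> \<le> A2 * h\<^sup>2 * B0" for z
      unfolding k_def abs_mult
      by (intro mult_mono DERIV_Taylor2_bound[where f'' = "\<alpha> (Suc (Suc i))"] mollifier_DERIV)
        (use A2 B0 in auto)
    ultimately show ?thesis using bnd[OF int] by simp
  qed
  have 3: "\<bar>conv \<alpha> w i j x (t + h) - conv \<alpha> w i j x t - h * conv \<alpha> w i (Suc j) x t\<bar> \<le> (A0 * (B2 * h\<^sup>2)) * I"
    for x t h
  proof -
    define k where "k z = \<alpha> i (x - fst z) * (\<alpha> j ((t - snd z) + h) - \<alpha> j (t - snd z) - h * \<alpha> (Suc j) (t - snd z))"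
      for z :: "real \<times> real"
    have eq: "w z * k z = w z * (\<alpha> i (x - fst z) * \<alpha> j (t + h - snd z))
        - w z * (\<alpha> i (x - fst z) * \<alpha> j (t - snd z)) - h * (w z * (\<alpha> i (x - fst z) * \<alpha> (Suc j) (t - snd z)))" for z
      by (simp add: k_def algebra_simps)
    have int: "integrable lborel (\<lambda>z. w z * k z)"
      unfolding eq by (intro Bochner_Integration.integrable_diff integrable_mult_right conv_integrable w)
    have "(LBINT z. w z * k z) = conv \<alpha> w i j x (t + h) - conv \<alpha> w i j x t - h * conv \<alpha> w i (Suc j) x t"
      unfolding eq conv_def
      by (simp add: conv_integrable[OF w] Bochner_Integration.integrable_diff)
    moreover have "\<bar>k z\<bar> \<le> A0 * (B2 * h\<^sup>2)" for z
      unfolding k_def abs_mult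
      by (intro mult_mono DERIV_Taylor2_bound[where f'' = "\<alpha> (Suc (Suc j))"] mollifier_DERIV)
        (use A0 B2 in auto)
    ultimately show ?thesis using bnd[OF int] by simp
  qed
  define C where "C = (A0 * B0) * I + (A2 * B0) * I + (A0 * B2) * I"
  have nn: "(A0 * B0) * I \<ge> 0" "(A2 * B0) * I \<ge> 0" "(A0 * B2) * I \<ge> 0"
    using A0 B0 A2 B2 I0 by auto
  have C: "(A0 * B0) * I \<le> C" "(A2 * h\<^sup>2 * B0) * I \<le> C * h\<^sup>2" "(A0 * (B2 * h\<^sup>2)) * I \<le> C * h\<^sup>2" for h
  proof -
    show "(A0 * B0) * I \<le> C" using nn by (simp add: C_def)
    have "(A2 * B0) * I * h\<^sup>2 \<le> C * h\<^sup>2" "(A0 * B2) * I * h\<^sup>2 \<le> C * h\<^sup>2"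
      by (intro mult_right_mono; use nn in \<open>simp add: C_def\<close>)+
    thus "(A2 * h\<^sup>2 * B0) * I \<le> C * h\<^sup>2" "(A0 * (B2 * h\<^sup>2)) * I \<le> C * h\<^sup>2" by (simp_all add: mult_ac)
  qed
  show ?thesis
    by (intro exI[of _ C] allI conjI) (use 1 2 3 C in \<open>blast intro: order_trans\<close>)+
qed

lemma conv_DERIV_x:
  "integrable lborel w \<Longrightarrow> ((\<lambda>x. conv \<alpha> w i j x t) has_real_derivative conv \<alpha> w (Suc i) j x t) (at x)"
  using conv_diff_bound[of w i j] DERIV_from_quadratic_bound by metis

lemma conv_DERIV_t:
  "integrable lborel w \<Longrightarrow> ((\<lambda>t. conv \<alpha> w i j x t) has_real_derivative conv \<alpha> w i (Suc j) x t) (at t)"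
  using conv_diff_bound[of w i j] DERIV_from_quadratic_bound[of "\<lambda>t. conv \<alpha> w i j x t"] by metis

text \<open>Both partial derivatives are convolutions of the same kind, hence bounded; this gives
  joint Lipschitz continuity.\<close>

lemma conv_continuous_on:
  assumes w: "integrable lborel w"
  shows "continuous_on S (\<lambda>z. conv \<alpha> w i j (fst z) (snd z))"
proof -
  obtain C1 where C1: "\<And>x t. \<bar>conv \<alpha> w (Suc i) j x t\<bar> \<le> C1" using conv_diff_bound[OF w] by blast
  obtain C2 where C2: "\<And>x t. \<bar>conv \<alpha> w i (Suc j) x t\<bar> \<le> C2" using conv_diff_bound[OF w] by blast
  have "(C1 + C2)-lipschitz_on UNIV (\<lambda>z. conv \<alpha> w i j (fst z) (snd z))"
  proof (rule lipschitz_onI)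
    show "C1 + C2 \<ge> 0" using C1[of 0 0] C2[of 0 0] by linarith
    fix z z' :: "real \<times> real"
    have "\<bar>conv \<alpha> w i j (fst z) (snd z) - conv \<alpha> w i j (fst z') (snd z)\<bar> \<le> C1 * \<bar>fst z - fst z'\<bar>"
      using field_differentiable_bound[of UNIV "\<lambda>x. conv \<alpha> w i j x (snd z)", OF _ conv_DERIV_x[OF w]] C1
      by simp
    moreover have "\<bar>conv \<alpha> w i j (fst z') (snd z) - conv \<alpha> w i j (fst z') (snd z')\<bar> \<le> C2 * \<bar>snd z - snd z'\<bar>"
      using field_differentiable_bound[of UNIV "\<lambda>t. conv \<alpha> w i j (fst z') t", OF _ conv_DERIV_t[OF w]] C2
      by simp
    moreover have "C1 * \<bar>fst z - fst z'\<bar> \<le> C1 * dist z z'" "C2 * \<bar>snd z - snd z'\<bar> \<le> C2 * dist z z'"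
      using C1[of 0 0] C2[of 0 0] dist_fst_le[of z z'] dist_snd_le[of z z']
      by (auto intro!: mult_left_mono simp: dist_real_def)
    ultimately show "dist (conv \<alpha> w i j (fst z) (snd z)) (conv \<alpha> w i j (fst z') (snd z')) \<le> (C1 + C2) * dist z z'"
      by (simp add: dist_real_def algebra_simps)
  qed
  thus ?thesis using lipschitz_on_continuous_on continuous_on_subset by blast
qed

lemma kernel_integral: "(LBINT z. \<alpha> 0 (fst z) * \<alpha> 0 (snd z)) = 1"
  and kernel_integrable: "integrable lborel (\<lambda>z. \<alpha> i (fst z) * \<alpha> j (snd z))"
proof -
  show int: "integrable lborel (\<lambda>z. \<alpha> i (fst z) * \<alpha> j (snd z))" for i j
  proof (rule continuous_compact_support_integrable[where K = "{-\<delta>..\<delta>} \<times> {-\<delta>..\<delta>}"])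
    show "\<alpha> i (fst z) * \<alpha> j (snd z) = 0" if "z \<notin> {-\<delta>..\<delta>} \<times> {-\<delta>..\<delta>}" for z
    proof -
      have "\<delta> \<le> \<bar>fst z\<bar> \<or> \<delta> \<le> \<bar>snd z\<bar>" using that by (cases z) auto
      thus ?thesis using mollifier_vanishes by auto
    qed
  qed (intro continuous_intros mollifier_continuous_compose compact_Times compact_Icc)+
  have "(LBINT z. \<alpha> 0 (fst z) * \<alpha> 0 (snd z)) = integral\<^sup>L (lborel \<Otimes>\<^sub>M lborel) (\<lambda>(x, y). \<alpha> 0 x * \<alpha> 0 y)"
    by (simp add: lborel_prod case_prod_beta')
  also have "\<dots> = (LBINT x. LBINT y. \<alpha> 0 x * \<alpha> 0 y)"
    by (rule lborel_pair.integral_fst[symmetric]) (use int[of 0 0] in \<open>simp add: lborel_prod case_prod_beta'\<close>)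
  finally show "(LBINT z. \<alpha> 0 (fst z) * \<alpha> 0 (snd z)) = 1"
    by (simp add: mollifier_integral)
qed

text \<open>Reflection fixes the kernel at the origin, so that convolutions at different points can
  be compared under one integral.\<close>

lemma conv_flip:
  assumes "w \<in> borel_measurable borel"
  shows "conv \<alpha> w i j x t = (LBINT z. w ((x, t) - z) * (\<alpha> i (fst z) * \<alpha> j (snd z)))"
proof -
  have "conv \<alpha> w i j x t = integral\<^sup>L (distr lborel borel (\<lambda>z. (x, t) - z))
      (\<lambda>z. w z * (\<alpha> i (x - fst z) * \<alpha> j (t - snd z)))"
    by (simp add: conv_def lborel_distr_minus)
  also have "\<dots> = (LBINT z. w ((x, t) - z) * (\<alpha> i (fst z) * \<alpha> j (snd z)))"
  proof (subst integral_distr)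
    have "(\<lambda>z::real\<times>real. \<alpha> i (x - fst z) * \<alpha> j (t - snd z)) \<in> borel_measurable borel"
      by (intro borel_measurable_continuous_onI continuous_intros mollifier_continuous_compose)
    thus "(\<lambda>z. w z * (\<alpha> i (x - fst z) * \<alpha> j (t - snd z))) \<in> borel_measurable borel"
      using assms by (rule borel_measurable_times[rotated])
  qed auto
  finally show ?thesis .
qed

lemma conv_flip_integrable:
  assumes w: "integrable lborel w"
  shows "integrable lborel (\<lambda>z. w ((x, t) - z) * (\<alpha> i (fst z) * \<alpha> j (snd z)))"
proof -
  obtain B1 where B1: "\<And>x. \<bar>\<alpha> i x\<bar> \<le> B1" "B1 \<ge> 0" using mollifier_bounded[OF M, of i] by blast
  obtain B2 where B2: "\<And>x. \<bar>\<alpha> j x\<bar> \<le> B2" "B2 \<ge> 0" using mollifier_bounded[OF M, of j] by blast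
  have wm: "w \<in> borel_measurable borel" using borel_measurable_integrable[OF w] by simp
  have sh: "integrable lborel (\<lambda>z. w ((x, t) - z))"
    using integrable_distr_eq[of "\<lambda>z. (x, t) - z" lborel borel w] wm w
    by (simp add: lborel_distr_minus)
  show ?thesis
  proof (rule Bochner_Integration.integrable_bound)
    show "integrable lborel (\<lambda>z. (B1 * B2) * w ((x, t) - z))" using sh by simp
    show "(\<lambda>z. w ((x, t) - z) * (\<alpha> i (fst z) * \<alpha> j (snd z))) \<in> borel_measurable lborel"
      by (intro borel_measurable_times borel_measurable_integrable[OF sh] borel_measurable_integrable[OF kernel_integrable])
    have "\<bar>\<alpha> i (fst z) * \<alpha> j (snd z)\<bar> \<le> B1 * B2" for z :: "real \<times> real"
      unfolding abs_mult by (intro mult_mono) (use B1 B2 in auto)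
    hence "\<bar>w ((x, t) - z)\<bar> * \<bar>\<alpha> i (fst z) * \<alpha> j (snd z)\<bar> \<le> \<bar>w ((x, t) - z)\<bar> * (B1 * B2)" for z
      by (intro mult_left_mono) auto
    thus "AE z in lborel. norm (w ((x, t) - z) * (\<alpha> i (fst z) * \<alpha> j (snd z))) \<le> norm ((B1 * B2) * w ((x, t) - z))"
      using B1 B2 by (intro AE_I2) (simp add: abs_mult mult_ac)
  qed
qed

lemma conv_mono:
  assumes w: "integrable lborel w" and w': "integrable lborel w'"
    and le: "\<And>y s. \<bar>y\<bar> < \<delta> \<Longrightarrow> \<bar>s\<bar> < \<delta> \<Longrightarrow> w (x - y, t - s) + c \<le> w' (x' - y, t' - s)"
  shows "conv \<alpha> w 0 0 x t + c \<le> conv \<alpha> w' 0 0 x' t'"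
proof -
  have wm: "w \<in> borel_measurable borel" "w' \<in> borel_measurable borel"
    using borel_measurable_integrable[OF w] borel_measurable_integrable[OF w'] by simp_all
  have "conv \<alpha> w 0 0 x t + c = (LBINT z. w ((x, t) - z) * (\<alpha> 0 (fst z) * \<alpha> 0 (snd z)))
      + (LBINT z. c * (\<alpha> 0 (fst z) * \<alpha> 0 (snd z)))"
    by (simp add: conv_flip[OF wm(1)] kernel_integral)
  also have "\<dots> = (LBINT z. w ((x, t) - z) * (\<alpha> 0 (fst z) * \<alpha> 0 (snd z)) + c * (\<alpha> 0 (fst z) * \<alpha> 0 (snd z)))"
    by (intro Bochner_Integration.integral_add[symmetric] conv_flip_integrable w integrable_mult_right kernel_integrable)
  also have "\<dots> \<le> (LBINT z. w' ((x', t') - z) * (\<alpha> 0 (fst z) * \<alpha> 0 (snd z)))"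
  proof (rule integral_mono)
    show "w ((x, t) - z) * (\<alpha> 0 (fst z) * \<alpha> 0 (snd z)) + c * (\<alpha> 0 (fst z) * \<alpha> 0 (snd z))
        \<le> w' ((x', t') - z) * (\<alpha> 0 (fst z) * \<alpha> 0 (snd z))" for z
    proof (cases "\<bar>fst z\<bar> < \<delta> \<and> \<bar>snd z\<bar> < \<delta>")
      case True
      with le[of "fst z" "snd z"] have "w ((x, t) - z) + c \<le> w' ((x', t') - z)"
        by (cases z) simp
      hence "(w ((x, t) - z) + c) * (\<alpha> 0 (fst z) * \<alpha> 0 (snd z)) \<le> w' ((x', t') - z) * (\<alpha> 0 (fst z) * \<alpha> 0 (snd z))"
        by (intro mult_right_mono mult_nonneg_nonneg mollifier_nonneg)
      thus ?thesis by (simp add: algebra_simps)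
    next
      case False
      hence "\<alpha> 0 (fst z) = 0 \<or> \<alpha> 0 (snd z) = 0" using mollifier_vanishes by auto
      thus ?thesis by auto
    qed
  qed (intro Bochner_Integration.integrable_add conv_flip_integrable w w' integrable_mult_right kernel_integrable)+
  also have "\<dots> = conv \<alpha> w' 0 0 x' t'" by (simp add: conv_flip[OF wm(2)])
  finally show ?thesis .
qed

lemma conv_ge:
  assumes w: "integrable lborel w"
    and le: "\<And>y s. \<bar>y\<bar> < \<delta> \<Longrightarrow> \<bar>s\<bar> < \<delta> \<Longrightarrow> c \<le> w (x - y, t - s)"
  shows "c \<le> conv \<alpha> w 0 0 x t"
  using conv_mono[of "\<lambda>_. 0" w x t c x t] assms by (simp add: conv_def)

lemma conv_le:
  assumes w: "integrable lborel w"
    and le: "\<And>y s. \<bar>y\<bar> < \<delta> \<Longrightarrow> \<bar>s\<bar> < \<delta> \<Longrightarrow> w (x - y, t - s) \<le> c"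
  shows "conv \<alpha> w 0 0 x t \<le> c"
  using conv_mono[of w "\<lambda>_. 0" x t "-c" x t] assms by (simp add: conv_def)

end

section \<open>Mollified strong solutions\<close>

context
  fixes a b :: "nat \<Rightarrow> real \<Rightarrow> real"
  assumes a: "\<And>n x. (a n has_real_derivative a (Suc n) x) (at x)"
    and b: "\<And>n x. (b n has_real_derivative b (Suc n) x) (at x)"
begin

lemma Dx_product: "Dx (\<lambda>z. a i (fst z) * b j (snd z)) = (\<lambda>z. a (Suc i) (fst z) * b j (snd z))"
proof
  fix z :: "real \<times> real"
  obtain x t where z: "z = (x, t)" by (cases z)
  have "((\<lambda>y. a i y * b j t) has_real_derivative a (Suc i) x * b j t) (at x)"
    by (rule DERIV_cmult_right[OF a])
  thus "Dx (\<lambda>z. a i (fst z) * b j (snd z)) z = a (Suc i) (fst z) * b j (snd z)"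
    by (simp add: Dx_def z DERIV_imp_deriv)
qed

lemma Dt_product: "Dt (\<lambda>z. a i (fst z) * b j (snd z)) = (\<lambda>z. a i (fst z) * b (Suc j) (snd z))"
proof
  fix z :: "real \<times> real"
  obtain x t where z: "z = (x, t)" by (cases z)
  have "((\<lambda>s. a i x * b j s) has_real_derivative a i x * b (Suc j) t) (at t)"
    by (rule DERIV_cmult[OF b])
  thus "Dt (\<lambda>z. a i (fst z) * b j (snd z)) z = a i (fst z) * b (Suc j) (snd z)"
    by (simp add: Dt_def z DERIV_imp_deriv)
qed

lemma Ck_product: "Ck k (\<lambda>z. a i (fst z) * b j (snd z))"
proof (induction k arbitrary: i j)
  case 0
  have c: "continuous_on UNIV (a i)" "continuous_on UNIV (b j)"
    by (auto intro!: continuous_at_imp_continuous_on DERIV_isCont a b)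
  have "continuous_on UNIV (\<lambda>z::real\<times>real. a i (fst z))" "continuous_on UNIV (\<lambda>z::real\<times>real. b j (snd z))"
    by (rule continuous_on_compose2[OF c(1)] continuous_on_compose2[OF c(2)];
        simp add: continuous_on_fst continuous_on_snd)+
  thus ?case by (simp add: continuous_on_mult)
next
  case (Suc k)
  have "(\<lambda>z. a i (fst z) * b j (snd z)) differentiable (at z)" for z :: "real \<times> real"
  proof -
    have "((\<lambda>z. a i (fst z)) has_derivative (\<lambda>h. a (Suc i) (fst z) * fst h)) (at z)"
      by (rule has_derivative_compose[OF has_derivative_fst[OF has_derivative_ident]
            a[of i "fst z", unfolded has_field_derivative_def]])
    moreover have "((\<lambda>z. b j (snd z)) has_derivative (\<lambda>h. b (Suc j) (snd z) * snd h)) (at z)"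
      by (rule has_derivative_compose[OF has_derivative_snd[OF has_derivative_ident]
            b[of j "snd z", unfolded has_field_derivative_def]])
    ultimately show ?thesis
      using differentiableI differentiable_mult by blast
  qed
  with Suc show ?case by (simp add: Dx_product Dt_product)
qed

lemma product_test_function:
  assumes "compact K" "K \<subseteq> \<Omega>" "\<And>z. z \<notin> K \<Longrightarrow> a i (fst z) * b j (snd z) = 0"
  shows "(\<lambda>z. a i (fst z) * b j (snd z)) \<in> test_functions \<Omega>"
proof -
  define S where "S = closure {z. a i (fst z) * b j (snd z) \<noteq> 0}"
  have SK: "S \<subseteq> K"
    unfolding S_def by (intro closure_minimal compact_imp_closed assms(1)) (use assms(3) in blast)
  have "closed S" unfolding S_def by (rule closed_closure)
  hence "compact (S \<inter> K)" using assms(1) by (rule closed_Int_compact)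
  hence "compact S" using SK by (simp add: Int_absorb2)
  moreover have "S \<subseteq> \<Omega>" using SK assms(2) by (rule subset_trans)
  ultimately show ?thesis
    unfolding test_functions_def S_def by (intro CollectI conjI allI Ck_product)
qed

end

section \<open>Weak derivatives tested with the mollification kernel\<close>

context
  fixes \<delta> :: real and \<alpha> :: "nat \<Rightarrow> real \<Rightarrow> real" and \<Omega> :: "(real \<times> real) set" and x t :: real
  assumes M: "mollifier \<delta> \<alpha>" and box: "{x - \<delta>..x + \<delta>} \<times> {t - \<delta>..t + \<delta>} \<subseteq> \<Omega>" and open_\<Omega>: "open \<Omega>"
begin

private definition "ker i j z = \<alpha> i (x - fst z) * \<alpha> j (t - snd z)" for i j and z :: "real \<times> real"

text \<open>The kernel factors as functions of the integration variable: differentiating in y or s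
  raises the index and changes the sign.\<close>

private definition "a i n y = (-1) ^ n * \<alpha> (i + n) (x - y)" for i n y
private definition "b j n s = (-1) ^ n * \<alpha> (j + n) (t - s)" for j n s

private lemma ker_eq: "ker i j = (\<lambda>z. a i 0 (fst z) * b j 0 (snd z))"
  by (auto simp: ker_def a_def b_def)

private lemma DERIV_ab: "(a i n has_real_derivative a i (Suc n) y) (at y)"
  "(b i n has_real_derivative b i (Suc n) y) (at y)"
proof -
  have "((\<lambda>y. (-1) ^ n * \<alpha> (i + n) (c - y)) has_real_derivative (-1) ^ Suc n * \<alpha> (i + Suc n) (c - y)) (at y)" for c y
  proof -
    have "((\<lambda>y. \<alpha> (i + n) (c - y)) has_real_derivative \<alpha> (Suc (i + n)) (c - y) * (-1)) (at y)"
      by (rule DERIV_chain2[OF mollifier_DERIV[OF M]]) (auto intro!: derivative_eq_intros)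
    from DERIV_cmult[OF this, of "(-1) ^ n"] show ?thesis by simp
  qed
  thus "(a i n has_real_derivative a i (Suc n) y) (at y)" "(b i n has_real_derivative b i (Suc n) y) (at y)"
    unfolding a_def b_def by blast+
qed

private lemma ker_vanishes: "z \<notin> {x - \<delta>..x + \<delta>} \<times> {t - \<delta>..t + \<delta>} \<Longrightarrow> ker i j z = 0"
proof -
  assume "z \<notin> {x - \<delta>..x + \<delta>} \<times> {t - \<delta>..t + \<delta>}"
  hence "\<delta> \<le> \<bar>x - fst z\<bar> \<or> \<delta> \<le> \<bar>t - snd z\<bar>" by (cases z) auto
  thus ?thesis using mollifier_vanishes[OF M] by (auto simp: ker_def)
qed

private lemma compact_box: "compact ({x - \<delta>..x + \<delta>} \<times> {t - \<delta>..t + \<delta>})"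
  by (intro compact_Times compact_Icc)

private lemma Dx_ker: "Dx (ker i j) = (\<lambda>z. - ker (Suc i) j z)"
  unfolding ker_eq Dx_product[of "a i" "b j", OF DERIV_ab] by (auto simp: a_def b_def)

private lemma Dt_ker: "Dt (ker i j) = (\<lambda>z. - ker i (Suc j) z)"
  unfolding ker_eq Dt_product[of "a i" "b j", OF DERIV_ab] by (auto simp: a_def b_def)

private lemma ker_test: "ker i j \<in> test_functions \<Omega>"
  unfolding ker_eq
proof (rule product_test_function[where a = "a i" and b = "b j", OF DERIV_ab compact_box box])
  fix z assume "z \<notin> {x - \<delta>..x + \<delta>} \<times> {t - \<delta>..t + \<delta>}"
  from ker_vanishes[OF this, of i j] show "a i 0 (fst z) * b j 0 (snd z) = 0" by (simp add: ker_eq)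
qed

private lemma \<Omega>_sets: "\<Omega> \<in> sets lebesgue"
  using open_\<Omega> by auto

private lemma ker_measurable: "ker i j \<in> borel_measurable borel"
  unfolding ker_def[abs_def]
  by (intro borel_measurable_continuous_onI continuous_intros mollifier_continuous_compose[OF M])

private lemma ker_bounded: "\<exists>B. \<forall>z. \<bar>ker i j z\<bar> \<le> B"
proof -
  obtain B1 where B1: "\<And>x. \<bar>\<alpha> i x\<bar> \<le> B1" "B1 \<ge> 0" using mollifier_bounded[OF M, of i] by blast
  obtain B2 where B2: "\<And>x. \<bar>\<alpha> j x\<bar> \<le> B2" "B2 \<ge> 0" using mollifier_bounded[OF M, of j] by blast
  have "\<bar>ker i j z\<bar> \<le> B1 * B2" for z
    unfolding ker_def abs_mult by (intro mult_mono) (use B1 B2 in auto)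
  thus ?thesis by blast
qed

private lemma Lp_loc_mult_ker_integrable:
  assumes "v \<in> Lp_loc 1 \<Omega>"
  shows "integrable (lebesgue_on \<Omega>) (\<lambda>z. v z * ker i j z)"
proof -
  let ?K = "{x - \<delta>..x + \<delta>} \<times> {t - \<delta>..t + \<delta>}"
  obtain B where B: "\<And>z. \<bar>ker i j z\<bar> \<le> B" using ker_bounded by blast
  have vm: "v \<in> borel_measurable (lebesgue_on ?K)" and vi: "integrable (lebesgue_on ?K) (\<lambda>z. \<bar>v z\<bar>)"
    using assms compact_box box by (auto simp: Lp_loc_def)
  have "integrable (lebesgue_on ?K) (\<lambda>z. v z * ker i j z)"
  proof (rule Bochner_Integration.integrable_bound)
    show "integrable (lebesgue_on ?K) (\<lambda>z. B * \<bar>v z\<bar>)" using vi by simp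
    show "(\<lambda>z. v z * ker i j z) \<in> borel_measurable (lebesgue_on ?K)"
      using ker_measurable[of i j]
      by (intro borel_measurable_times[OF vm] measurable_restrict_space1 measurable_completion) auto
    show "AE z in lebesgue_on ?K. norm (v z * ker i j z) \<le> norm (B * \<bar>v z\<bar>)"
    proof (rule AE_I2)
      fix z
      have "\<bar>ker i j z\<bar> * \<bar>v z\<bar> \<le> B * \<bar>v z\<bar>" by (rule mult_right_mono[OF B]) simp
      thus "norm (v z * ker i j z) \<le> norm (B * \<bar>v z\<bar>)" using B[of z] by (simp add: abs_mult mult.commute)
    qed
  qed
  hence "integrable lebesgue (\<lambda>z. indicator ?K z *\<^sub>R (v z * ker i j z))"
    by (subst (asm) integrable_restrict_space) (simp_all add: fmeasurableD[OF lmeasurable_compact[OF compact_box]])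
  also have "(\<lambda>z. indicator ?K z *\<^sub>R (v z * ker i j z)) = (\<lambda>z. indicator \<Omega> z *\<^sub>R (v z * ker i j z))"
    using ker_vanishes box by (intro ext) (auto simp: indicator_def)
  finally show ?thesis
    by (subst integrable_restrict_space) (use \<Omega>_sets in auto)
qed

private lemma conv_eq_set_integral:
  assumes w: "integrable lborel w" and eq: "\<And>z. z \<in> {x - \<delta>..x + \<delta>} \<times> {t - \<delta>..t + \<delta>} \<Longrightarrow> w z = v z"
  shows "conv \<alpha> w i j x t = (LINT z|lebesgue_on \<Omega>. v z * ker i j z)"
proof -
  have "conv \<alpha> w i j x t = (LBINT z. w z * ker i j z)"
    by (simp add: conv_def ker_def)
  also have "\<dots> = (LINT z|lebesgue. w z * ker i j z)"
    using conv_integrable[OF M w, of i x j t]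
    by (intro integral_completion[symmetric]) (auto simp: ker_def[abs_def] dest: borel_measurable_integrable)
  also have "(\<lambda>z. w z * ker i j z) = (\<lambda>z. indicator \<Omega> z *\<^sub>R (v z * ker i j z))"
  proof
    fix z
    show "w z * ker i j z = indicator \<Omega> z *\<^sub>R (v z * ker i j z)"
    proof (cases "z \<in> {x - \<delta>..x + \<delta>} \<times> {t - \<delta>..t + \<delta>}")
      case True
      with eq[OF True] box show ?thesis by auto
    qed (simp add: ker_vanishes)
  qed
  also have "(LINT z|lebesgue. indicator \<Omega> z *\<^sub>R (v z * ker i j z)) = (LINT z|lebesgue_on \<Omega>. v z * ker i j z)"
    by (rule integral_restrict_space[symmetric]) (use \<Omega>_sets in auto)
  finally show ?thesis .
qed

text \<open>The kernel is a test function, so its time derivative can be moved onto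
  \<open>ut\<close>; averaging with a nonnegative kernel of mass at most 1 keeps the upper
  bound.\<close>

lemma conv_weak_Dt_le:
  assumes ut: "weak_deriv Dt \<Omega> u ut" and bd: "AE z in lebesgue_on \<Omega>. \<bar>ut z\<bar> \<le> C"
    and w: "integrable lborel w" and eq: "\<And>z. z \<in> {x - \<delta>..x + \<delta>} \<times> {t - \<delta>..t + \<delta>} \<Longrightarrow> w z = u z"
    and C: "C \<ge> 0"
  shows "conv \<alpha> w 0 (Suc 0) x t \<le> C"
proof -
  let ?K = "{x - \<delta>..x + \<delta>} \<times> {t - \<delta>..t + \<delta>}"
  have K: "integrable lborel (indicat_real ?K)"
    using borel_integrable_compact[OF compact_box, of "\<lambda>_. 1::real"] by (simp add: set_integrable_def)
  have "conv \<alpha> w 0 (Suc 0) x t = (LINT z|lebesgue_on \<Omega>. u z * ker 0 (Suc 0) z)"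
    by (rule conv_eq_set_integral[OF w eq])
  also have "\<dots> = - (LINT z|lebesgue_on \<Omega>. u z * Dt (ker 0 0) z)"
    by (simp add: Dt_ker)
  also have "\<dots> = (LINT z|lebesgue_on \<Omega>. ut z * ker 0 0 z)"
    using ut ker_test[of 0 0] by (auto simp: weak_deriv_def)
  \<comment> \<open>The factor 1 is the constant function, written out so that the facts on products
    with the kernel apply to it. On the box it agrees with the integrable indicator of
    \<open>?K\<close>, whose mollification is at most 1.\<close>
  also have "\<dots> \<le> (LINT z|lebesgue_on \<Omega>. C * (1 * ker 0 0 z))"
  proof (rule integral_mono_AE)
    have "(\<lambda>_. 1) \<in> Lp_loc 1 \<Omega>"
      using emeasure_compact_finite
      by (force simp: Lp_loc_def emeasure_restrict_space compact_imp_closed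
          intro!: finite_measure.integrable_const finite_measureI)
    thus "integrable (lebesgue_on \<Omega>) (\<lambda>z. C * (1 * ker 0 0 z))"
      using Lp_loc_mult_ker_integrable[of "\<lambda>_. 1" 0 0] by simp
    show "integrable (lebesgue_on \<Omega>) (\<lambda>z. ut z * ker 0 0 z)"
      by (rule Lp_loc_mult_ker_integrable) (use ut in \<open>auto simp: weak_deriv_def\<close>)
    show "AE z in lebesgue_on \<Omega>. ut z * ker 0 0 z \<le> C * (1 * ker 0 0 z)"
      using bd
    proof eventually_elim
      case (elim z)
      have "ker 0 0 z \<ge> 0" by (simp add: ker_def mollifier_nonneg[OF M])
      thus ?case using elim by (simp add: mult_right_mono)
    qed
  qed
  also have "\<dots> = C * conv \<alpha> (indicat_real ?K) 0 0 x t"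
    by (subst conv_eq_set_integral[OF K, of "\<lambda>_. 1"]) auto
  also have "\<dots> \<le> C * 1"
    by (intro mult_left_mono C conv_le[OF M K]) (auto simp: indicator_def)
  finally show ?thesis by simp
qed

text \<open>The kernel absorbs one time derivative or two space derivatives, by the definition of
  weak derivative. It lives on the box where the globally integrable \<open>w\<close> agrees with
  \<open>u\<close>. General \<open>i\<close> and \<open>j\<close> also give the differentiated
  equations.\<close>

lemma conv_heat_equation:
  assumes sol: "strong_solution F \<Omega> u"
    and w: "integrable lborel w" and eq: "\<And>z. z \<in> {x - \<delta>..x + \<delta>} \<times> {t - \<delta>..t + \<delta>} \<Longrightarrow> w z = u z"
    and Fw: "integrable lborel (\<lambda>z. F (w z))"
  shows "conv \<alpha> w i (Suc j) x t = conv \<alpha> w (Suc (Suc i)) j x t + conv \<alpha> (\<lambda>z. F (w z)) i j x t"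
proof -
  obtain ut ux uxx where ut: "weak_deriv Dt \<Omega> u ut" and ux: "weak_deriv Dx \<Omega> u ux" and uxx: "weak_deriv Dx \<Omega> ux uxx"
    and ae: "AE z in lebesgue_on \<Omega>. ut z - uxx z = F (u z)"
    using sol by (auto simp: strong_solution_def)
  have "conv \<alpha> w i (Suc j) x t = (LINT z|lebesgue_on \<Omega>. u z * ker i (Suc j) z)"
    by (rule conv_eq_set_integral[OF w eq])
  also have "\<dots> = - (LINT z|lebesgue_on \<Omega>. u z * Dt (ker i j) z)"
    by (simp add: Dt_ker)
  also have "\<dots> = (LINT z|lebesgue_on \<Omega>. ut z * ker i j z)"
    using ut ker_test[of i j] by (auto simp: weak_deriv_def)
  finally have 1: "conv \<alpha> w i (Suc j) x t = (LINT z|lebesgue_on \<Omega>. ut z * ker i j z)" .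
  have "conv \<alpha> w (Suc (Suc i)) j x t = (LINT z|lebesgue_on \<Omega>. u z * ker (Suc (Suc i)) j z)"
    by (rule conv_eq_set_integral[OF w eq])
  also have "\<dots> = - (LINT z|lebesgue_on \<Omega>. u z * Dx (ker (Suc i) j) z)"
    by (simp add: Dx_ker)
  also have "\<dots> = (LINT z|lebesgue_on \<Omega>. ux z * ker (Suc i) j z)"
    using ux ker_test[of "Suc i" j] by (auto simp: weak_deriv_def)
  also have "\<dots> = - (LINT z|lebesgue_on \<Omega>. ux z * Dx (ker i j) z)"
    by (simp add: Dx_ker)
  also have "\<dots> = (LINT z|lebesgue_on \<Omega>. uxx z * ker i j z)"
    using uxx ker_test[of i j] by (auto simp: weak_deriv_def)
  finally have 2: "conv \<alpha> w (Suc (Suc i)) j x t = (LINT z|lebesgue_on \<Omega>. uxx z * ker i j z)" .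
  have int: "integrable (lebesgue_on \<Omega>) (\<lambda>z. ut z * ker i j z)" "integrable (lebesgue_on \<Omega>) (\<lambda>z. uxx z * ker i j z)"
    by (rule Lp_loc_mult_ker_integrable; use ut uxx in \<open>auto simp: weak_deriv_def\<close>)+
  have "conv \<alpha> (\<lambda>z. F (w z)) i j x t = (LINT z|lebesgue_on \<Omega>. F (u z) * ker i j z)"
    by (rule conv_eq_set_integral[OF Fw]) (simp add: eq)
  also have "\<dots> = (LINT z|lebesgue_on \<Omega>. ut z * ker i j z - uxx z * ker i j z)"
  proof (rule integral_cong_AE)
    \<comment> \<open>Measurability is inherited from \<open>w\<close>; where \<open>u\<close> and
      \<open>w\<close> may differ, the kernel vanishes.\<close>
    have "(\<lambda>z. F (u z) * ker i j z) = (\<lambda>z. F (w z) * ker i j z)"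
    proof
      show "F (u z) * ker i j z = F (w z) * ker i j z" for z
      proof (cases "z \<in> {x - \<delta>..x + \<delta>} \<times> {t - \<delta>..t + \<delta>}")
        case False
        show ?thesis using ker_vanishes[OF False, of i j] by simp
      qed (simp only: eq)
    qed
    moreover have "(\<lambda>z. F (w z) * ker i j z) \<in> borel_measurable lborel"
      using borel_measurable_integrable[OF conv_integrable[OF M Fw, of i x j t]] by (simp add: ker_def)
    ultimately show "(\<lambda>z. F (u z) * ker i j z) \<in> borel_measurable (lebesgue_on \<Omega>)"
      by (simp only:) (intro measurable_restrict_space1 measurable_completion)
    show "(\<lambda>z. ut z * ker i j z - uxx z * ker i j z) \<in> borel_measurable (lebesgue_on \<Omega>)"
      by (intro borel_measurable_diff borel_measurable_integrable int)
    show "AE z in lebesgue_on \<Omega>. F (u z) * ker i j z = ut z * ker i j z - uxx z * ker i j z"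
      using ae by eventually_elim (simp flip: left_diff_distrib)
  qed
  also have "\<dots> = (LINT z|lebesgue_on \<Omega>. ut z * ker i j z) - (LINT z|lebesgue_on \<Omega>. uxx z * ker i j z)"
    by (rule Bochner_Integration.integral_diff[OF int])
  finally show ?thesis using 1 2 by simp
qed

end

section \<open>Approximation and the maximum principle\<close>

lemma closure_Q: "closure Q = {-1..1} \<times> {0..}"
  by (simp add: Q_def closure_Times)

lemma open_Q: "open Q"
  unfolding Q_def by (intro open_Times) auto

text \<open>The cutoff only makes \<open>u\<close> integrable; mollifications are evaluated where it equals \<open>u\<close>.\<close>

definition cut :: "real \<Rightarrow> (real \<times> real \<Rightarrow> real) \<Rightarrow> real \<times> real \<Rightarrow> real" where
  "cut T u z = indicator ({-1..1} \<times> {0..T}) z * u z"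

lemma cut_integrable:
  assumes "continuous_on (closure Q) u"
  shows "integrable lborel (cut T u)"
proof -
  have "integrable lborel (\<lambda>z. indicator ({-1..1} \<times> {0..T}) z *\<^sub>R u z)"
    by (rule borel_integrable_compact) (auto intro!: compact_Times continuous_on_subset[OF assms] simp: closure_Q)
  thus ?thesis by (simp add: cut_def[abs_def])
qed

lemma source_cut_integrable:
  assumes u: "continuous_on (closure Q) u" and F: "F \<in> borel_measurable borel" "F 0 = 0" "\<And>x. \<bar>F x\<bar> \<le> (1::real)"
  shows "integrable lborel (\<lambda>z. F (cut T u z))"
proof (rule Bochner_Integration.integrable_bound)
  show "integrable lborel (cut T (\<lambda>_. 1))" by (rule cut_integrable) auto
  show "(\<lambda>z. F (cut T u z)) \<in> borel_measurable lborel"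
    using borel_measurable_integrable[OF cut_integrable[OF u, of T]] F(1) by (rule measurable_compose)
  show "AE z in lborel. norm (F (cut T u z)) \<le> norm (cut T (\<lambda>_. 1) z)"
    using F(2,3) by (intro AE_I2) (auto simp: cut_def indicator_def)
qed

text \<open>Averaging changes a value by at most the oscillation of \<open>v\<close> over the box,
  whose points lie within |y| + |s| < 2 \<delta> of the centre. Uniform continuity on K makes the
  threshold independent of the point and of the mollifier.\<close>

lemma conv_uniform_approximation:
  assumes w: "integrable lborel w" and K: "compact K" and v: "continuous_on K v"
    and wv: "\<And>z. z \<in> K \<Longrightarrow> w z = v z" and \<eta>: "\<eta> > 0"
  obtains d where "d > 0"
    "\<And>\<delta> \<alpha> x t. mollifier \<delta> \<alpha> \<Longrightarrow> \<delta> < d \<Longrightarrow> {x - \<delta>..x + \<delta>} \<times> {t - \<delta>..t + \<delta>} \<subseteq> K \<Longrightarrow>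
      \<bar>conv \<alpha> w 0 0 x t - v (x, t)\<bar> \<le> \<eta>"
proof -
  obtain d where d: "d > 0" "\<And>z z'. z \<in> K \<Longrightarrow> z' \<in> K \<Longrightarrow> dist z' z < d \<Longrightarrow> dist (v z') (v z) < \<eta>"
    using compact_uniformly_continuous[OF v K] \<eta> unfolding uniformly_continuous_on_def by metis
  show ?thesis
  proof (rule that[of "d / 2"])
    fix \<delta> \<alpha> x t assume M: "mollifier \<delta> \<alpha>" and \<delta>: "\<delta> < d / 2" and box: "{x - \<delta>..x + \<delta>} \<times> {t - \<delta>..t + \<delta>} \<subseteq> K"
    have near: "\<bar>w (x - y, t - s) - v (x, t)\<bar> < \<eta>" if "\<bar>y\<bar> < \<delta>" "\<bar>s\<bar> < \<delta>" for y s
    proof -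
      have "dist (x - y, t - s) (x, t) \<le> \<bar>y\<bar> + \<bar>s\<bar>"
        using sqrt_sum_squares_le_sum_abs[of y s] by (simp add: dist_Pair_Pair dist_real_def)
      moreover have "(x - y, t - s) \<in> K" "(x, t) \<in> K" using box that by (auto simp: subset_iff abs_less_iff)
      ultimately show ?thesis
        using d(2)[of "(x, t)" "(x - y, t - s)"] wv[of "(x - y, t - s)"] that \<delta> by (simp add: dist_real_def)
    qed
    have "v (x, t) - \<eta> \<le> conv \<alpha> w 0 0 x t"
      by (rule conv_ge[OF M w]) (use near in \<open>force simp: abs_less_iff\<close>)
    moreover have "conv \<alpha> w 0 0 x t \<le> v (x, t) + \<eta>"
      by (rule conv_le[OF M w]) (use near in \<open>force simp: abs_less_iff\<close>)
    ultimately show "\<bar>conv \<alpha> w 0 0 x t - v (x, t)\<bar> \<le> \<eta>" by linarith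
  qed (use d(1) in simp)
qed

text \<open>Because \<open>F\<close> is continuous, the mollified source is uniformly close to
  \<open>F (u z)\<close>, so \<open>W\<close> satisfies the equation up to \<eta>. The value
  \<open>F 0 = 0\<close> keeps the source of the cut-off function integrable.\<close>

lemma smooth_approximation:
  fixes T :: real
  assumes sol: "strong_solution F Q u" and u: "continuous_on (closure Q) u"
    and F: "continuous_on UNIV F" "F 0 = 0" "\<And>x. \<bar>F x\<bar> \<le> 1" and \<rho>: "\<rho> > 0" and \<eta>: "\<eta> > 0"
  obtains W Wt Wx Wxx where
    "\<And>x t. ((\<lambda>t. W x t) has_real_derivative Wt x t) (at t)"
    "\<And>x t. ((\<lambda>x. W x t) has_real_derivative Wx x t) (at x)"
    "\<And>x t. ((\<lambda>x. Wx x t) has_real_derivative Wxx x t) (at x)"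
    "continuous_on UNIV (\<lambda>z. W (fst z) (snd z))"
    "\<And>x t. x \<in> {-1 + \<rho>..1 - \<rho>} \<Longrightarrow> t \<in> {\<rho>..T} \<Longrightarrow> \<bar>W x t - u (x, t)\<bar> \<le> \<eta>"
    "\<And>x t. x \<in> {-1 + \<rho>..1 - \<rho>} \<Longrightarrow> t \<in> {\<rho>..T} \<Longrightarrow> \<bar>Wt x t - Wxx x t - F (u (x, t))\<bar> \<le> \<eta>"
proof -
  define K where "K = {-1..1::real} \<times> {0..T + 1}"
  have K: "compact K" unfolding K_def by (intro compact_Times compact_Icc)
  have uK: "continuous_on K u" by (rule continuous_on_subset[OF u]) (auto simp: K_def closure_Q)
  have FuK: "continuous_on K (\<lambda>z. F (u z))" by (rule continuous_on_compose2[OF F(1) uK]) simp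
  define w where "w = cut (T + 1) u"
  have w: "integrable lborel w" unfolding w_def by (rule cut_integrable[OF u])
  have Fw: "integrable lborel (\<lambda>z. F (w z))" unfolding w_def
    by (rule source_cut_integrable[OF u borel_measurable_continuous_onI[OF F(1)] F(2,3)])
  have wu: "w z = u z" if "z \<in> K" for z using that by (auto simp: w_def cut_def K_def)
  obtain d1 where d1: "d1 > 0" "\<And>\<delta> \<alpha> x t. mollifier \<delta> \<alpha> \<Longrightarrow> \<delta> < d1 \<Longrightarrow>
      {x - \<delta>..x + \<delta>} \<times> {t - \<delta>..t + \<delta>} \<subseteq> K \<Longrightarrow> \<bar>conv \<alpha> w 0 0 x t - u (x, t)\<bar> \<le> \<eta>"
    using conv_uniform_approximation[OF w K uK wu \<eta>] by blast
  obtain d2 where d2: "d2 > 0" "\<And>\<delta> \<alpha> x t. mollifier \<delta> \<alpha> \<Longrightarrow> \<delta> < d2 \<Longrightarrow>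
      {x - \<delta>..x + \<delta>} \<times> {t - \<delta>..t + \<delta>} \<subseteq> K \<Longrightarrow> \<bar>conv \<alpha> (\<lambda>z. F (w z)) 0 0 x t - F (u (x, t))\<bar> \<le> \<eta>"
    using conv_uniform_approximation[OF Fw K FuK _ \<eta>] wu by metis
  define \<delta> where "\<delta> = Min {\<rho> / 2, 1, d1 / 2, d2 / 2}"
  have \<delta>: "\<delta> > 0" "\<delta> < \<rho>" "\<delta> \<le> 1" "\<delta> < d1" "\<delta> < d2"
    using \<rho> d1(1) d2(1) by (auto simp: \<delta>_def)
  obtain \<alpha> where M: "mollifier \<delta> \<alpha>" using mollifier_exists[OF \<delta>(1)] .
  show ?thesis
  proof (rule that)
    show "((\<lambda>t. conv \<alpha> w 0 0 x t) has_real_derivative conv \<alpha> w 0 (Suc 0) x t) (at t)" for x t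
      by (rule conv_DERIV_t[OF M w])
    show "((\<lambda>x. conv \<alpha> w 0 0 x t) has_real_derivative conv \<alpha> w (Suc 0) 0 x t) (at x)" for x t
      by (rule conv_DERIV_x[OF M w])
    show "((\<lambda>x. conv \<alpha> w (Suc 0) 0 x t) has_real_derivative conv \<alpha> w (Suc (Suc 0)) 0 x t) (at x)" for x t
      by (rule conv_DERIV_x[OF M w])
    show "continuous_on UNIV (\<lambda>z. conv \<alpha> w 0 0 (fst z) (snd z))"
      by (rule conv_continuous_on[OF M w])
  next
    fix x t assume xt: "x \<in> {-1 + \<rho>..1 - \<rho>}" "t \<in> {\<rho>..T}"
    have box: "{x - \<delta>..x + \<delta>} \<times> {t - \<delta>..t + \<delta>} \<subseteq> Q" "{x - \<delta>..x + \<delta>} \<times> {t - \<delta>..t + \<delta>} \<subseteq> K"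
      using xt \<delta> by (auto simp: Q_def K_def)
    show "\<bar>conv \<alpha> w 0 0 x t - u (x, t)\<bar> \<le> \<eta>" by (rule d1(2)[OF M \<delta>(4) box(2)])
    have "conv \<alpha> w 0 (Suc 0) x t = conv \<alpha> w (Suc (Suc 0)) 0 x t + conv \<alpha> (\<lambda>z. F (w z)) 0 0 x t"
      by (rule conv_heat_equation[OF M box(1) open_Q sol w _ Fw]) (use wu box(2) in blast)
    thus "\<bar>conv \<alpha> w 0 (Suc 0) x t - conv \<alpha> w (Suc (Suc 0)) 0 x t - F (u (x, t))\<bar> \<le> \<eta>"
      using d2(2)[OF M \<delta>(5) box(2)] by simp
  qed
qed

section \<open>A maximum principle by smooth approximation\<close>

lemma DERIV2_local_max:
  fixes f :: "real \<Rightarrow> real"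
  assumes f: "\<And>x. (f has_real_derivative f' x) (at x)" and f': "(f' has_real_derivative f'') (at x)"
    and r: "r > 0" and max: "\<And>y. \<bar>y - x\<bar> < r \<Longrightarrow> f y \<le> f x"
  shows "f'' \<le> 0"
proof (rule ccontr)
  assume "\<not> f'' \<le> 0"
  then obtain d where d: "d > 0" "\<And>h. 0 < h \<Longrightarrow> h < d \<Longrightarrow> f' x < f' (x + h)"
    using DERIV_pos_inc_right[OF f'] by auto
  have f'0: "f' x = 0"
    by (rule DERIV_local_max[OF f r]) (use max in \<open>auto simp: abs_minus_commute\<close>)
  define h where "h = min d r / 2"
  have h: "0 < h" "h < d" "h < r" using d(1) r by (auto simp: h_def)
  obtain \<xi> where \<xi>: "x < \<xi>" "\<xi> < x + h" "f (x + h) - f x = (x + h - x) * f' \<xi>"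
    using MVT2[of x "x + h" f f'] f h by auto
  have "f' \<xi> > 0" using d(2)[of "\<xi> - x"] \<xi> h f'0 by auto
  hence "f (x + h) > f x" using \<xi>(3) h by (simp add: algebra_simps)
  thus False using max[of "x + h"] h by simp
qed

lemma DERIV_left_max:
  fixes f :: "real \<Rightarrow> real"
  assumes f: "(f has_real_derivative f') (at x)" and r: "r > 0"
    and max: "\<And>y. x - r < y \<Longrightarrow> y \<le> x \<Longrightarrow> f y \<le> f x"
  shows "f' \<ge> 0"
proof (rule ccontr)
  assume "\<not> f' \<ge> 0"
  then obtain d where d: "d > 0" "\<And>h. 0 < h \<Longrightarrow> h < d \<Longrightarrow> f x < f (x - h)"
    using DERIV_neg_dec_left[OF f] by auto
  define h where "h = min d r / 2"
  have h: "0 < h" "h < d" "h < r" using d(1) r by (auto simp: h_def)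
  show False using d(2)[of h] max[of "x - h"] h by simp
qed

text \<open>The function \<open>d\<close> need not be differentiable, so the tests at a maximum are
  applied to smooth approximations \<open>D\<close>. These are controlled only at distance \<rho>
  from the parabolic boundary; hence the candidates for a positive maximum are first confined to a
  compact set away from it, and \<rho> is read off from that set.\<close>

lemma parabolic_max_principle:
  fixes d :: "real \<times> real \<Rightarrow> real"
  assumes cont: "continuous_on (closure Q) d"
    and init: "\<And>x. x \<in> {-1<..<1} \<Longrightarrow> d (x, 0) \<le> 0"
    and lat: "\<And>x t. x \<in> {-1, 1} \<Longrightarrow> t > 0 \<Longrightarrow> d (x, t) \<le> 0"
    and L: "L \<ge> 0"
    and approx: "\<And>\<rho> \<eta> T. \<rho> > 0 \<Longrightarrow> \<eta> > 0 \<Longrightarrow> \<exists>D Dt Dx Dxx.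
      (\<forall>x t. ((\<lambda>t. D x t) has_real_derivative Dt x t) (at t)) \<and>
      (\<forall>x t. ((\<lambda>x. D x t) has_real_derivative Dx x t) (at x)) \<and>
      (\<forall>x t. ((\<lambda>x. Dx x t) has_real_derivative Dxx x t) (at x)) \<and>
      continuous_on UNIV (\<lambda>z. D (fst z) (snd z)) \<and>
      (\<forall>x\<in>{-1 + \<rho>..1 - \<rho>}. \<forall>t\<in>{\<rho>..T}. \<bar>D x t - d (x, t)\<bar> \<le> \<eta> \<and> Dt x t - Dxx x t \<le> L * max (d (x, t)) 0 + \<eta>)"
    and z: "z \<in> closure Q"
  shows "d z \<le> 0"
proof (rule ccontr)
  assume "\<not> d z \<le> 0"
  obtain x1 t1 where z_eq: "z = (x1, t1)" by (cases z)
  have zK: "x1 \<in> {-1..1}" "t1 \<ge> 0" using z by (auto simp: z_eq closure_Q)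
  \<comment> \<open>The initial data are given for |x| < 1 and the lateral data for t > 0; the
    corners follow by continuity along the sides.\<close>
  have corner: "d (x, 0) \<le> 0" if "x \<in> {-1, 1}" for x
  proof -
    have "((\<lambda>t. d (x, t)) \<longlongrightarrow> d (x, 0)) (at 0 within {0..})"
    proof -
      have "continuous_on {0..} (\<lambda>t. d (x, t))"
        by (rule continuous_on_compose2[OF cont]) (use that in \<open>auto intro!: continuous_intros simp: closure_Q\<close>)
      thus ?thesis by (simp add: continuous_on_def)
    qed
    moreover have "at 0 within {0..} = at_right (0::real)"
      by (simp add: at_within_Ici_at_right)
    ultimately have "((\<lambda>t. d (x, t)) \<longlongrightarrow> d (x, 0)) (at_right 0)" by simp
    thus ?thesis
      by (rule tendsto_upperbound) (use lat[OF that] in \<open>auto simp: eventually_at_right_field intro!: exI[of _ 1]\<close>)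
  qed
  \<comment> \<open>The weight \<open>exp (- c t)\<close> with \<open>c > L\<close> turns the zeroth-order term into one of the right sign.\<close>
  define c where "c = L + 1"
  have exp1: "exp (- c * s) \<le> 1" if "s \<ge> 0" for s
  proof -
    have "c \<ge> 0" using L by (simp add: c_def)
    from mult_nonneg_nonneg[OF this that] show ?thesis by simp
  qed
  define V where "V z = exp (- c * snd z) * d z" for z
  define m where "m = V z"
  have m: "m > 0" using \<open>\<not> d z \<le> 0\<close> by (simp add: m_def V_def)
  define K where "K = {-1..1::real} \<times> {0..t1}"
  have K: "compact K" unfolding K_def by (intro compact_Times compact_Icc)
  have VK: "continuous_on K V"
    unfolding V_def by (intro continuous_intros continuous_on_subset[OF cont]) (auto simp: K_def closure_Q)
  \<comment> \<open>This compact set misses the parabolic boundary, where \<open>d\<close> is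
    nonpositive; its distance from there determines \<open>\<rho>\<close> before \<open>D\<close> is
    chosen.\<close>
  define S where "S = {z \<in> K. m / 2 \<le> V z}"
  have "closed S" unfolding S_def
    using continuous_on_closed_Collect_le[of K "\<lambda>_. m / 2" V] VK compact_imp_closed[OF K] by auto
  hence S: "compact S" using K by (metis (no_types, lifting) S_def compact_Int_closed inf.absorb_iff2 mem_Collect_eq subsetI)
  have zS: "z \<in> S" using m zK by (auto simp: S_def m_def K_def z_eq)
  have Sint: "\<bar>fst y\<bar> < 1 \<and> snd y > 0" if "y \<in> S" for y
  proof -
    obtain x t where y: "y = (x, t)" by (cases y)
    have "V y > 0" using that m by (auto simp: S_def)
    hence dy: "d (x, t) > 0" by (simp add: V_def y zero_less_mult_iff)
    have xt: "x \<in> {-1..1}" "t \<ge> 0" using that by (auto simp: S_def K_def y)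
    have "t \<noteq> 0" using init[of x] corner[of x] dy xt by (cases "x \<in> {-1<..<1}") auto
    moreover have "x \<noteq> 1" "x \<noteq> -1" using lat[of x t] dy xt \<open>t \<noteq> 0\<close> by auto
    ultimately show ?thesis using xt by (auto simp: y)
  qed
  obtain y1 where y1: "y1 \<in> S" "\<And>y. y \<in> S \<Longrightarrow> \<bar>fst y\<bar> \<le> \<bar>fst y1\<bar>"
    using continuous_attains_sup[OF S, of "\<lambda>y. \<bar>fst y\<bar>"] zS by (force intro: continuous_intros)
  obtain y2 where y2: "y2 \<in> S" "\<And>y. y \<in> S \<Longrightarrow> snd y2 \<le> snd y"
    using continuous_attains_inf[OF S, of snd] zS by (force intro: continuous_intros)
  define \<rho> where "\<rho> = min (1 - \<bar>fst y1\<bar>) (snd y2) / 2"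
  have \<rho>: "\<rho> > 0" using Sint[OF y1(1)] Sint[OF y2(1)] by (simp add: \<rho>_def)
  have S\<rho>: "\<bar>fst y\<bar> \<le> 1 - 2 * \<rho> \<and> 2 * \<rho> \<le> snd y \<and> snd y \<le> t1" if "y \<in> S" for y
    using y1(2)[OF that] y2(2)[OF that] that by (auto simp: \<rho>_def S_def K_def)
  \<comment> \<open>The bound m / 8 forces the maximum point of \<open>E\<close> into
    \<open>S\<close>; \<open>(L + 2) * \<eta> < m\<close> will contradict m - \<eta> \<le> D \<le>
    (L + 1) \<eta> at that point.\<close>
  define \<eta> where "\<eta> = m / (4 * (L + 2))"
  have \<eta>: "\<eta> > 0" "\<eta> \<le> m / 8" "(L + 2) * \<eta> < m"
    using m L by (auto simp: \<eta>_def field_simps intro: add_pos_nonneg)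
  obtain D Dt Dx Dxx where
    Dt: "\<And>x t. ((\<lambda>t. D x t) has_real_derivative Dt x t) (at t)" and
    Dx: "\<And>x t. ((\<lambda>x. D x t) has_real_derivative Dx x t) (at x)" and
    Dxx: "\<And>x t. ((\<lambda>x. Dx x t) has_real_derivative Dxx x t) (at x)" and
    Dc: "continuous_on UNIV (\<lambda>z. D (fst z) (snd z))" and
    Dd: "\<And>x t. x \<in> {-1 + \<rho>..1 - \<rho>} \<Longrightarrow> t \<in> {\<rho>..t1} \<Longrightarrow> \<bar>D x t - d (x, t)\<bar> \<le> \<eta>" and
    De: "\<And>x t. x \<in> {-1 + \<rho>..1 - \<rho>} \<Longrightarrow> t \<in> {\<rho>..t1} \<Longrightarrow> Dt x t - Dxx x t \<le> L * max (d (x, t)) 0 + \<eta>"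
    using approx[OF \<rho> \<eta>(1), of t1] by blast
  define R where "R = {-1 + \<rho>..1 - \<rho>} \<times> {\<rho>..t1}"
  define E where "E z = exp (- c * snd z) * D (fst z) (snd z)" for z
  have R: "compact R" unfolding R_def by (intro compact_Times compact_Icc)
  have SR: "S \<subseteq> R" using S\<rho> \<rho> by (fastforce simp: R_def abs_le_iff)
  have EV: "\<bar>E y - V y\<bar> \<le> \<eta>" if "y \<in> R" for y
  proof -
    have "\<bar>E y - V y\<bar> = exp (- c * snd y) * \<bar>D (fst y) (snd y) - d y\<bar>"
      by (simp add: E_def V_def abs_mult flip: right_diff_distrib)
    also have "\<dots> \<le> 1 * \<eta>"
    proof (rule mult_mono)
      show "exp (- c * snd y) \<le> 1" using that \<rho> by (intro exp1) (auto simp: R_def)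
      show "\<bar>D (fst y) (snd y) - d y\<bar> \<le> \<eta>" using Dd[of "fst y" "snd y"] that by (auto simp: R_def)
    qed auto
    finally show ?thesis by simp
  qed
  have "continuous_on R E"
    unfolding E_def by (intro continuous_intros continuous_on_subset[OF Dc]) auto
  then obtain y where y: "y \<in> R" "\<And>y'. y' \<in> R \<Longrightarrow> E y' \<le> E y"
    using continuous_attains_sup[OF R, of E] zS SR by blast
  have Ey: "E y \<ge> m - \<eta>"
    using y(2)[of z] EV[of z] zS SR by (auto simp: m_def)
  hence "V y \<ge> m / 2" using EV[OF y(1)] \<eta>(2) m by linarith
  moreover have "y \<in> K" using y(1) \<rho> by (auto simp: R_def K_def)
  ultimately have yS: "y \<in> S" by (simp add: S_def)
  obtain x t where y_eq: "y = (x, t)" by (cases y)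
  have xt: "\<bar>x\<bar> \<le> 1 - 2 * \<rho>" "2 * \<rho> \<le> t" "t \<le> t1" using S\<rho>[OF yS] by (auto simp: y_eq)
  have "Dxx x t \<le> 0"
  proof (rule DERIV2_local_max[OF Dx Dxx \<rho>])
    fix x' assume "\<bar>x' - x\<bar> < \<rho>"
    hence "(x', t) \<in> R" using xt \<rho> by (auto simp: R_def)
    from y(2)[OF this] show "D x' t \<le> D x t" by (simp add: E_def y_eq)
  qed
  \<comment> \<open>The maximum may be attained at the final time \<open>t1\<close>, so the test in
    time looks only backwards.\<close>
  moreover have "exp (- c * t) * (Dt x t - c * D x t) \<ge> 0"
  proof (rule DERIV_left_max[OF _ \<rho>])
    show "((\<lambda>t. exp (- c * t) * D x t) has_real_derivative exp (- c * t) * (Dt x t - c * D x t)) (at t)"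
      by (auto intro!: derivative_eq_intros Dt simp: algebra_simps)
    fix t' assume "t - \<rho> < t'" "t' \<le> t"
    hence "(x, t') \<in> R" using xt \<rho> by (auto simp: R_def)
    from y(2)[OF this] show "exp (- c * t') * D x t' \<le> exp (- c * t) * D x t" by (simp add: E_def y_eq)
  qed
  hence "c * D x t \<le> Dt x t" by (simp add: zero_le_mult_iff)
  moreover have xR: "x \<in> {-1 + \<rho>..1 - \<rho>}" "t \<in> {\<rho>..t1}" using y(1) by (auto simp: R_def y_eq)
  moreover have Dm: "D x t \<ge> m - \<eta>"
  proof -
    have "E y > 0" using Ey \<eta>(2) m by linarith
    hence "D x t > 0" by (simp add: E_def y_eq zero_less_mult_iff)
    moreover have "exp (- c * t) \<le> 1" using xt \<rho> by (intro exp1) simp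
    ultimately have "E y \<le> 1 * D x t" unfolding E_def y_eq fst_conv snd_conv by (intro mult_right_mono) auto
    thus ?thesis using Ey by simp
  qed
  moreover have "L * max (d (x, t)) 0 \<le> L * (D x t + \<eta>)"
    using Dd[OF xR] Dm L \<eta> m by (intro mult_left_mono) auto
  ultimately have "c * D x t \<le> L * (D x t + \<eta>) + \<eta>"
    using De[OF xR] by linarith
  hence "D x t \<le> (L + 1) * \<eta>" by (simp add: c_def algebra_simps)
  thus False using Dm \<eta>(3) by (simp add: algebra_simps)
qed

section \<open>Comparison for the regularized problems\<close>

lemma f_reg_altdef: "\<epsilon> > 0 \<Longrightarrow> f_reg \<epsilon> = (\<lambda>z. max 0 (min (z / \<epsilon>) 1))"
  by (auto simp: f_reg_def fun_eq_iff max_def min_def field_simps)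

lemma f_reg_continuous: "\<epsilon> > 0 \<Longrightarrow> continuous_on UNIV (f_reg \<epsilon>)"
  by (subst f_reg_altdef) (auto intro!: continuous_intros)

lemma f_reg_0: "\<epsilon> > 0 \<Longrightarrow> f_reg \<epsilon> 0 = 0"
  by (simp add: f_reg_def)

lemma f_reg_bounds: "\<epsilon> > 0 \<Longrightarrow> 0 \<le> f_reg \<epsilon> z" "\<epsilon> > 0 \<Longrightarrow> \<bar>f_reg \<epsilon> z\<bar> \<le> 1"
  by (auto simp: f_reg_altdef)

lemma f_reg_one_sided_Lipschitz:
  assumes "\<epsilon> > 0"
  shows "f_reg \<epsilon> a - f_reg \<epsilon> b \<le> 1 / \<epsilon> * max (a - b) 0"
proof (cases "a \<le> b")
  case True
  hence "a / \<epsilon> \<le> b / \<epsilon>" using assms by (intro divide_right_mono) auto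
  thus ?thesis using True assms by (auto simp: f_reg_altdef)
next
  case False
  hence "b / \<epsilon> \<le> a / \<epsilon>" using assms by (intro divide_right_mono) auto
  hence "f_reg \<epsilon> a - f_reg \<epsilon> b \<le> a / \<epsilon> - b / \<epsilon>" using assms by (auto simp: f_reg_altdef)
  thus ?thesis using False assms by (simp add: diff_divide_distrib)
qed

context
  fixes \<epsilon> :: real and U :: "real \<times> real \<Rightarrow> real"
  assumes \<epsilon>: "\<epsilon> > 0" and U: "solves_ibvp (f_reg \<epsilon>) (\<lambda>x. 2 * x\<^sup>2 - 1) (\<lambda>x t. t + 1) U"
begin

private lemma U_props: "strong_solution (f_reg \<epsilon>) Q U" "continuous_on (closure Q) U"
  "x \<in> {-1<..<1} \<Longrightarrow> U (x, 0) = 2 * x\<^sup>2 - 1" "x \<in> {-1, 1} \<Longrightarrow> t > 0 \<Longrightarrow> U (x, t) = t + 1"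
  using U unfolding solves_ibvp_def by blast+

text \<open>The function 2 x^2 - 1 + t has the same data as U, and its heat operator equals 1 - 4 =
  -3, which lies below the nonnegative source.\<close>

lemma regularized_ge_subsolution:
  assumes z: "z \<in> closure Q"
  shows "2 * (fst z)\<^sup>2 - 1 + snd z \<le> U z"
proof -
  define d where "d z = 2 * (fst z)\<^sup>2 - 1 + snd z - U z" for z
  have "d z \<le> 0"
  proof (rule parabolic_max_principle[where L = 0, OF _ _ _ _ _ z])
    show "continuous_on (closure Q) d" unfolding d_def by (intro continuous_intros U_props)
    show "d (x, 0) \<le> 0" if "x \<in> {-1<..<1}" for x using U_props(3)[OF that] by (simp add: d_def)
    show "d (x, t) \<le> 0" if "x \<in> {-1, 1}" "t > 0" for x t using U_props(4)[OF that] that by (auto simp: d_def)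
    fix \<rho> \<eta> T :: real assume pos: "\<rho> > 0" "\<eta> > 0"
    obtain W Wt Wx Wxx where
      Wt: "\<And>x t. ((\<lambda>t. W x t) has_real_derivative Wt x t) (at t)" and
      Wx: "\<And>x t. ((\<lambda>x. W x t) has_real_derivative Wx x t) (at x)" and
      Wxx: "\<And>x t. ((\<lambda>x. Wx x t) has_real_derivative Wxx x t) (at x)" and
      Wc: "continuous_on UNIV (\<lambda>z. W (fst z) (snd z))" and
      WU: "\<And>x t. x \<in> {-1 + \<rho>..1 - \<rho>} \<Longrightarrow> t \<in> {\<rho>..T} \<Longrightarrow> \<bar>W x t - U (x, t)\<bar> \<le> \<eta>" and
      We: "\<And>x t. x \<in> {-1 + \<rho>..1 - \<rho>} \<Longrightarrow> t \<in> {\<rho>..T} \<Longrightarrow> \<bar>Wt x t - Wxx x t - f_reg \<epsilon> (U (x, t))\<bar> \<le> \<eta>"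
      by (rule smooth_approximation[OF U_props(1,2) f_reg_continuous[OF \<epsilon>] f_reg_0[OF \<epsilon>] f_reg_bounds(2)[OF \<epsilon>] pos, of T]) (rule that)
    show "\<exists>D Dt Dx Dxx.
      (\<forall>x t. ((\<lambda>t. D x t) has_real_derivative Dt x t) (at t)) \<and>
      (\<forall>x t. ((\<lambda>x. D x t) has_real_derivative Dx x t) (at x)) \<and>
      (\<forall>x t. ((\<lambda>x. Dx x t) has_real_derivative Dxx x t) (at x)) \<and>
      continuous_on UNIV (\<lambda>z. D (fst z) (snd z)) \<and>
      (\<forall>x\<in>{-1 + \<rho>..1 - \<rho>}. \<forall>t\<in>{\<rho>..T}. \<bar>D x t - d (x, t)\<bar> \<le> \<eta> \<and> Dt x t - Dxx x t \<le> 0 * max (d (x, t)) 0 + \<eta>)"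
    proof (intro exI conjI allI ballI)
      show "((\<lambda>t. 2 * x\<^sup>2 - 1 + t - W x t) has_real_derivative 1 - Wt x t) (at t)" for x t
        by (auto intro!: derivative_eq_intros Wt)
      show "((\<lambda>x. 2 * x\<^sup>2 - 1 + t - W x t) has_real_derivative 4 * x - Wx x t) (at x)" for x t
        by (auto intro!: derivative_eq_intros Wx)
      show "((\<lambda>x. 4 * x - Wx x t) has_real_derivative 4 - Wxx x t) (at x)" for x t
        by (auto intro!: derivative_eq_intros Wxx)
      show "continuous_on UNIV (\<lambda>z. 2 * (fst z)\<^sup>2 - 1 + snd z - W (fst z) (snd z))"
        by (intro continuous_intros Wc)
      fix x t assume xt: "x \<in> {-1 + \<rho>..1 - \<rho>}" "t \<in> {\<rho>..T}"
      show "\<bar>2 * x\<^sup>2 - 1 + t - W x t - d (x, t)\<bar> \<le> \<eta>"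
        using WU[OF xt] by (simp add: d_def abs_minus_commute)
      show "1 - Wt x t - (4 - Wxx x t) \<le> 0 * max (d (x, t)) 0 + \<eta>"
        using We[OF xt] f_reg_bounds(1)[OF \<epsilon>, of "U (x, t)"] by auto
    qed
  qed simp
  thus ?thesis by (simp add: d_def)
qed

text \<open>U + \<tau> is compared with the solution shifted by \<tau> in time. On the sides the two
  agree, and at t = 0 the subsolution bound at time \<tau> orders them; the lateral data t + 1 are
  made for this.\<close>

lemma regularized_time_growth:
  assumes z: "z \<in> closure Q" and \<tau>: "\<tau> \<ge> 0"
  shows "U z + \<tau> \<le> U (fst z, snd z + \<tau>)"
proof -
  define d where "d z = U z + \<tau> - U (fst z, snd z + \<tau>)" for z
  have "d z \<le> 0"
  proof (rule parabolic_max_principle[where L = "1 / \<epsilon>", OF _ _ _ _ _ z])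
    show "continuous_on (closure Q) d" unfolding d_def
      by (intro continuous_intros continuous_on_compose2[OF U_props(2)] U_props(2)) (use \<tau> in \<open>auto simp: closure_Q\<close>)
    show "d (x, 0) \<le> 0" if "x \<in> {-1<..<1}" for x
      using U_props(3)[OF that] regularized_ge_subsolution[of "(x, \<tau>)"] that \<tau> by (simp add: d_def closure_Q)
    show "d (x, t) \<le> 0" if "x \<in> {-1, 1}" "t > 0" for x t
      using U_props(4)[OF that] U_props(4)[OF that(1), of "t + \<tau>"] that \<tau> by (auto simp: d_def)
    fix \<rho> \<eta> T :: real assume pos: "\<rho> > 0" "\<eta> > 0"
    hence pos': "\<eta> / 2 > 0" by simp
    obtain W Wt Wx Wxx where
      Wt: "\<And>x t. ((\<lambda>t. W x t) has_real_derivative Wt x t) (at t)" and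
      Wx: "\<And>x t. ((\<lambda>x. W x t) has_real_derivative Wx x t) (at x)" and
      Wxx: "\<And>x t. ((\<lambda>x. Wx x t) has_real_derivative Wxx x t) (at x)" and
      Wc: "continuous_on UNIV (\<lambda>z. W (fst z) (snd z))" and
      WU: "\<And>x t. x \<in> {-1 + \<rho>..1 - \<rho>} \<Longrightarrow> t \<in> {\<rho>..T + \<tau>} \<Longrightarrow> \<bar>W x t - U (x, t)\<bar> \<le> \<eta> / 2" and
      We: "\<And>x t. x \<in> {-1 + \<rho>..1 - \<rho>} \<Longrightarrow> t \<in> {\<rho>..T + \<tau>} \<Longrightarrow> \<bar>Wt x t - Wxx x t - f_reg \<epsilon> (U (x, t))\<bar> \<le> \<eta> / 2"
      by (rule smooth_approximation[OF U_props(1,2) f_reg_continuous[OF \<epsilon>] f_reg_0[OF \<epsilon>] f_reg_bounds(2)[OF \<epsilon>] pos(1) pos', of "T + \<tau>"]) (rule that)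
    show "\<exists>D Dt Dx Dxx.
      (\<forall>x t. ((\<lambda>t. D x t) has_real_derivative Dt x t) (at t)) \<and>
      (\<forall>x t. ((\<lambda>x. D x t) has_real_derivative Dx x t) (at x)) \<and>
      (\<forall>x t. ((\<lambda>x. Dx x t) has_real_derivative Dxx x t) (at x)) \<and>
      continuous_on UNIV (\<lambda>z. D (fst z) (snd z)) \<and>
      (\<forall>x\<in>{-1 + \<rho>..1 - \<rho>}. \<forall>t\<in>{\<rho>..T}. \<bar>D x t - d (x, t)\<bar> \<le> \<eta> \<and> Dt x t - Dxx x t \<le> 1 / \<epsilon> * max (d (x, t)) 0 + \<eta>)"
    proof (intro exI conjI allI ballI)
      show "((\<lambda>t. W x t + \<tau> - W x (t + \<tau>)) has_real_derivative Wt x t - Wt x (t + \<tau>)) (at t)" for x t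
      proof -
        have "((\<lambda>t. W x (t + \<tau>)) has_real_derivative Wt x (t + \<tau>) * 1) (at t)"
          by (rule DERIV_chain2[OF Wt]) (auto intro!: derivative_eq_intros)
        thus ?thesis by (auto intro!: derivative_eq_intros Wt)
      qed
      show "((\<lambda>x. W x t + \<tau> - W x (t + \<tau>)) has_real_derivative Wx x t - Wx x (t + \<tau>)) (at x)" for x t
        by (auto intro!: derivative_eq_intros Wx)
      show "((\<lambda>x. Wx x t - Wx x (t + \<tau>)) has_real_derivative Wxx x t - Wxx x (t + \<tau>)) (at x)" for x t
        by (auto intro!: derivative_eq_intros Wxx)
      have "continuous_on UNIV (\<lambda>z. W (fst (fst z, snd z + \<tau>)) (snd (fst z, snd z + \<tau>)))"
        by (rule continuous_on_compose2[OF Wc]) (auto intro!: continuous_intros)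
      thus "continuous_on UNIV (\<lambda>z. W (fst z) (snd z) + \<tau> - W (fst z) (snd z + \<tau>))"
        by (intro continuous_intros Wc) simp
      fix x t assume xt: "x \<in> {-1 + \<rho>..1 - \<rho>}" "t \<in> {\<rho>..T}"
      hence in1: "t \<in> {\<rho>..T + \<tau>}" and in2: "t + \<tau> \<in> {\<rho>..T + \<tau>}" using \<tau> by auto
      show "\<bar>W x t + \<tau> - W x (t + \<tau>) - d (x, t)\<bar> \<le> \<eta>"
        using WU[OF xt(1) in1] WU[OF xt(1) in2] unfolding d_def fst_conv snd_conv abs_le_iff by linarith
      have "f_reg \<epsilon> (U (x, t)) - f_reg \<epsilon> (U (x, t + \<tau>)) \<le> 1 / \<epsilon> * max (U (x, t) - U (x, t + \<tau>)) 0"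
        by (rule f_reg_one_sided_Lipschitz[OF \<epsilon>])
      \<comment> \<open>The difference of the two solutions is \<open>d\<close> minus \<tau>, hence
        at most \<open>d\<close>.\<close>
      also have "\<dots> \<le> 1 / \<epsilon> * max (d (x, t)) 0"
        using \<epsilon> \<tau> by (intro mult_left_mono) (auto simp: d_def)
      finally show "Wt x t - Wt x (t + \<tau>) - (Wxx x t - Wxx x (t + \<tau>)) \<le> 1 / \<epsilon> * max (d (x, t)) 0 + \<eta>"
        using We[OF xt(1) in1] We[OF xt(1) in2] unfolding abs_le_iff by linarith
    qed
  qed (use \<epsilon> in simp)
  thus ?thesis by (simp add: d_def)
qed

end

section \<open>Passage to the least solution\<close>

context
  fixes u :: "real \<times> real \<Rightarrow> real"
  assumes least: "least_solution (\<lambda>x. 2 * x\<^sup>2 - 1) (\<lambda>x t. t + 1) u"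
begin

lemma least_ge_subsolution:
  assumes z: "z \<in> closure Q"
  shows "2 * (fst z)\<^sup>2 - 1 + snd z \<le> u z"
proof -
  obtain U where U: "\<And>\<epsilon>. \<epsilon> > 0 \<Longrightarrow> solves_ibvp (f_reg \<epsilon>) (\<lambda>x. 2 * x\<^sup>2 - 1) (\<lambda>x t. t + 1) (U \<epsilon>)"
    and lim: "\<And>z. z \<in> closure Q \<Longrightarrow> ((\<lambda>\<epsilon>. U \<epsilon> z) \<longlongrightarrow> u z) (at_right 0)"
    using least by (auto simp: least_solution_def)
  show ?thesis
  proof (rule tendsto_lowerbound[OF lim[OF z]])
    show "\<forall>\<^sub>F \<epsilon> in at_right 0. 2 * (fst z)\<^sup>2 - 1 + snd z \<le> U \<epsilon> z"
      unfolding eventually_at_right_field using regularized_ge_subsolution[OF _ U z] by (intro exI[of _ 1]) auto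
  qed simp
qed

lemma least_time_growth:
  assumes z: "z \<in> closure Q" and \<tau>: "\<tau> \<ge> 0"
  shows "u z + \<tau> \<le> u (fst z, snd z + \<tau>)"
proof -
  obtain U where U: "\<And>\<epsilon>. \<epsilon> > 0 \<Longrightarrow> solves_ibvp (f_reg \<epsilon>) (\<lambda>x. 2 * x\<^sup>2 - 1) (\<lambda>x t. t + 1) (U \<epsilon>)"
    and lim: "\<And>z. z \<in> closure Q \<Longrightarrow> ((\<lambda>\<epsilon>. U \<epsilon> z) \<longlongrightarrow> u z) (at_right 0)"
    using least by (auto simp: least_solution_def)
  have z': "(fst z, snd z + \<tau>) \<in> closure Q" using z \<tau> by (auto simp: closure_Q)
  show ?thesis
  proof (rule tendsto_le[OF _ lim[OF z'] tendsto_add[OF lim[OF z] tendsto_const]])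
    show "\<forall>\<^sub>F \<epsilon> in at_right 0. U \<epsilon> z + \<tau> \<le> U \<epsilon> (fst z, snd z + \<tau>)"
      unfolding eventually_at_right_field using regularized_time_growth[OF _ U z \<tau>] by (intro exI[of _ 1]) auto
  qed simp
qed

end

section \<open>Consequences of a bounded time derivative\<close>

text \<open>The function f(x + s) + f(x - s) - a s^2 is nondecreasing in s, by the mean value
  theorem for f'; the upper bound is the lower one for -f. Second differences involve no
  derivatives, so these bounds survive when the mollification is removed.\<close>

lemma second_difference_bounds:
  fixes f :: "real \<Rightarrow> real"
  assumes f: "\<And>y. (f has_real_derivative f' y) (at y)" and f': "\<And>y. (f' has_real_derivative f'' y) (at y)"
    and h: "h \<ge> 0"
  shows "(\<And>y. y \<in> {x - h..x + h} \<Longrightarrow> a \<le> f'' y) \<Longrightarrow> a * h\<^sup>2 \<le> f (x + h) + f (x - h) - 2 * f x"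
    and "(\<And>y. y \<in> {x - h..x + h} \<Longrightarrow> f'' y \<le> b) \<Longrightarrow> f (x + h) + f (x - h) - 2 * f x \<le> b * h\<^sup>2"
proof -
  have *: "a * h\<^sup>2 \<le> f (x + h) + f (x - h) - 2 * f x"
    if f: "\<And>y. (f has_real_derivative f' y) (at y)" and f': "\<And>y. (f' has_real_derivative f'' y) (at y)"
      and a: "\<And>y. y \<in> {x - h..x + h} \<Longrightarrow> a \<le> f'' y" for f f' f'' :: "real \<Rightarrow> real" and a
  proof -
    define k where "k s = f (x + s) + f (x - s) - a * s\<^sup>2" for s
    have k: "(k has_real_derivative f' (x + s) - f' (x - s) - 2 * a * s) (at s)" for s
    proof -
      have "((\<lambda>s. f (x + s)) has_real_derivative f' (x + s) * 1) (at s)"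
        by (rule DERIV_chain2[OF f]) (auto intro!: derivative_eq_intros)
      moreover have "((\<lambda>s. f (x - s)) has_real_derivative f' (x - s) * (-1)) (at s)"
        by (rule DERIV_chain2[OF f]) (auto intro!: derivative_eq_intros)
      ultimately show ?thesis unfolding k_def by (auto intro!: derivative_eq_intros)
    qed
    have "k 0 \<le> k h"
    proof (rule DERIV_nonneg_imp_nondecreasing[OF h])
      fix s assume s: "0 \<le> s" "s \<le> h"
      have "f' (x + s) - f' (x - s) - 2 * a * s \<ge> 0"
      proof (cases "s = 0")
        case False
        then obtain \<xi> where \<xi>: "x - s < \<xi>" "\<xi> < x + s" "f' (x + s) - f' (x - s) = (x + s - (x - s)) * f'' \<xi>"
          using MVT2[of "x - s" "x + s" f' f''] f' s by auto
        have "2 * s * a \<le> 2 * s * f'' \<xi>" using s \<xi> by (intro mult_left_mono a) auto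
        thus ?thesis using \<xi>(3) by (simp add: algebra_simps)
      qed simp
      thus "\<exists>y. (k has_real_derivative y) (at s) \<and> 0 \<le> y" using k by blast
    qed
    thus ?thesis by (simp add: k_def)
  qed
  show "a * h\<^sup>2 \<le> f (x + h) + f (x - h) - 2 * f x" if "\<And>y. y \<in> {x - h..x + h} \<Longrightarrow> a \<le> f'' y"
    by (rule *[OF f f' that])
  show "f (x + h) + f (x - h) - 2 * f x \<le> b * h\<^sup>2" if "\<And>y. y \<in> {x - h..x + h} \<Longrightarrow> f'' y \<le> b"
    using *[of "\<lambda>y. - f y" "\<lambda>y. - f' y" "\<lambda>y. - f'' y" "-b"] that by (simp add: f f' DERIV_minus)
qed

text \<open>The \<delta>-box about (x, t) lies in \<open>Q\<close> and below time T, so a kernel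
  centred there does not see the cutoff.\<close>

definition box_inside :: "real \<Rightarrow> real \<Rightarrow> real \<Rightarrow> real \<Rightarrow> bool" where
  "box_inside T \<delta> x t \<longleftrightarrow> -1 + \<delta> < x \<and> x < 1 - \<delta> \<and> \<delta> < t \<and> t + \<delta> < T"

text \<open>All that is retained of leastness is \<open>lower\<close> and \<open>growth\<close>. The
  remaining assumptions are the equation, the data and the bound to be refuted; the locale will turn
  out to be contradictory.\<close>

locale bounded_time_derivative =
  fixes u ut :: "real \<times> real \<Rightarrow> real" and C :: real
  assumes sol: "strong_solution (indicat_real {0<..}) Q u"
    and cont: "continuous_on (closure Q) u"
    and lateral: "\<And>x t. x \<in> {-1, 1} \<Longrightarrow> t > 0 \<Longrightarrow> u (x, t) = t + 1"
    and start: "u (0, 0) < 0"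
    and lower: "\<And>z. z \<in> closure Q \<Longrightarrow> 2 * (fst z)\<^sup>2 - 1 + snd z \<le> u z"
    and growth: "\<And>z \<tau>. z \<in> closure Q \<Longrightarrow> \<tau> \<ge> 0 \<Longrightarrow> u z + \<tau> \<le> u (fst z, snd z + \<tau>)"
    and ut: "weak_deriv Dt Q u ut" and bound: "AE z in lebesgue_on Q. \<bar>ut z\<bar> \<le> C" and C: "C \<ge> 1"
begin

definition src :: "real \<Rightarrow> real \<times> real \<Rightarrow> real" where
  "src T z = indicat_real {0<..} (cut T u z)"

lemma w_integrable: "integrable lborel (cut T u)"
  by (rule cut_integrable[OF cont])

lemma src_integrable: "integrable lborel (src T)"
  unfolding src_def[abs_def] by (rule source_cut_integrable[OF cont]) (auto simp: indicator_def)

lemma cut_eq: "x \<in> {-1..1} \<Longrightarrow> t \<in> {0..T} \<Longrightarrow> cut T u (x, t) = u (x, t)"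
  by (simp add: cut_def)

lemma src_eq: "x \<in> {-1..1} \<Longrightarrow> t \<in> {0..T} \<Longrightarrow> src T (x, t) = (if u (x, t) > 0 then 1 else 0)"
  by (simp add: src_def cut_eq)

lemma src_bounds: "0 \<le> src T z" "src T z \<le> 1"
  by (auto simp: src_def indicator_def)

context
  fixes \<delta> \<alpha> T x t
  assumes M: "mollifier \<delta> \<alpha>" and box: "box_inside T \<delta> x t"
begin

private lemma box_Q: "{x - \<delta>..x + \<delta>} \<times> {t - \<delta>..t + \<delta>} \<subseteq> Q"
  and box_cut: "z \<in> {x - \<delta>..x + \<delta>} \<times> {t - \<delta>..t + \<delta>} \<Longrightarrow> cut T u z = u z"
  using box by (auto simp: box_inside_def Q_def cut_def)

lemma mollified_equation:
  "conv \<alpha> (cut T u) i (Suc j) x t = conv \<alpha> (cut T u) (Suc (Suc i)) j x t + conv \<alpha> (src T) i j x t"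
  using conv_heat_equation[OF M box_Q open_Q sol w_integrable box_cut src_integrable[unfolded src_def[abs_def]]]
  by (simp add: src_def[abs_def])

lemma mollified_dt_le: "conv \<alpha> (cut T u) 0 (Suc 0) x t \<le> C"
  using conv_weak_Dt_le[OF M box_Q open_Q ut bound w_integrable box_cut] C by simp

text \<open>Averaging \<open>growth\<close> yields an increment of at least h over a short time h,
  which excludes a derivative below 1. The choice of \<open>h\<close> keeps the shifted box below
  the cutoff time.\<close>

lemma mollified_dt_ge: "1 \<le> conv \<alpha> (cut T u) 0 (Suc 0) x t"
proof (rule ccontr)
  assume "\<not> 1 \<le> conv \<alpha> (cut T u) 0 (Suc 0) x t"
  hence neg: "conv \<alpha> (cut T u) 0 (Suc 0) x t - 1 < 0" by simp
  have "((\<lambda>t. conv \<alpha> (cut T u) 0 0 x t - t) has_real_derivative conv \<alpha> (cut T u) 0 (Suc 0) x t - 1) (at t)"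
    by (auto intro!: derivative_eq_intros conv_DERIV_t[OF M w_integrable])
  from DERIV_neg_dec_right[OF this neg] obtain d where d: "d > 0" and
    dec: "\<And>h. 0 < h \<Longrightarrow> h < d \<Longrightarrow> conv \<alpha> (cut T u) 0 0 x t - t > conv \<alpha> (cut T u) 0 0 x (t + h) - (t + h)"
    by blast
  define h where "h = min d (T - t - \<delta>) / 2"
  have h: "0 < h" "h < d" "t + \<delta> + h < T" using d box by (auto simp: h_def box_inside_def min_def field_simps)
  have "conv \<alpha> (cut T u) 0 0 x t + h \<le> conv \<alpha> (cut T u) 0 0 x (t + h)"
  proof (rule conv_mono[OF M w_integrable w_integrable])
    fix y s assume ys: "\<bar>y\<bar> < \<delta>" "\<bar>s\<bar> < \<delta>"
    have "(x - y, t - s) \<in> closure Q" using ys box by (auto simp: closure_Q box_inside_def)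
    moreover have eq: "t + h - s = t - s + h" by simp
    ultimately show "cut T u (x - y, t - s) + h \<le> cut T u (x - y, t + h - s)"
      unfolding eq using growth[of "(x - y, t - s)" h] ys box h
      by (subst (1 2) cut_eq) (auto simp: box_inside_def)
  qed
  thus False using dec[OF h(1,2)] by simp
qed

lemma mollified_src_bounds: "0 \<le> conv \<alpha> (src T) 0 0 x t" "conv \<alpha> (src T) 0 0 x t \<le> 1"
  by (rule conv_ge[OF M src_integrable] conv_le[OF M src_integrable]; simp add: src_bounds)+

text \<open>The lower bound 1 for the time derivative is exactly what absorbs the largest possible
  source, and the source is nonnegative.\<close>

lemma mollified_xx_bounds:
  "0 \<le> conv \<alpha> (cut T u) (Suc (Suc 0)) 0 x t" "conv \<alpha> (cut T u) (Suc (Suc 0)) 0 x t \<le> C"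
  using mollified_equation[of 0 0] mollified_dt_le mollified_dt_ge mollified_src_bounds by linarith+

lemma mollified_xx_ge_1:
  assumes "\<And>y s. \<bar>y\<bar> < \<delta> \<Longrightarrow> \<bar>s\<bar> < \<delta> \<Longrightarrow> u (x - y, t - s) \<le> 0"
  shows "1 \<le> conv \<alpha> (cut T u) (Suc (Suc 0)) 0 x t"
proof -
  have "conv \<alpha> (src T) 0 0 x t \<le> 0"
    by (rule conv_le[OF M src_integrable], subst src_eq) (use assms box in \<open>auto simp: box_inside_def not_less\<close>)
  thus ?thesis using mollified_equation[of 0 0] mollified_dt_ge by linarith
qed

end

text \<open>Counterpart of \<open>smooth_approximation\<close> for the discontinuous source: only
  \<open>u\<close> is approximated uniformly, while derivatives are controlled by the bounds above,
  which hold without error. The parameter \<open>\<rho>'\<close> allows a further restriction of the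
  radius.\<close>

lemma mollified_approximation:
  assumes "\<rho> > 0" "\<eta> > 0" "\<rho>' > 0"
  obtains \<delta> \<alpha> where "mollifier \<delta> \<alpha>" "\<delta> < \<rho>'"
    "\<And>x t. x \<in> {-1 + \<rho>..1 - \<rho>} \<Longrightarrow> t \<in> {\<rho>..T} \<Longrightarrow> box_inside (T + 1) \<delta> x t"
    "\<And>x t. x \<in> {-1 + \<rho>..1 - \<rho>} \<Longrightarrow> t \<in> {\<rho>..T} \<Longrightarrow> \<bar>conv \<alpha> (cut (T + 1) u) 0 0 x t - u (x, t)\<bar> \<le> \<eta>"
proof -
  define K where "K = {-1..1::real} \<times> {0..T + 1}"
  have K: "compact K" unfolding K_def by (intro compact_Times compact_Icc)
  have uK: "continuous_on K u" by (rule continuous_on_subset[OF cont]) (auto simp: K_def closure_Q)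
  have wu: "cut (T + 1) u z = u z" if "z \<in> K" for z using that by (auto simp: cut_def K_def)
  obtain d where d: "d > 0" "\<And>\<delta> \<alpha> x t. mollifier \<delta> \<alpha> \<Longrightarrow> \<delta> < d \<Longrightarrow>
      {x - \<delta>..x + \<delta>} \<times> {t - \<delta>..t + \<delta>} \<subseteq> K \<Longrightarrow> \<bar>conv \<alpha> (cut (T + 1) u) 0 0 x t - u (x, t)\<bar> \<le> \<eta>"
    using conv_uniform_approximation[OF w_integrable K uK wu assms(2)] by blast
  define \<delta> where "\<delta> = Min {\<rho>, 1, d, \<rho>'} / 2"
  have \<delta>: "\<delta> > 0" "\<delta> < \<rho>" "\<delta> < 1" "\<delta> < d" "\<delta> < \<rho>'"
    using assms d(1) by (auto simp: \<delta>_def)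
  obtain \<alpha> where M: "mollifier \<delta> \<alpha>" using mollifier_exists[OF \<delta>(1)] .
  show ?thesis
  proof (rule that[OF M \<delta>(5)])
    fix x t assume "x \<in> {-1 + \<rho>..1 - \<rho>}" "t \<in> {\<rho>..T}"
    thus "box_inside (T + 1) \<delta> x t" using \<delta> by (auto simp: box_inside_def)
    hence "{x - \<delta>..x + \<delta>} \<times> {t - \<delta>..t + \<delta>} \<subseteq> K" by (auto simp: box_inside_def K_def)
    thus "\<bar>conv \<alpha> (cut (T + 1) u) 0 0 x t - u (x, t)\<bar> \<le> \<eta>" by (rule d(2)[OF M \<delta>(4)])
  qed
qed

section \<open>Estimates for the solution itself\<close>

lemma time_Lipschitz:
  assumes x: "x \<in> {-1<..<1}" and t: "t > 0" and s: "s \<ge> 0"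
  shows "u (x, t + s) \<le> u (x, t) + C * s"
proof (rule field_le_epsilon)
  fix e :: real assume e: "e > 0"
  define \<rho> where "\<rho> = Min {1 - \<bar>x\<bar>, t}"
  have \<rho>: "\<rho> > 0" using x t by (auto simp: \<rho>_def)
  have in1: "x \<in> {-1 + \<rho>..1 - \<rho>}" "t' \<in> {t..t + s} \<Longrightarrow> t' \<in> {\<rho>..t + s}" for t' by (auto simp: \<rho>_def)
  have e2: "e / 2 > 0" using e by simp
  obtain \<delta> \<alpha> where M: "mollifier \<delta> \<alpha>" and
    box: "\<And>x' t'. x' \<in> {-1 + \<rho>..1 - \<rho>} \<Longrightarrow> t' \<in> {\<rho>..t + s} \<Longrightarrow> box_inside (t + s + 1) \<delta> x' t'" and
    ap: "\<And>x' t'. x' \<in> {-1 + \<rho>..1 - \<rho>} \<Longrightarrow> t' \<in> {\<rho>..t + s} \<Longrightarrow> \<bar>conv \<alpha> (cut (t + s + 1) u) 0 0 x' t' - u (x', t')\<bar> \<le> e / 2"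
    by (rule mollified_approximation[OF \<rho> e2 zero_less_one, of "t + s"]) (rule that)
  have "C * t - conv \<alpha> (cut (t + s + 1) u) 0 0 x t \<le> C * (t + s) - conv \<alpha> (cut (t + s + 1) u) 0 0 x (t + s)"
  proof (rule DERIV_nonneg_imp_nondecreasing[of t "t + s" "\<lambda>t'. C * t' - conv \<alpha> (cut (t + s + 1) u) 0 0 x t'"])
    fix t' assume "t \<le> t'" "t' \<le> t + s"
    hence "conv \<alpha> (cut (t + s + 1) u) 0 (Suc 0) x t' \<le> C"
      by (intro mollified_dt_le[OF M] box in1) auto
    moreover have "((\<lambda>t'. C * t' - conv \<alpha> (cut (t + s + 1) u) 0 0 x t') has_real_derivative
        C - conv \<alpha> (cut (t + s + 1) u) 0 (Suc 0) x t') (at t')"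
      by (auto intro!: derivative_eq_intros conv_DERIV_t[OF M w_integrable])
    ultimately show "\<exists>y. ((\<lambda>t'. C * t' - conv \<alpha> (cut (t + s + 1) u) 0 0 x t') has_real_derivative y) (at t') \<and> 0 \<le> y"
      by force
  qed (use s in simp)
  thus "u (x, t + s) \<le> u (x, t) + C * s + e"
    using ap[OF in1(1), of t] ap[OF in1(1), of "t + s"] in1(2) s unfolding abs_le_iff
    by (simp add: algebra_simps)
qed

lemma u_convex:
  assumes t: "t > 0"
  shows "convex_on {-1<..<1} (\<lambda>x. u (x, t))"
proof (rule convex_onI)
  fix q x y :: real assume l: "0 < q" "q < 1" and xy: "x \<in> {-1<..<1}" "y \<in> {-1<..<1}"
  show "u ((1 - q) *\<^sub>R x + q *\<^sub>R y, t) \<le> (1 - q) * u (x, t) + q * u (y, t)"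
  proof (rule field_le_epsilon)
    fix e :: real assume e: "e > 0"
    define \<rho> where "\<rho> = Min {1 - \<bar>x\<bar>, 1 - \<bar>y\<bar>, t}"
    have \<rho>: "\<rho> > 0" using xy t by (auto simp: \<rho>_def)
    have in1: "x \<in> {-1 + \<rho>..1 - \<rho>}" "y \<in> {-1 + \<rho>..1 - \<rho>}" "t \<in> {\<rho>..t}" by (auto simp: \<rho>_def)
    have in2: "(1 - q) *\<^sub>R x + q *\<^sub>R y \<in> {-1 + \<rho>..1 - \<rho>}"
      using convexD[OF convex_real_interval(5)[of "-1 + \<rho>" "1 - \<rho>"] in1(1,2)] l by auto
    have e2: "e / 2 > 0" using e by simp
    obtain \<delta> \<alpha> where M: "mollifier \<delta> \<alpha>" and
      box: "\<And>x' t'. x' \<in> {-1 + \<rho>..1 - \<rho>} \<Longrightarrow> t' \<in> {\<rho>..t} \<Longrightarrow> box_inside (t + 1) \<delta> x' t'" and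
      ap: "\<And>x' t'. x' \<in> {-1 + \<rho>..1 - \<rho>} \<Longrightarrow> t' \<in> {\<rho>..t} \<Longrightarrow> \<bar>conv \<alpha> (cut (t + 1) u) 0 0 x' t' - u (x', t')\<bar> \<le> e / 2"
      by (rule mollified_approximation[OF \<rho> e2 zero_less_one, of "t"]) (rule that)
    let ?f = "\<lambda>x. conv \<alpha> (cut (t + 1) u) 0 0 x t"
    have "convex_on {-1 + \<rho>..1 - \<rho>} ?f"
    proof (rule f''_ge0_imp_convex)
      show "(?f has_real_derivative conv \<alpha> (cut (t + 1) u) (Suc 0) 0 z t) (at z)" for z
        by (rule conv_DERIV_x[OF M w_integrable])
      show "((\<lambda>x. conv \<alpha> (cut (t + 1) u) (Suc 0) 0 x t) has_real_derivative conv \<alpha> (cut (t + 1) u) (Suc (Suc 0)) 0 z t) (at z)" for z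
        by (rule conv_DERIV_x[OF M w_integrable])
      show "0 \<le> conv \<alpha> (cut (t + 1) u) (Suc (Suc 0)) 0 z t" if "z \<in> {-1 + \<rho>..1 - \<rho>}" for z
        by (rule mollified_xx_bounds[OF M box[OF that in1(3)]])
    qed simp
    from convex_onD[OF this, of q x y] l in1
    have "?f ((1 - q) *\<^sub>R x + q *\<^sub>R y) \<le> (1 - q) * ?f x + q * ?f y" by simp
    also have "\<dots> \<le> (1 - q) * (u (x, t) + e / 2) + q * (u (y, t) + e / 2)"
    proof (intro add_mono mult_left_mono)
      show "?f x \<le> u (x, t) + e / 2" using ap[OF in1(1,3)] by linarith
      show "?f y \<le> u (y, t) + e / 2" using ap[OF in1(2,3)] by linarith
    qed (use l in auto)
    also have "\<dots> = (1 - q) * u (x, t) + q * u (y, t) + e / 2"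
      by (simp add: field_simps)
    finally show "u ((1 - q) *\<^sub>R x + q *\<^sub>R y, t) \<le> (1 - q) * u (x, t) + q * u (y, t) + e"
      using ap[OF in2 in1(3)] by linarith
  qed
qed simp

lemma u_second_difference:
  assumes h: "h \<ge> 0" "-1 < x - h" "x + h < 1" and t: "t > 0"
  shows "u (x + h, t) + u (x - h, t) - 2 * u (x, t) \<le> C * h\<^sup>2"
    and "(\<And>y. y \<in> {x - h..x + h} \<Longrightarrow> u (y, t) < 0) \<Longrightarrow> h\<^sup>2 \<le> u (x + h, t) + u (x - h, t) - 2 * u (x, t)"
proof -
  define \<rho> where "\<rho> = Min {1 - \<bar>x + h\<bar>, 1 - \<bar>x - h\<bar>, t}"
  have \<rho>: "\<rho> > 0" using h t by (auto simp: \<rho>_def)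
  have in1: "y \<in> {-1 + \<rho>..1 - \<rho>}" if "y \<in> {x - h..x + h}" for y using that by (auto simp: \<rho>_def)
  have tt: "t \<in> {\<rho>..t}" by (auto simp: \<rho>_def)
  have pts: "x + h \<in> {x - h..x + h}" "x - h \<in> {x - h..x + h}" "x \<in> {x - h..x + h}" using h by auto
  have approx: "\<exists>\<delta> \<alpha>. mollifier \<delta> \<alpha> \<and> \<delta> < \<rho>' \<and> (\<forall>y\<in>{x - h..x + h}. box_inside (t + 1) \<delta> y t) \<and>
    \<bar>(conv \<alpha> (cut (t + 1) u) 0 0 (x + h) t + conv \<alpha> (cut (t + 1) u) 0 0 (x - h) t - 2 * conv \<alpha> (cut (t + 1) u) 0 0 x t)
      - (u (x + h, t) + u (x - h, t) - 2 * u (x, t))\<bar> \<le> e" if e: "e > 0" and \<rho>': "\<rho>' > 0" for e \<rho>'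
  proof -
    have e4: "e / 4 > 0" using e by simp
    obtain \<delta> \<alpha> where M: "mollifier \<delta> \<alpha>" "\<delta> < \<rho>'" and
      box: "\<And>x' t'. x' \<in> {-1 + \<rho>..1 - \<rho>} \<Longrightarrow> t' \<in> {\<rho>..t} \<Longrightarrow> box_inside (t + 1) \<delta> x' t'" and
      ap: "\<And>x' t'. x' \<in> {-1 + \<rho>..1 - \<rho>} \<Longrightarrow> t' \<in> {\<rho>..t} \<Longrightarrow> \<bar>conv \<alpha> (cut (t + 1) u) 0 0 x' t' - u (x', t')\<bar> \<le> e / 4"
      by (rule mollified_approximation[OF \<rho> e4 \<rho>', of "t"]) (rule that)
    show ?thesis
    proof (intro exI[of _ \<delta>] exI[of _ \<alpha>] conjI ballI M)
      show "box_inside (t + 1) \<delta> y t" if "y \<in> {x - h..x + h}" for y by (rule box[OF in1[OF that] tt])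
      show "\<bar>(conv \<alpha> (cut (t + 1) u) 0 0 (x + h) t + conv \<alpha> (cut (t + 1) u) 0 0 (x - h) t - 2 * conv \<alpha> (cut (t + 1) u) 0 0 x t)
        - (u (x + h, t) + u (x - h, t) - 2 * u (x, t))\<bar> \<le> e"
        using ap[OF in1[OF pts(1)] tt] ap[OF in1[OF pts(2)] tt] ap[OF in1[OF pts(3)] tt] by linarith
    qed
  qed
  show "u (x + h, t) + u (x - h, t) - 2 * u (x, t) \<le> C * h\<^sup>2"
  proof (rule field_le_epsilon)
    fix e :: real assume "e > 0"
    with approx[of e 1] obtain \<delta> \<alpha> where M: "mollifier \<delta> \<alpha>" and box: "\<forall>y\<in>{x - h..x + h}. box_inside (t + 1) \<delta> y t"
      and ap: "\<bar>(conv \<alpha> (cut (t + 1) u) 0 0 (x + h) t + conv \<alpha> (cut (t + 1) u) 0 0 (x - h) t - 2 * conv \<alpha> (cut (t + 1) u) 0 0 x t)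
      - (u (x + h, t) + u (x - h, t) - 2 * u (x, t))\<bar> \<le> e" by auto
    have "conv \<alpha> (cut (t + 1) u) 0 0 (x + h) t + conv \<alpha> (cut (t + 1) u) 0 0 (x - h) t - 2 * conv \<alpha> (cut (t + 1) u) 0 0 x t \<le> C * h\<^sup>2"
      by (rule second_difference_bounds(2)[OF conv_DERIV_x[OF M w_integrable] conv_DERIV_x[OF M w_integrable] h(1)])
        (use mollified_xx_bounds(2)[OF M] box in blast)
    thus "u (x + h, t) + u (x - h, t) - 2 * u (x, t) \<le> C * h\<^sup>2 + e" using ap by linarith
  qed
  assume neg: "\<And>y. y \<in> {x - h..x + h} \<Longrightarrow> u (y, t) < 0"
  show "h\<^sup>2 \<le> u (x + h, t) + u (x - h, t) - 2 * u (x, t)"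
  proof (rule field_le_epsilon)
    fix e :: real assume e: "e > 0"
    define K where "K = {-1..1::real} \<times> {0..t + 1}"
    have K: "compact K" unfolding K_def by (intro compact_Times compact_Icc)
    have uK: "continuous_on K u" by (rule continuous_on_subset[OF cont]) (auto simp: K_def closure_Q)
    have "continuous_on {x - h..x + h} (\<lambda>y. u (y, t))"
      by (rule continuous_on_compose2[OF uK]) (use h t in \<open>auto intro!: continuous_intros simp: K_def\<close>)
    then obtain y0 where y0: "y0 \<in> {x - h..x + h}" "\<And>y. y \<in> {x - h..x + h} \<Longrightarrow> u (y, t) \<le> u (y0, t)"
      using continuous_attains_sup[of "{x - h..x + h}" "\<lambda>y. u (y, t)"] pts by auto
    \<comment> \<open>On the compact segment \<open>u\<close> has a negative maximum. Uniform
      continuity with this margin keeps \<open>u\<close> nonpositive on all boxes around the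
      segment, since |y'| + |s| < 2 \<delta> < d.\<close>
    have m: "- u (y0, t) > 0" using neg[OF y0(1)] by simp
    obtain d where d: "d > 0" "\<And>z z'. z \<in> K \<Longrightarrow> z' \<in> K \<Longrightarrow> dist z' z < d \<Longrightarrow> dist (u z') (u z) < - u (y0, t)"
      using compact_uniformly_continuous[OF uK K] m unfolding uniformly_continuous_on_def by metis
    have "d / 2 > 0" using d by simp
    with approx[OF e] obtain \<delta> \<alpha> where M: "mollifier \<delta> \<alpha>" and \<delta>: "\<delta> < d / 2"
      and box: "\<forall>y\<in>{x - h..x + h}. box_inside (t + 1) \<delta> y t"
      and ap: "\<bar>(conv \<alpha> (cut (t + 1) u) 0 0 (x + h) t + conv \<alpha> (cut (t + 1) u) 0 0 (x - h) t - 2 * conv \<alpha> (cut (t + 1) u) 0 0 x t)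
      - (u (x + h, t) + u (x - h, t) - 2 * u (x, t))\<bar> \<le> e" by blast
    have "1 * h\<^sup>2 \<le> conv \<alpha> (cut (t + 1) u) 0 0 (x + h) t + conv \<alpha> (cut (t + 1) u) 0 0 (x - h) t - 2 * conv \<alpha> (cut (t + 1) u) 0 0 x t"
    proof (rule second_difference_bounds(1)[OF conv_DERIV_x[OF M w_integrable] conv_DERIV_x[OF M w_integrable] h(1)])
      fix y assume y: "y \<in> {x - h..x + h}"
      hence b: "box_inside (t + 1) \<delta> y t" using box by blast
      show "1 \<le> conv \<alpha> (cut (t + 1) u) (Suc (Suc 0)) 0 y t"
      proof (rule mollified_xx_ge_1[OF M b])
        fix y' s assume ys: "\<bar>y'\<bar> < \<delta>" "\<bar>s\<bar> < \<delta>"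
        have "dist (y - y', t - s) (y, t) \<le> \<bar>y'\<bar> + \<bar>s\<bar>"
          using sqrt_sum_squares_le_sum_abs[of y' s] by (simp add: dist_Pair_Pair dist_real_def)
        moreover have "(y - y', t - s) \<in> K" "(y, t) \<in> K" using b ys by (auto simp: box_inside_def K_def)
        ultimately show "u (y - y', t - s) \<le> 0"
          using d(2)[of "(y, t)" "(y - y', t - s)"] y0(2)[OF y] ys \<delta> by (auto simp: dist_real_def)
      qed
    qed
    thus "h\<^sup>2 \<le> u (x + h, t) + u (x - h, t) - 2 * u (x, t) + e" using ap by linarith
  qed
qed

end

section \<open>The truncated backward Gaussian\<close>

text \<open>The heat kernel in the reversed time \<tau> = T - t, without its factor 1 / sqrt (4
  pi).\<close>

definition gauss :: "real \<Rightarrow> real \<Rightarrow> real" where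
  "gauss x \<tau> = exp (- (x\<^sup>2 / (4 * \<tau>))) / sqrt \<tau>"

lemma gauss_pos: "\<tau> > 0 \<Longrightarrow> gauss x \<tau> > 0"
  by (simp add: gauss_def)

lemma gauss_antimono:
  assumes "\<tau> > 0" "\<bar>x\<bar> \<le> \<bar>y\<bar>"
  shows "gauss y \<tau> \<le> gauss x \<tau>"
proof -
  have "x\<^sup>2 \<le> y\<^sup>2" using assms(2) by (simp add: abs_le_square_iff)
  hence "x\<^sup>2 / (4 * \<tau>) \<le> y\<^sup>2 / (4 * \<tau>)" using assms by (intro divide_right_mono) auto
  thus ?thesis unfolding gauss_def using assms by (intro divide_right_mono) auto
qed

lemma gauss_DERIV_x:
  assumes "\<tau> > 0"
  shows "((\<lambda>x. gauss (x - a) \<tau>) has_real_derivative - ((x - a) / (2 * \<tau>) * gauss (x - a) \<tau>)) (at x)"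
proof -
  have "((\<lambda>x. - ((x - a)\<^sup>2 / (4 * \<tau>))) has_real_derivative - ((x - a) / (2 * \<tau>))) (at x)"
    using assms by (auto intro!: derivative_eq_intros simp: field_simps)
  from DERIV_cdivide[OF DERIV_fun_exp[OF this], of "sqrt \<tau>"] show ?thesis
    by (simp add: gauss_def mult.commute)
qed

lemma gauss_DERIV_xx:
  assumes "\<tau> > 0"
  shows "((\<lambda>x. - ((x - a) / (2 * \<tau>) * gauss (x - a) \<tau>)) has_real_derivative
    ((x - a)\<^sup>2 / (4 * \<tau>\<^sup>2) - 1 / (2 * \<tau>)) * gauss (x - a) \<tau>) (at x)"
  using assms
  by (auto intro!: derivative_eq_intros gauss_DERIV_x simp: field_simps power2_eq_square)

lemma gauss_DERIV_\<tau>: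
  assumes "\<tau> > 0"
  shows "(gauss x has_real_derivative (x\<^sup>2 / (4 * \<tau>\<^sup>2) - 1 / (2 * \<tau>)) * gauss x \<tau>) (at \<tau>)"
proof -
  have s: "sqrt \<tau> * sqrt \<tau> = \<tau>" using assms by simp
  have "((\<lambda>\<tau>. exp (- (x\<^sup>2 / (4 * \<tau>))) / sqrt \<tau>) has_real_derivative
     (exp (- (x\<^sup>2 / (4 * \<tau>))) * (x\<^sup>2 / (4 * \<tau>\<^sup>2)) * sqrt \<tau> - exp (- (x\<^sup>2 / (4 * \<tau>))) * (inverse (sqrt \<tau>) / 2)) / (sqrt \<tau> * sqrt \<tau>)) (at \<tau>)"
    using assms by (auto intro!: derivative_eq_intros simp: field_simps power2_eq_square)
  also have "(exp (- (x\<^sup>2 / (4 * \<tau>))) * (x\<^sup>2 / (4 * \<tau>\<^sup>2)) * sqrt \<tau> - exp (- (x\<^sup>2 / (4 * \<tau>))) * (inverse (sqrt \<tau>) / 2)) / (sqrt \<tau> * sqrt \<tau>)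
    = (x\<^sup>2 / (4 * \<tau>\<^sup>2) - 1 / (2 * \<tau>)) * gauss x \<tau>"
  proof -
    have "sqrt \<tau> \<noteq> 0" using assms by simp
    hence "(E * p * q - E * (inverse q / 2)) / (q * q) = (p - 1 / (2 * (q * q))) * (E / q)" if "q = sqrt \<tau>" for E p q
      using that by (simp add: field_simps)
    from this[OF refl, of "exp (- (x\<^sup>2 / (4 * \<tau>)))" "x\<^sup>2 / (4 * \<tau>\<^sup>2)"] show ?thesis
      unfolding s gauss_def by simp
  qed
  finally show ?thesis by (simp add: gauss_def[abs_def])
qed

text \<open>The inequality exp (-z) \<le> 1 / (1 + z) replaces the Gaussian by the derivative of an
  arctangent. The point is a bound independent of \<tau> and r; the integral over the whole line is
  2 sqrt pi.\<close>

lemma gauss_integral_le: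
  assumes \<tau>: "\<tau> > 0" and r: "r > 0"
  shows "integral {a - r..a + r} (\<lambda>x. gauss (x - a) \<tau>) \<le> 2 * pi"
proof -
  define s where "s = sqrt \<tau>"
  have s: "s > 0" "s * s = \<tau>" using \<tau> by (auto simp: s_def)
  define F where "F x = 2 * arctan ((x - a) / (2 * s))" for x
  have F: "(F has_real_derivative 1 / s / (1 + (x - a)\<^sup>2 / (4 * \<tau>))) (at x)" for x
  proof -
    have "(F has_real_derivative 2 * (inverse (1 + ((x - a) / (2 * s))\<^sup>2) * (1 / (2 * s)))) (at x)"
      unfolding F_def using s by (auto intro!: derivative_eq_intros)
    also have "((x - a) / (2 * s))\<^sup>2 = (x - a)\<^sup>2 / (4 * \<tau>)"
      by (simp add: power2_eq_square flip: s(2))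
    finally have "(F has_real_derivative 2 * (inverse (1 + (x - a)\<^sup>2 / (4 * \<tau>)) * (1 / (2 * s)))) (at x)" .
    moreover have "2 * (inverse d * (1 / (2 * s))) = 1 / s / d" for d
      using s(1) by (cases "d = 0") (simp_all add: divide_simps)
    ultimately show ?thesis by (simp only:)
  qed
  have hi: "((\<lambda>x. 1 / s / (1 + (x - a)\<^sup>2 / (4 * \<tau>))) has_integral F (a + r) - F (a - r)) {a - r..a + r}"
    using r F by (intro fundamental_theorem_of_calculus)
      (auto simp flip: has_real_derivative_iff_has_vector_derivative intro: has_field_derivative_at_within)
  have gi: "(\<lambda>x. gauss (x - a) \<tau>) integrable_on {a - r..a + r}"
    by (intro integrable_continuous_real continuous_at_imp_continuous_on ballI DERIV_isCont[OF gauss_DERIV_x[OF \<tau>]])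
  have le: "gauss (x - a) \<tau> \<le> 1 / s / (1 + (x - a)\<^sup>2 / (4 * \<tau>))" for x
  proof -
    define z where "z = (x - a)\<^sup>2 / (4 * \<tau>)"
    have z: "z \<ge> 0" using \<tau> by (simp add: z_def)
    have "exp (- z) \<le> 1 / (1 + z)"
      using exp_ge_add_one_self[of z] z by (simp add: exp_minus divide_simps)
    hence "exp (- z) / s \<le> 1 / (1 + z) / s" using s by (intro divide_right_mono) auto
    thus ?thesis by (simp add: gauss_def s_def z_def mult.commute)
  qed
  have "integral {a - r..a + r} (\<lambda>x. gauss (x - a) \<tau>) \<le> F (a + r) - F (a - r)"
    using has_integral_le[OF integrable_integral[OF gi] hi] le by blast
  also have "\<dots> \<le> 2 * pi"
    using arctan_ubound[of "r / (2 * s)"] arctan_lbound[of "- r / (2 * s)"] by (simp add: F_def)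
  finally show ?thesis .
qed

text \<open>Here \<open>W\<close>, \<open>Hx\<close>, \<open>g\<close> stand for the mollified \<open>u\<^sub>x\<^sub>x\<close>, \<open>u\<^sub>t\<^sub>x\<close>, \<open>\<chi>\<close>, so that \<open>Hx = Wx + gx\<close> and \<open>Hx\<^sub>x = Wt\<close>.\<close>

lemma gaussian_mass_log_growth:
  fixes W Wx Wt Hx g gx :: "real \<Rightarrow> real \<Rightarrow> real"
  assumes r: "r > 0" and t12: "t1 < t2" "t2 < T" and Tr: "T - t1 \<le> r\<^sup>2 / 2" and c: "c > 0" "c' > 0"
    and Wt: "\<And>x t. ((\<lambda>t. W x t) has_real_derivative Wt x t) (at t)"
    and Wx: "\<And>x t. ((\<lambda>x. W x t) has_real_derivative Wx x t) (at x)"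
    and Hxx: "\<And>x t. ((\<lambda>x. Hx x t) has_real_derivative Wt x t) (at x)"
    and gx: "\<And>x t. ((\<lambda>x. g x t) has_real_derivative gx x t) (at x)"
    and Wc: "continuous_on UNIV (\<lambda>z. W (fst z) (snd z))" and Wtc: "continuous_on UNIV (\<lambda>z. Wt (fst z) (snd z))"
    and eq: "\<And>x t. \<bar>x - a\<bar> \<le> r \<Longrightarrow> t \<in> {t1..t2} \<Longrightarrow> Hx x t = Wx x t + gx x t"
    and Wb: "\<And>x t. \<bar>x - a\<bar> \<le> r \<Longrightarrow> t \<in> {t1..t2} \<Longrightarrow> 0 \<le> W x t \<and> W x t \<le> C"
    and sgn: "\<And>x t. \<bar>x - a\<bar> \<le> r \<Longrightarrow> t \<in> {t1..t2} \<Longrightarrow> 0 \<le> gx x t * (x - a)"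
    and supp: "\<And>x t. \<bar>x - a\<bar> \<le> r \<Longrightarrow> t \<in> {t1..t2} \<Longrightarrow> gx x t \<noteq> 0 \<Longrightarrow>
      c * sqrt (T - t) \<le> \<bar>x - a\<bar> \<and> \<bar>x - a\<bar> \<le> c' * sqrt (T - t)"
    and jump: "\<And>t. t \<in> {t1..t2} \<Longrightarrow> g (a + r) t - g a t = 1"
  shows "c / 2 * exp (- (c'\<^sup>2 / 4)) * ln ((T - t1) / (T - t2)) \<le> 2 * pi * C"
proof -
  define c0 where "c0 = c / 2 * exp (- (c'\<^sup>2 / 4))"
  have c0: "c0 > 0" using c by (simp add: c0_def)
  \<comment> \<open>Subtracting the boundary value makes \<open>K\<close> vanish at \<open>a - r\<close> and \<open>a + r\<close>, and \<open>K\<close> remains a backward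
    subsolution while \<open>T - t \<le> r\<^sup>2 / 2\<close>, so no error terms arise.\<close>
  define K where "K x t = gauss (x - a) (T - t) - gauss r (T - t)" for x t
  define Kx where "Kx x t = - ((x - a) / (2 * (T - t)) * gauss (x - a) (T - t))" for x t
  define P where "P x \<tau> = (x\<^sup>2 / (4 * \<tau>\<^sup>2) - 1 / (2 * \<tau>)) * gauss x \<tau>" for x \<tau> :: real
  define Kt where "Kt x t = - P (x - a) (T - t) + P r (T - t)" for x t
  define f where "f t x = Wt x t * K x t + W x t * Kt x t" for t x
  define A where "A t = integral (cbox (a - r) (a + r)) (\<lambda>x. W x t * K x t)" for t
  have K: "((\<lambda>x. K x t) has_real_derivative Kx x t) (at x)" if "t < T" for x t
    unfolding K_def Kx_def using gauss_DERIV_x[of "T - t" a x] that by (auto intro!: derivative_eq_intros)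
  have Kx: "((\<lambda>x. Kx x t) has_real_derivative P (x - a) (T - t)) (at x)" if "t < T" for x t
    unfolding Kx_def P_def using gauss_DERIV_xx[of "T - t" a x] that by simp
  have gt: "((\<lambda>t. gauss y (T - t)) has_real_derivative - P y (T - t)) (at t)" if "t < T" for y t
  proof -
    have "((\<lambda>t. gauss y (T - t)) has_real_derivative P y (T - t) * (-1)) (at t)"
      unfolding P_def by (rule DERIV_chain2[OF gauss_DERIV_\<tau>]) (use that in \<open>auto intro!: derivative_eq_intros\<close>)
    thus ?thesis by simp
  qed
  have Kt: "((\<lambda>t. K x t) has_real_derivative Kt x t) (at t)" if "t < T" for x t
    unfolding K_def Kt_def using gt[OF that] by (auto intro!: derivative_eq_intros)
  have cW: "continuous_on S (\<lambda>z. W (snd z) (fst z))" and cWt: "continuous_on S (\<lambda>z. Wt (snd z) (fst z))" for S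
    using continuous_on_compose2[OF Wc continuous_on_swap] continuous_on_compose2[OF Wtc continuous_on_swap]
    by (auto simp: prod.swap_def)
  have cG: "continuous_on ({..<T} \<times> cbox (a - r) (a + r)) (\<lambda>z. gauss (snd z - a) (T - fst z))"
    "continuous_on ({..<T} \<times> cbox (a - r) (a + r)) (\<lambda>z. gauss r (T - fst z))"
    unfolding gauss_def by (intro continuous_intros; auto)+
  have cf: "continuous_on ({..<T} \<times> cbox (a - r) (a + r)) (\<lambda>(t, x). f t x)"
    unfolding f_def K_def Kt_def P_def case_prod_beta'
    by (intro continuous_intros cW cWt cG; auto)
  have cx: "continuous_on S (\<lambda>x. W x t)" "continuous_on S (\<lambda>x. Wt x t)" for S t
  proof -
    have p: "continuous_on S (\<lambda>x. (x, t))" by (intro continuous_on_Pair continuous_on_id continuous_on_const)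
    show "continuous_on S (\<lambda>x. W x t)" "continuous_on S (\<lambda>x. Wt x t)"
      using continuous_on_compose2[OF Wc p] continuous_on_compose2[OF Wtc p] by auto
  qed
  have fi: "f t integrable_on {b..d}" if "t < T" for t b d
  proof -
    have "continuous_on {b..d} (\<lambda>x. gauss (x - a) (T - t))"
      using that by (intro continuous_at_imp_continuous_on ballI DERIV_isCont[OF gauss_DERIV_x]) auto
    thus ?thesis unfolding f_def K_def Kt_def P_def
      using that by (intro integrable_continuous_real continuous_intros cx) auto
  qed
  have WKi: "(\<lambda>x. W x t * K x t) integrable_on cbox (a - r) (a + r)" if "t < T" for t
  proof -
    have "continuous_on {a - r..a + r} (\<lambda>x. K x t)"
      by (intro continuous_at_imp_continuous_on ballI DERIV_isCont[OF K[OF that]])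
    from integrable_continuous_real[OF continuous_on_mult[OF cx(1) this]] show ?thesis by simp
  qed
  have A: "(A has_real_derivative integral (cbox (a - r) (a + r)) (f t)) (at t)" if "t < T" for t
  proof -
    have "((\<lambda>t. integral (cbox (a - r) (a + r)) (\<lambda>x. W x t * K x t)) has_real_derivative integral (cbox (a - r) (a + r)) (f t)) (at t within {..<T})"
    proof (rule leibniz_rule_field_derivative[OF _ _ cf])
      fix s x assume s: "s \<in> {..<T}"
      show "((\<lambda>s. W x s * K x s) has_real_derivative f s x) (at s within {..<T})"
        unfolding f_def using s
        by (intro has_field_derivative_at_within[OF DERIV_mult'[OF Wt Kt, THEN DERIV_cong]]) auto
    qed (use that WKi in auto)
    thus ?thesis using that at_within_open[of t "{..<T}"] by (simp add: A_def[abs_def])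
  qed
  have key: "c0 / (T - t) \<le> integral (cbox (a - r) (a + r)) (f t)" if t: "t \<in> {t1..t2}" for t
  proof -
    define \<tau> where "\<tau> = T - t"
    have tT: "t < T" using t t12 by auto
    have \<tau>: "\<tau> > 0" "\<tau> \<le> r\<^sup>2 / 2" using tT t Tr by (auto simp: \<tau>_def)
    \<comment> \<open>The primitive that integrates by parts twice at once: for |x - a| \<le> r its
      derivative is Wt K + gx Kx - W Kxx, so \<open>f t x\<close> is this derivative minus gx Kx
      plus W times \<open>P r \<tau>\<close>.\<close>
    define \<Phi> where "\<Phi> x = Hx x t * K x t - W x t * Kx x t" for x
    have \<Phi>: "(\<Phi> has_real_derivative Wt x t * K x t + Hx x t * Kx x t - (Wx x t * Kx x t + W x t * P (x - a) \<tau>)) (at x)" for x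
      unfolding \<Phi>_def \<tau>_def
      by (rule DERIV_cong[OF DERIV_diff[OF DERIV_mult[OF Hxx K[OF tT]] DERIV_mult[OF Wx Kx[OF tT]]]]) simp
    \<comment> \<open>\<open>P r \<tau>\<close> is the \<tau>-derivative of
      \<open>gauss r \<tau>\<close>, which is nonnegative as long as 2 \<tau> \<le> r^2; so the
      subtracted boundary value contributes with the right sign.\<close>
    have Pr: "P r \<tau> \<ge> 0"
    proof -
      have "1 / (2 * \<tau>) \<le> r\<^sup>2 / (4 * \<tau>\<^sup>2)" using \<tau> by (simp add: divide_simps power2_eq_square)
      thus ?thesis using gauss_pos[OF \<tau>(1), of r] by (simp add: P_def)
    qed
    have f_ge: "Wt x t * K x t + Hx x t * Kx x t - (Wx x t * Kx x t + W x t * P (x - a) \<tau>) - gx x t * Kx x t \<le> f t x"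
      if "\<bar>x - a\<bar> \<le> r" for x
    proof -
      have "f t x = Wt x t * K x t - W x t * P (x - a) \<tau> + W x t * P r \<tau>"
        by (simp add: f_def Kt_def \<tau>_def algebra_simps)
      moreover have "W x t * P r \<tau> \<ge> 0" using Wb[OF that t] Pr by simp
      moreover have "Hx x t * Kx x t = Wx x t * Kx x t + gx x t * Kx x t" by (simp add: eq[OF that t] algebra_simps)
      ultimately show ?thesis by linarith
    qed
    have gK0: "- (gx x t * Kx x t) = gx x t * (x - a) * (gauss (x - a) \<tau> / (2 * \<tau>))" for x
      by (simp add: Kx_def \<tau>_def)
    have gK: "0 \<le> - (gx x t * Kx x t)" if "\<bar>x - a\<bar> \<le> r" for x
      unfolding gK0 by (rule mult_nonneg_nonneg) (use sgn[OF that t] gauss_pos[OF \<tau>(1), of "x - a"] \<tau> in auto)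
    \<comment> \<open>On the support of \<open>gx\<close> the factor x - a is at least c sqrt \<tau>
      and the kernel at least its value at c' sqrt \<tau>; their product divided by 2 \<tau> is at
      least c0 / \<tau>.\<close>
    have gK': "c0 / \<tau> * gx x t \<le> - (gx x t * Kx x t)" if x: "\<bar>x - a\<bar> \<le> r" "x \<ge> a" for x
    proof (cases "gx x t = 0")
      case False
      have s: "c * sqrt \<tau> \<le> x - a" "x - a \<le> c' * sqrt \<tau>" using supp[OF x(1) t False] x(2) by (auto simp: \<tau>_def)
      have s0: "sqrt \<tau> > 0" "sqrt \<tau> * sqrt \<tau> = \<tau>" using \<tau> by auto
      have xa: "x - a > 0" using s(1) c s0(1) mult_pos_pos[of c "sqrt \<tau>"] by linarith
      hence gp: "gx x t \<ge> 0" using sgn[OF x(1) t] by (simp add: zero_le_mult_iff)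
      have "gauss (c' * sqrt \<tau>) \<tau> \<le> gauss (x - a) \<tau>"
        using s xa by (intro gauss_antimono \<tau>) auto
      moreover have "gauss (c' * sqrt \<tau>) \<tau> = exp (- (c'\<^sup>2 / 4)) / sqrt \<tau>"
        using \<tau> by (simp add: gauss_def power_mult_distrib)
      ultimately have "(c * sqrt \<tau>) * (exp (- (c'\<^sup>2 / 4)) / sqrt \<tau>) \<le> (x - a) * gauss (x - a) \<tau>"
        using s xa s0 by (intro mult_mono) auto
      hence "c0 / \<tau> \<le> (x - a) * (gauss (x - a) \<tau> / (2 * \<tau>))"
        using \<tau> s0 by (simp add: c0_def divide_simps)
      from mult_left_mono[OF this gp] show ?thesis unfolding gK0 by (simp add: mult_ac)
    qed simp
    \<comment> \<open>On the left half the source term is kept only as nonnegative; the rise of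
      \<open>g\<close> between a and a + r already supplies the rate.\<close>
    have left: "\<Phi> a - \<Phi> (a - r) \<le> integral {a - r..a} (f t)"
    proof (rule has_integral_le[OF _ integrable_integral[OF fi[OF tT]]])
      show "((\<lambda>x. Wt x t * K x t + Hx x t * Kx x t - (Wx x t * Kx x t + W x t * P (x - a) \<tau>)) has_integral \<Phi> a - \<Phi> (a - r)) {a - r..a}"
        using r \<Phi> by (intro fundamental_theorem_of_calculus)
          (auto simp flip: has_real_derivative_iff_has_vector_derivative intro: has_field_derivative_at_within)
      fix x assume "x \<in> {a - r..a}"
      hence "\<bar>x - a\<bar> \<le> r" by auto
      from f_ge[OF this] gK[OF this]
      show "Wt x t * K x t + Hx x t * Kx x t - (Wx x t * Kx x t + W x t * P (x - a) \<tau>) \<le> f t x" by linarith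
    qed
    have right: "(\<Phi> (a + r) + c0 / \<tau> * g (a + r) t) - (\<Phi> a + c0 / \<tau> * g a t) \<le> integral {a..a + r} (f t)"
    proof (rule has_integral_le[OF _ integrable_integral[OF fi[OF tT]]])
      have "((\<lambda>x. \<Phi> x + c0 / \<tau> * g x t) has_real_derivative
         (Wt x t * K x t + Hx x t * Kx x t - (Wx x t * Kx x t + W x t * P (x - a) \<tau>)) + c0 / \<tau> * gx x t) (at x)" for x
        by (intro DERIV_add \<Phi> DERIV_cmult gx)
      thus "((\<lambda>x. (Wt x t * K x t + Hx x t * Kx x t - (Wx x t * Kx x t + W x t * P (x - a) \<tau>)) + c0 / \<tau> * gx x t)
          has_integral (\<Phi> (a + r) + c0 / \<tau> * g (a + r) t) - (\<Phi> a + c0 / \<tau> * g a t)) {a..a + r}"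
        using r by (intro fundamental_theorem_of_calculus)
          (auto simp flip: has_real_derivative_iff_has_vector_derivative intro: has_field_derivative_at_within)
      fix x assume "x \<in> {a..a + r}"
      hence x: "\<bar>x - a\<bar> \<le> r" "x \<ge> a" by auto
      from f_ge[OF x(1)] gK'[OF x]
      show "(Wt x t * K x t + Hx x t * Kx x t - (Wx x t * Kx x t + W x t * P (x - a) \<tau>)) + c0 / \<tau> * gx x t \<le> f t x" by linarith
    qed
    \<comment> \<open>At both ends K vanishes and only - W Kx remains; since the Gaussian decreases
      outwards, both boundary terms are favourable.\<close>
    have "\<Phi> (a + r) \<ge> 0"
    proof -
      have "W (a + r) t * (r / (2 * \<tau>) * gauss r \<tau>) \<ge> 0"
        using Wb[of "a + r" t] t r \<tau> gauss_pos[OF \<tau>(1), of r] by (intro mult_nonneg_nonneg) auto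
      thus ?thesis by (simp add: \<Phi>_def K_def Kx_def \<tau>_def)
    qed
    moreover have "\<Phi> (a - r) \<le> 0"
    proof -
      have "W (a - r) t * (r / (2 * \<tau>) * gauss r \<tau>) \<ge> 0"
        using Wb[of "a - r" t] t r \<tau> gauss_pos[OF \<tau>(1), of r] by (intro mult_nonneg_nonneg) auto
      thus ?thesis by (simp add: \<Phi>_def K_def Kx_def \<tau>_def gauss_def)
    qed
    moreover have "c0 / \<tau> * g (a + r) t - c0 / \<tau> * g a t = c0 / \<tau>"
      using jump[OF t] unfolding right_diff_distrib[symmetric] by simp
    moreover have "integral {a - r..a + r} (f t) = integral {a - r..a} (f t) + integral {a..a + r} (f t)"
      using r by (intro Henstock_Kurzweil_Integration.integral_combine[symmetric] fi tT) auto
    ultimately show ?thesis using left right by (simp add: \<tau>_def)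
  qed
  \<comment> \<open>The derivative - c0 / (T - t) of the logarithm is compensated by
    \<open>key\<close>. With A nonnegative at t1 and at most 2 pi C at t2, the logarithm of the
    ratio of remaining times is bounded.\<close>
  have mono: "A t1 + c0 * ln (T - t1) \<le> A t2 + c0 * ln (T - t2)"
  proof (rule DERIV_nonneg_imp_nondecreasing[of t1 t2 "\<lambda>t. A t + c0 * ln (T - t)"])
    fix t assume t: "t1 \<le> t" "t \<le> t2"
    hence tT: "t < T" using t12 by simp
    have "((\<lambda>t. A t + c0 * ln (T - t)) has_real_derivative integral (cbox (a - r) (a + r)) (f t) - c0 / (T - t)) (at t)"
      using tT by (auto intro!: derivative_eq_intros A simp: divide_simps)
    thus "\<exists>y. ((\<lambda>t. A t + c0 * ln (T - t)) has_real_derivative y) (at t) \<and> 0 \<le> y"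
      using key[of t] t by force
  qed (use t12 in simp)
  have K0: "0 \<le> K x t" if "\<bar>x - a\<bar> \<le> r" "t < T" for x t
    unfolding K_def using gauss_antimono[of "T - t" "x - a" r] that r by simp
  have "A t1 \<ge> 0"
    unfolding A_def
    by (rule integral_nonneg[OF WKi]) (use t12 Wb K0 in \<open>auto intro!: mult_nonneg_nonneg simp: abs_le_iff\<close>)
  moreover have "A t2 \<le> C * (2 * pi)"
  proof -
    have gi: "(\<lambda>x. C * gauss (x - a) (T - t2)) integrable_on cbox (a - r) (a + r)"
    proof -
      have "continuous_on {a - r..a + r} (\<lambda>x. gauss (x - a) (T - t2))"
        using t12 by (intro continuous_at_imp_continuous_on ballI DERIV_isCont[OF gauss_DERIV_x]) auto
      from integrable_continuous_real[OF continuous_on_mult[OF continuous_on_const this]] show ?thesis by simp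
    qed
    have C0: "C \<ge> 0" using Wb[of a t2] t12 r by auto
    have "A t2 \<le> integral (cbox (a - r) (a + r)) (\<lambda>x. C * gauss (x - a) (T - t2))"
      unfolding A_def
    proof (rule integral_le[OF WKi gi])
      fix x assume "x \<in> cbox (a - r) (a + r)"
      hence x: "\<bar>x - a\<bar> \<le> r" by (auto simp: abs_le_iff)
      have "K x t2 \<le> gauss (x - a) (T - t2)" using gauss_pos[of "T - t2" r] t12 by (simp add: K_def)
      thus "W x t2 * K x t2 \<le> C * gauss (x - a) (T - t2)"
        using Wb[OF x, of t2] K0[OF x, of t2] t12 C0 by (intro mult_mono) auto
    qed (use t12 in simp)
    also have "\<dots> = C * integral {a - r..a + r} (\<lambda>x. gauss (x - a) (T - t2))" by simp
    also have "\<dots> \<le> C * (2 * pi)" by (intro mult_left_mono gauss_integral_le C0 r) (use t12 in simp)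
    finally show ?thesis .
  qed
  ultimately have "c0 * (ln (T - t1) - ln (T - t2)) \<le> 2 * pi * C"
    using mono by (simp add: algebra_simps)
  thus ?thesis using t12 by (simp add: c0_def ln_div)
qed

section \<open>First contact and the contradiction\<close>

context bounded_time_derivative
begin

text \<open>The point with the largest time in the compact set where u \<le> 0 and t \<le> 1.
  Stopping at time 1 is harmless, as the subsolution is 2 x^2 \<ge> 0 there. A negative value at an
  earlier last time would persist a little longer by continuity.\<close>

lemma first_contact:
  obtains T a where "T > 0" "a \<in> {-1<..<1}" "u (a, T) = 0" "\<And>x. x \<in> {-1..1} \<Longrightarrow> 0 \<le> u (x, T)"
proof -
  define K where "K = {-1..1::real} \<times> {0..1::real}"
  define N where "N = {z \<in> K. u z \<le> 0}"
  have uK: "continuous_on K u" by (rule continuous_on_subset[OF cont]) (auto simp: K_def closure_Q)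
  have "compact N"
  proof -
    have K: "compact K" unfolding K_def by (intro compact_Times compact_Icc)
    have "closed N" unfolding N_def
      using continuous_on_closed_Collect_le[OF uK continuous_on_const compact_imp_closed[OF K], of 0] .
    hence "compact (K \<inter> N)" using K by (rule compact_Int_closed[rotated])
    moreover have "K \<inter> N = N" by (auto simp: N_def)
    ultimately show ?thesis by simp
  qed
  moreover have "(0, 0) \<in> N" using start by (auto simp: N_def K_def)
  ultimately obtain z where z: "z \<in> N" "\<And>z'. z' \<in> N \<Longrightarrow> snd z' \<le> snd z"
    using continuous_attains_sup[of N snd] by (force intro: continuous_intros)
  obtain a T where zeq: "z = (a, T)" by (cases z)
  have aT: "a \<in> {-1..1}" "0 \<le> T" "T \<le> 1" "u (a, T) \<le> 0" using z(1) by (auto simp: zeq N_def K_def)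
  have nonneg: "0 \<le> u (x, T)" if x: "x \<in> {-1..1}" for x
  proof (rule ccontr)
    assume neg: "\<not> 0 \<le> u (x, T)"
    have "2 * x\<^sup>2 \<le> u (x, 1)" using lower[of "(x, 1)"] x by (simp add: closure_Q)
    hence "0 \<le> u (x, 1)" using zero_le_power2[of x] by linarith
    hence "T \<noteq> 1" using neg by auto
    hence T1: "T < 1" using aT by simp
    have c: "continuous_on {0..1} (\<lambda>s. u (x, s))"
      by (rule continuous_on_compose2[OF uK]) (use x in \<open>auto intro!: continuous_intros simp: K_def\<close>)
    hence "continuous (at T within {0..1}) (\<lambda>s. u (x, s))"
      using aT by (auto simp: continuous_on_eq_continuous_within)
    hence "continuous (at T within {T..1}) (\<lambda>s. u (x, s))"
      by (rule continuous_within_subset) (use aT in auto)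
    hence "((\<lambda>s. u (x, s)) \<longlongrightarrow> u (x, T)) (at_right T)"
      using T1 by (simp add: continuous_within at_within_Icc_at_right)
    hence "\<forall>\<^sub>F s in at_right T. u (x, s) < 0"
      using neg by (intro order_tendstoD(2)) auto
    then obtain b where b: "b > T" "\<And>s. T < s \<Longrightarrow> s < b \<Longrightarrow> u (x, s) < 0"
      unfolding eventually_at_right_field by blast
    define s where "s = (T + min b 1) / 2"
    have s: "T < s" "s < b" "s < 1" using b(1) T1 by (auto simp: s_def)
    have "(x, s) \<in> N" using b(2)[OF s(1,2)] s x aT by (auto simp: N_def K_def)
    from z(2)[OF this] s show False by (simp add: zeq)
  qed
  have "T \<noteq> 0" using nonneg[of 0] start by auto
  hence T: "T > 0" using aT by simp
  have "a \<noteq> 1" "a \<noteq> -1" using lateral[of a T] T aT by auto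
  hence "a \<in> {-1<..<1}" using aT by auto
  moreover have "u (a, T) = 0" using nonneg[OF aT(1)] aT by simp
  ultimately show ?thesis using that T nonneg by blast
qed

lemma u_le_on_segment:
  assumes "t > 0" "p \<in> {-1<..<1}" "q \<in> {-1<..<1}" "u (p, t) \<le> m" "u (q, t) \<le> m" "p \<le> y" "y \<le> q"
  shows "u (y, t) \<le> m"
proof (cases "p = q")
  case False
  define s where "s = (y - p) / (q - p)"
  have pq: "q - p > 0" using False assms by simp
  have s: "0 \<le> s" "s \<le> 1" using assms pq by (auto simp: s_def divide_simps)
  have "s * (q - p) = y - p" using pq by (simp add: s_def)
  hence y: "(1 - s) *\<^sub>R p + s *\<^sub>R q = y" by (simp add: algebra_simps)
  have "u (y, t) \<le> (1 - s) * u (p, t) + s * u (q, t)"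
    using convex_onD[OF u_convex[OF assms(1)] s assms(2,3)] by (simp only: y)
  also have "\<dots> \<le> (1 - s) * m + s * m"
    using s assms by (intro add_mono mult_left_mono) auto
  finally show ?thesis by (simp add: algebra_simps)
qed (use assms in auto)

section \<open>The nonpositive set seen from the contact point\<close>

context
  fixes T a :: real
  assumes T: "T > 0" and a: "a \<in> {-1<..<1}" and contact: "u (a, T) = 0"
    and nonneg: "\<And>x. x \<in> {-1..1} \<Longrightarrow> 0 \<le> u (x, T)"
begin

private lemma u_le_final: "x \<in> {-1..1} \<Longrightarrow> 0 \<le> t \<Longrightarrow> t \<le> T \<Longrightarrow> u (x, t) + (T - t) \<le> u (x, T)"
  using growth[of "(x, t)" "T - t"] by (simp add: closure_Q)

private lemma u_center_neg: "0 \<le> t \<Longrightarrow> t < T \<Longrightarrow> u (a, t) < 0"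
  using u_le_final[of a t] a contact by simp

text \<open>At time T the values at a + h and a - h are nonnegative and, since u vanishes at a,
  their sum is a second difference, at most C h^2; hence each is. Going back to time t lowers u by
  at least T - t.\<close>

lemma negative_near_contact:
  assumes h: "-1 < a - \<bar>x - a\<bar>" "a + \<bar>x - a\<bar> < 1" and t: "0 \<le> t" "t < T" and C: "C * (x - a)\<^sup>2 < T - t"
  shows "u (x, t) < 0"
proof -
  define h where "h = \<bar>x - a\<bar>"
  have "u (a + h, T) + u (a - h, T) \<le> C * h\<^sup>2"
    using u_second_difference(1)[of h a T] h T contact by (simp add: h_def)
  moreover have "0 \<le> u (a + h, T)" "0 \<le> u (a - h, T)"
    by (intro nonneg; use h a in \<open>auto simp: h_def\<close>)+
  moreover have "x = a + h \<or> x = a - h" by (auto simp: h_def)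
  ultimately have "u (x, T) \<le> C * h\<^sup>2" by auto
  moreover have "x \<in> {-1..1}" using h by auto
  ultimately show ?thesis using u_le_final[of x t] t C by (simp add: h_def)
qed

text \<open>If u is negative on the segment between a and x, of half-length h, the second difference
  pushes its midpoint down to -h^2 / 2 or lower. The time Lipschitz bound allows a depth of at most
  C times the remaining time, since u is nonnegative at T.\<close>

lemma nonpositive_imp_near_contact:
  assumes x: "x \<in> {-1<..<1}" and t: "0 < t" "t < T" and neg: "u (x, t) \<le> 0"
  shows "(x - a)\<^sup>2 \<le> 16 * C * (T - t)"
proof -
  \<comment> \<open>A slightly earlier time makes u strictly negative at x, hence on the whole
    segment. The step T - t at most doubles the remaining time, and t / 2 keeps \<open>t'\<close>
    positive.\<close>
  define t' where "t' = t - min (T - t) (t / 2)"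
  have t': "0 < t'" "t' < t" "T - t' \<le> 2 * (T - t)" using t by (auto simp: t'_def min_def field_simps)
  define m h where "m = (x + a) / 2" and "h = \<bar>x - a\<bar> / 2"
  have xneg: "u (x, t') < 0"
    using growth[of "(x, t')" "t - t'"] t' x neg by (simp add: closure_Q)
  have aneg: "u (a, t') < 0" using u_center_neg[of t'] t' t by simp
  have seg: "u (y, t') < 0" if "y \<in> {m - h..m + h}" for y
  proof -
    have "u (y, t') \<le> max (u (x, t')) (u (a, t'))"
    proof (cases "x \<le> a")
      case True
      hence "m - h = x" "m + h = a" by (simp_all add: m_def h_def field_simps)
      hence "x \<le> y" "y \<le> a" using that unfolding atLeastAtMost_iff by linarith+
      thus ?thesis by (rule u_le_on_segment[OF t'(1) x a max.cobounded1 max.cobounded2])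
    next
      case False
      hence "m - h = a" "m + h = x" by (simp_all add: m_def h_def field_simps)
      hence "a \<le> y" "y \<le> x" using that unfolding atLeastAtMost_iff by linarith+
      thus ?thesis by (rule u_le_on_segment[OF t'(1) a x max.cobounded2 max.cobounded1])
    qed
    thus ?thesis using xneg aneg by simp
  qed
  have mh: "-1 < m - h" "m + h < 1" "h \<ge> 0" using x a by (auto simp: m_def h_def field_simps abs_if)
  have m: "m \<in> {-1<..<1}" using mh by auto
  have "h\<^sup>2 \<le> u (m + h, t') + u (m - h, t') - 2 * u (m, t')"
    by (rule u_second_difference(2)) (use mh t' seg in auto)
  also have "\<dots> \<le> - 2 * u (m, t')" using seg[of "m + h"] seg[of "m - h"] mh(3) by simp
  finally have h2: "h\<^sup>2 \<le> - 2 * u (m, t')" .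
  have "0 \<le> u (m, T)" using m by (intro nonneg) auto
  also have "\<dots> \<le> u (m, t') + C * (T - t')"
    using time_Lipschitz[OF m t'(1), of "T - t'"] t' t by simp
  also have "\<dots> \<le> u (m, t') + C * (2 * (T - t))" using t' C by (intro add_left_mono mult_left_mono) auto
  finally have "h\<^sup>2 \<le> 4 * C * (T - t)" using h2 by (simp add: algebra_simps)
  moreover have "(x - a)\<^sup>2 = 4 * h\<^sup>2" by (simp add: h_def power_divide)
  ultimately show ?thesis by simp
qed

private lemma src_monotone:
  assumes "p \<in> {-1<..<1}" "q \<in> {-1<..<1}" "0 < t" "t < T" "a \<le> p \<and> p \<le> q \<or> q \<le> p \<and> p \<le> a"
  shows "src (T + 1) (p, t) \<le> src (T + 1) (q, t)"
proof -
  have "u (p, t) \<le> 0" if "u (q, t) \<le> 0"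
    using u_le_on_segment[OF assms(3) a assms(2), of 0 p] u_le_on_segment[OF assms(3) assms(2) a, of 0 p]
      that u_center_neg[of t] assms by auto
  thus ?thesis using assms by (auto simp: src_eq not_less)
qed

lemma contact_contradiction: False
proof -
  \<comment> \<open>The Gaussian lives on |x - a| \<le> r. The mollified source is described on |x -
    a| \<le> 2 r, so that its derivative is known up to distance r, and mollification reaches less
    than 3 r, still inside the space interval.\<close>
  define r where "r = min (1 - a) (1 + a) / 4"
  have r: "r > 0" "-1 + 2 * r \<le> a - 2 * r" "a + 2 * r \<le> 1 - 2 * r" using a by (auto simp: r_def)
  \<comment> \<open>Write \<tau> = T - t; after mollification the remaining time lies between \<tau>
    / 2 and 2 \<tau>. Points within c sqrt \<tau> move to at most 2 c sqrt \<tau>, and C (2 c)^2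
    \<tau> = \<tau> / 4 < \<tau> / 2 gives u < 0. Points beyond c' sqrt \<tau> stay at least 7 sqrt
    (C \<tau>) away, while u \<le> 0 would need a squared distance of at most 32 C \<tau>.\<close>
  define c c' where "c = 1 / (4 * sqrt C)" and "c' = 8 * sqrt C"
  have sC: "sqrt C \<ge> 1" "sqrt C * sqrt C = C" using C by auto
  have "4 * sqrt C \<ge> 1" using sC by linarith
  hence c_le: "c \<le> 1" using C by (simp add: c_def divide_le_eq_1)
  have c_eq: "c > 0" "c' > 0" "C * c\<^sup>2 = 1 / 16" "c'\<^sup>2 = 64 * C"
    using C sC by (auto simp: c_def c'_def power_divide power_mult_distrib divide_simps)
  note c = c_eq(1,2) c_le c_eq(3,4)
  define c0 where "c0 = c / 2 * exp (- (c'\<^sup>2 / 4))"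
  have c0: "c0 > 0" using c by (simp add: c0_def)
  \<comment> \<open>With this choice c'^2 \<tau>1 \<le> r^2 / 2, so the whole transition of the
    source happens within distance r of \<open>a\<close>; T / 2 keeps the window away from time
    0.\<close>
  define \<tau>1 where "\<tau>1 = min (T / 2) (r\<^sup>2 / (128 * C))"
  have \<tau>1: "\<tau>1 > 0" "\<tau>1 \<le> T / 2" "128 * C * \<tau>1 \<le> r\<^sup>2"
    using T r C by (auto simp: \<tau>1_def min_def field_simps)
  \<comment> \<open>\<open>Z\<close> will be the logarithm of the ratio of remaining times,
    \<open>\<tau>1 / \<kappa>\<close>; it is chosen to exceed what the bounded mass allows.\<close>
  define Z where "Z = 2 * pi * C / c0 + 1"
  have Z: "Z > 0" "c0 * Z > 2 * pi * C" using c0 C by (auto simp: Z_def field_simps intro!: add_pos_pos)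
  define \<kappa> where "\<kappa> = \<tau>1 * exp (- Z)"
  have \<kappa>: "\<kappa> > 0" "\<kappa> < \<tau>1" using \<tau>1 Z by (auto simp: \<kappa>_def)
  define t1 t2 where "t1 = T - \<tau>1" and "t2 = T - \<kappa>"
  \<comment> \<open>On the window T - t is at least \<open>\<kappa>\<close>. The entry
    \<open>\<kappa> / 2\<close> keeps remaining times comparable under mollification, and
    \<open>c * sqrt \<kappa> / 2\<close> keeps the radius below the scale of the interval
    throughout.\<close>
  define \<delta> where "\<delta> = Min {\<kappa> / 2, c * sqrt \<kappa> / 2, r / 4, T / 8, 1 / 2}"
  have \<delta>: "\<delta> > 0" "\<delta> \<le> \<kappa> / 2" "\<delta> \<le> c * sqrt \<kappa> / 2" "\<delta> \<le> r / 4" "\<delta> \<le> T / 8" "\<delta> \<le> 1 / 2"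
    using \<kappa> c r T by (auto simp: \<delta>_def)
  obtain \<alpha> where M: "mollifier \<delta> \<alpha>" using mollifier_exists[OF \<delta>(1)] .
  let ?w = "cut (T + 1) u" and ?s = "src (T + 1)"
  have box: "box_inside (T + 1) \<delta> x t" if "\<bar>x - a\<bar> \<le> 2 * r" "t \<in> {t1..t2}" for x t
    using that r \<delta> \<tau>1 \<kappa> T by (auto simp: box_inside_def t1_def t2_def abs_le_iff)
  have near: "x - y \<in> {-1<..<1} \<and> 0 < t - s \<and> t - s < T \<and> (T - t) / 2 \<le> T - (t - s) \<and> T - (t - s) \<le> 2 * (T - t)
      \<and> -1 < a - \<bar>x - y - a\<bar> \<and> a + \<bar>x - y - a\<bar> < 1"
    if "\<bar>x - a\<bar> \<le> 2 * r" "t \<in> {t1..t2}" "\<bar>y\<bar> < \<delta>" "\<bar>s\<bar> < \<delta>" for x t y s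
  proof -
    have "\<bar>x - y - a\<bar> < 3 * r" using that \<delta> by linarith
    moreover have "-1 \<le> a - 4 * r" "a + 4 * r \<le> 1" using r by auto
    moreover have "\<delta> \<le> (T - t) / 2" "T / 2 \<le> t" using that \<delta>(2) \<tau>1 by (auto simp: t1_def t2_def)
    ultimately show ?thesis using that \<delta>(5) T r(1) by (auto simp: abs_le_iff abs_less_iff)
  qed
  have \<delta>s: "\<delta> \<le> c * sqrt (T - t) / 2" if "t \<in> {t1..t2}" for t
  proof -
    have "sqrt \<kappa> \<le> sqrt (T - t)" using that by (simp add: t2_def)
    hence "c * sqrt \<kappa> / 2 \<le> c * sqrt (T - t) / 2" using c by (intro divide_right_mono mult_left_mono) auto
    thus ?thesis using \<delta>(3) by linarith
  qed
  have \<tau>pos: "T - t > 0" "sqrt (T - t) > 0" "(sqrt (T - t))\<^sup>2 = T - t" if "t \<in> {t1..t2}" for t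
    using that \<kappa> by (auto simp: t2_def)
  have s0: "conv \<alpha> ?s 0 0 x t = 0" if x: "\<bar>x - a\<bar> < c * sqrt (T - t)" "\<bar>x - a\<bar> \<le> 2 * r" and t: "t \<in> {t1..t2}" for x t
  proof (rule antisym)
    show "conv \<alpha> ?s 0 0 x t \<le> 0"
    proof (rule conv_le[OF M src_integrable])
      fix y s assume ys: "\<bar>y\<bar> < \<delta>" "\<bar>s\<bar> < \<delta>"
      note n = near[OF x(2) t ys]
      have "\<bar>x - y - a\<bar> \<le> 2 * (c * sqrt (T - t))" using x(1) ys(1) \<delta>s[OF t] by linarith
      hence "\<bar>x - y - a\<bar>\<^sup>2 \<le> (2 * (c * sqrt (T - t)))\<^sup>2" by (intro power_mono) auto
      hence "(x - y - a)\<^sup>2 \<le> 4 * c\<^sup>2 * (T - t)" using \<tau>pos[OF t] by (simp add: power_mult_distrib)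
      from mult_left_mono[OF this, of C] have "C * (x - y - a)\<^sup>2 \<le> 4 * (C * c\<^sup>2) * (T - t)" using C by (simp add: algebra_simps)
      hence "C * (x - y - a)\<^sup>2 < T - (t - s)" using n \<tau>pos[OF t] unfolding c(4) by linarith
      hence "u (x - y, t - s) < 0" using n by (intro negative_near_contact) auto
      thus "?s (x - y, t - s) \<le> 0" using n by (subst src_eq) auto
    qed
  qed (rule conv_ge[OF M src_integrable], simp add: src_bounds)
  have s1: "conv \<alpha> ?s 0 0 x t = 1" if x: "\<bar>x - a\<bar> > c' * sqrt (T - t)" "\<bar>x - a\<bar> \<le> 2 * r" and t: "t \<in> {t1..t2}" for x t
  proof (rule antisym)
    show "1 \<le> conv \<alpha> ?s 0 0 x t"
    proof (rule conv_ge[OF M src_integrable])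
      fix y s assume ys: "\<bar>y\<bar> < \<delta>" "\<bar>s\<bar> < \<delta>"
      note n = near[OF x(2) t ys]
      have "u (x - y, t - s) > 0"
      proof (rule ccontr)
        assume "\<not> u (x - y, t - s) > 0"
        hence "(x - y - a)\<^sup>2 \<le> 16 * C * (T - (t - s))"
          using n by (intro nonpositive_imp_near_contact) auto
        also have "\<dots> \<le> 16 * C * (2 * (T - t))" using n C by (intro mult_left_mono) auto
        finally have le: "(x - y - a)\<^sup>2 \<le> 32 * (C * (T - t))" by (simp add: algebra_simps)
        have "c * sqrt (T - t) \<le> sqrt C * sqrt (T - t)"
          using \<tau>pos(2)[OF t] by (intro mult_right_mono order_trans[OF c(3) sC(1)]) simp
        moreover have "\<bar>x - y - a\<bar> > 8 * (sqrt C * sqrt (T - t)) - c * sqrt (T - t)"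
          using x(1) ys(1) \<delta>s[OF t] \<delta>(1) unfolding c'_def mult.assoc by linarith
        ultimately have "7 * (sqrt C * sqrt (T - t)) \<le> \<bar>x - y - a\<bar>" by linarith
        hence "(7 * (sqrt C * sqrt (T - t)))\<^sup>2 \<le> \<bar>x - y - a\<bar>\<^sup>2"
          using sC \<tau>pos[OF t] by (intro power_mono) auto
        hence "49 * (C * (T - t)) \<le> (x - y - a)\<^sup>2"
          using C \<tau>pos[OF t] by (simp add: power_mult_distrib)
        moreover have "C * (T - t) > 0" using C \<tau>pos[OF t] by simp
        ultimately show False using le by simp
      qed
      thus "1 \<le> ?s (x - y, t - s)" using n by (subst src_eq) auto
    qed
  qed (rule conv_le[OF M src_integrable], simp add: src_bounds)
  have gD: "((\<lambda>x. conv \<alpha> ?s 0 0 x t) has_real_derivative conv \<alpha> ?s (Suc 0) 0 x t) (at x)" for x t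
    by (rule conv_DERIV_x[OF M src_integrable])
  have locally_const: "conv \<alpha> ?s (Suc 0) 0 x t = 0"
    if "open S" "x \<in> S" "\<And>y. y \<in> S \<Longrightarrow> conv \<alpha> ?s 0 0 y t = k" for S x t k
  proof -
    have "((\<lambda>x. conv \<alpha> ?s 0 0 x t) has_real_derivative 0) (at x)"
      by (rule has_field_derivative_transform_within_open[OF DERIV_const that(1,2)]) (simp add: that(3))
    thus ?thesis using gD DERIV_unique by blast
  qed
  have supp: "c * sqrt (T - t) \<le> \<bar>x - a\<bar> \<and> \<bar>x - a\<bar> \<le> c' * sqrt (T - t)"
    if x: "\<bar>x - a\<bar> \<le> r" and t: "t \<in> {t1..t2}" and nz: "conv \<alpha> ?s (Suc 0) 0 x t \<noteq> 0" for x t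
  proof (rule ccontr)
    assume "\<not> ?thesis"
    then consider "\<bar>x - a\<bar> < c * sqrt (T - t)" | "\<bar>x - a\<bar> > c' * sqrt (T - t)" by linarith
    thus False
    proof cases
      case 1
      have "open ({y. \<bar>y - a\<bar> < c * sqrt (T - t)} \<inter> {y. \<bar>y - a\<bar> < 2 * r})"
        by (intro open_Int open_Collect_less continuous_intros)
      from locally_const[OF this, of x t 0] show False using s0[OF _ _ t] 1 x nz r by auto
    next
      case 2
      have "open ({y. c' * sqrt (T - t) < \<bar>y - a\<bar>} \<inter> {y. \<bar>y - a\<bar> < 2 * r})"
        by (intro open_Int open_Collect_less continuous_intros)
      from locally_const[OF this, of x t 1] show False using s1[OF _ _ t] 2 x nz r by auto
    qed
  qed
  have sgn: "0 \<le> conv \<alpha> ?s (Suc 0) 0 x t * (x - a)" if x: "\<bar>x - a\<bar> \<le> r" and t: "t \<in> {t1..t2}" for x t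
  proof (rule ccontr)
    assume neg: "\<not> ?thesis"
    hence nz: "conv \<alpha> ?s (Suc 0) 0 x t \<noteq> 0" by auto
    \<comment> \<open>A nonzero derivative places x farther than \<delta> from \<open>a\<close>; all
      translates in the average then stay on one side of \<open>a\<close>, where the source is
      monotone.\<close>
    have xd: "\<bar>x - a\<bar> > \<delta>" using supp[OF x t nz] \<delta>s[OF t] \<delta>(1) by linarith
    have mono: "conv \<alpha> ?s 0 0 p t \<le> conv \<alpha> ?s 0 0 q t"
      if "\<bar>p - a\<bar> \<le> 2 * r" "\<bar>q - a\<bar> \<le> 2 * r" "a + \<delta> \<le> p \<and> p \<le> q \<or> q \<le> p \<and> p \<le> a - \<delta>" for p q
    proof -
      have "conv \<alpha> ?s 0 0 p t + 0 \<le> conv \<alpha> ?s 0 0 q t"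
      proof (rule conv_mono[OF M src_integrable src_integrable])
        fix y s assume ys: "\<bar>y\<bar> < \<delta>" "\<bar>s\<bar> < \<delta>"
        have "a \<le> p - y \<and> p - y \<le> q - y \<or> q - y \<le> p - y \<and> p - y \<le> a" using that(3) ys by linarith
        thus "?s (p - y, t - s) + 0 \<le> ?s (q - y, t - s)"
          using src_monotone[of "p - y" "q - y" "t - s"] near[OF that(1) t ys] near[OF that(2) t ys] by simp
      qed
      thus ?thesis by simp
    qed
    show False
    proof (cases "x > a")
      case True
      hence "conv \<alpha> ?s (Suc 0) 0 x t < 0" using neg by (simp add: not_le mult_less_0_iff)
      from DERIV_neg_dec_right[OF gD this] obtain d where d: "d > 0"
        "\<And>h. 0 < h \<Longrightarrow> h < d \<Longrightarrow> conv \<alpha> ?s 0 0 x t > conv \<alpha> ?s 0 0 (x + h) t" by blast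
      define h where "h = min d r / 2"
      have h: "0 < h" "h < d" "h \<le> r" using d(1) r(1) by (auto simp: h_def)
      have "conv \<alpha> ?s 0 0 x t \<le> conv \<alpha> ?s 0 0 (x + h) t"
        by (rule mono) (use True xd x h in auto)
      thus False using d(2)[OF h(1,2)] by simp
    next
      case False
      hence "conv \<alpha> ?s (Suc 0) 0 x t > 0" using neg by (auto simp: not_le mult_less_0_iff)
      from DERIV_pos_inc_right[OF gD this] obtain d where d: "d > 0"
        "\<And>h. 0 < h \<Longrightarrow> h < d \<Longrightarrow> conv \<alpha> ?s 0 0 x t < conv \<alpha> ?s 0 0 (x + h) t" by blast
      define h where "h = min d (a - \<delta> - x) / 2"
      have h: "0 < h" "h < d" "x + h \<le> a - \<delta>" using d(1) False xd by (auto simp: h_def min_def field_simps)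
      have "conv \<alpha> ?s 0 0 (x + h) t \<le> conv \<alpha> ?s 0 0 x t"
        by (rule mono) (use False xd x h r(1) \<delta>(1) in auto)
      thus False using d(2)[OF h(1,2)] by simp
    qed
  qed
  have "c / 2 * exp (- (c'\<^sup>2 / 4)) * ln ((T - t1) / (T - t2)) \<le> 2 * pi * C"
  proof (rule gaussian_mass_log_growth[OF r(1) _ _ _ c(1,2)])
    show "t1 < t2" "t2 < T" using \<kappa> by (auto simp: t1_def t2_def)
    have "\<tau>1 \<le> C * \<tau>1" using C \<tau>1(1) by simp
    hence "\<tau>1 \<le> r\<^sup>2 / 2" using \<tau>1(1,3) by linarith
    thus "T - t1 \<le> r\<^sup>2 / 2" by (simp add: t1_def)
    show "((\<lambda>t. conv \<alpha> ?w (Suc (Suc 0)) 0 x t) has_real_derivative conv \<alpha> ?w (Suc (Suc 0)) (Suc 0) x t) (at t)" for x t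
      by (rule conv_DERIV_t[OF M w_integrable])
    show "((\<lambda>x. conv \<alpha> ?w (Suc (Suc 0)) 0 x t) has_real_derivative conv \<alpha> ?w (Suc (Suc (Suc 0))) 0 x t) (at x)" for x t
      by (rule conv_DERIV_x[OF M w_integrable])
    show "((\<lambda>x. conv \<alpha> ?w (Suc 0) (Suc 0) x t) has_real_derivative conv \<alpha> ?w (Suc (Suc 0)) (Suc 0) x t) (at x)" for x t
      by (rule conv_DERIV_x[OF M w_integrable])
    show "((\<lambda>x. conv \<alpha> ?s 0 0 x t) has_real_derivative conv \<alpha> ?s (Suc 0) 0 x t) (at x)" for x t
      by (rule gD)
    show "continuous_on UNIV (\<lambda>z. conv \<alpha> ?w (Suc (Suc 0)) 0 (fst z) (snd z))"
      "continuous_on UNIV (\<lambda>z. conv \<alpha> ?w (Suc (Suc 0)) (Suc 0) (fst z) (snd z))"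
      by (rule conv_continuous_on[OF M w_integrable])+
    fix x t assume x: "\<bar>x - a\<bar> \<le> r" and t: "t \<in> {t1..t2}"
    have b: "box_inside (T + 1) \<delta> x t" using x t r(1) by (intro box) auto
    \<comment> \<open>The mollified equation, differentiated once in x.\<close>
    show "conv \<alpha> ?w (Suc 0) (Suc 0) x t = conv \<alpha> ?w (Suc (Suc (Suc 0))) 0 x t + conv \<alpha> ?s (Suc 0) 0 x t"
      by (rule mollified_equation[OF M b])
    show "0 \<le> conv \<alpha> ?w (Suc (Suc 0)) 0 x t \<and> conv \<alpha> ?w (Suc (Suc 0)) 0 x t \<le> C"
      using mollified_xx_bounds[OF M b] by blast
    show "0 \<le> conv \<alpha> ?s (Suc 0) 0 x t * (x - a)" by (rule sgn[OF x t])
    show "c * sqrt (T - t) \<le> \<bar>x - a\<bar> \<and> \<bar>x - a\<bar> \<le> c' * sqrt (T - t)" if "conv \<alpha> ?s (Suc 0) 0 x t \<noteq> 0"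
      by (rule supp[OF x t that])
  next
    fix t assume t: "t \<in> {t1..t2}"
    have "c'\<^sup>2 * (T - t) < r\<^sup>2"
    proof -
      have "C * (T - t) \<le> C * \<tau>1" "C * \<tau>1 > 0" using t C \<tau>1 by (auto simp: t1_def)
      thus ?thesis using \<tau>1(3) unfolding c(5) by linarith
    qed
    hence "(c' * sqrt (T - t))\<^sup>2 < r\<^sup>2" using \<tau>pos[OF t] by (simp add: power_mult_distrib)
    hence "c' * sqrt (T - t) < r" by (rule power_less_imp_less_base) (use r(1) in simp)
    hence "conv \<alpha> ?s 0 0 (a + r) t = 1" using r(1) t by (intro s1) auto
    moreover have "conv \<alpha> ?s 0 0 a t = 0" using r(1) t c(1) \<tau>pos[OF t] by (intro s0) auto
    ultimately show "conv \<alpha> ?s 0 0 (a + r) t - conv \<alpha> ?s 0 0 a t = 1" by simp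
  qed
  moreover have "(T - t1) / (T - t2) = exp Z"
    using \<tau>1(1) by (simp add: t1_def t2_def \<kappa>_def exp_minus field_simps)
  ultimately show False using Z(2) by (simp add: c0_def)
qed

end

lemma no_bounded_time_derivative: False
  by (rule first_contact) (rule contact_contradiction)

end

theorem mainTheorem2:
  fixes u :: "real \<times> real \<Rightarrow> real"
  assumes "least_solution (\<lambda>x. 2 * x\<^sup>2 - 1) (\<lambda>x t. t + 1) u"
  shows "\<forall>ut. weak_deriv Dt Q u ut \<longrightarrow> ut \<notin> Linf Q"
proof (intro allI impI notI)
  fix ut assume ut: "weak_deriv Dt Q u ut" and "ut \<in> Linf Q"
  then obtain C where C: "AE z in lebesgue_on Q. \<bar>ut z\<bar> \<le> C" by (auto simp: Linf_def)
  have sol: "solves_ibvp (indicat_real {0<..}) (\<lambda>x. 2 * x\<^sup>2 - 1) (\<lambda>x t. t + 1) u"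
    using assms by (simp add: least_solution_def)
  have "bounded_time_derivative u ut (max C 1)"
  proof
    show "strong_solution (indicat_real {0<..}) Q u" "continuous_on (closure Q) u"
      using sol by (simp_all add: solves_ibvp_def)
    show "u (x, t) = t + 1" if "x \<in> {-1, 1}" "t > 0" for x t
      using sol that by (auto simp: solves_ibvp_def)
    have "u (0, 0) = 2 * 0\<^sup>2 - 1"
      using sol unfolding solves_ibvp_def by (metis greaterThanLessThan_iff neg_less_0_iff_less zero_less_one)
    thus "u (0, 0) < 0" by simp
    show "AE z in lebesgue_on Q. \<bar>ut z\<bar> \<le> max C 1" using C by eventually_elim simp
  qed (use least_ge_subsolution[OF assms] least_time_growth[OF assms] ut in auto)
  thus False by (rule bounded_time_derivative.no_bounded_time_derivative)
qed

end
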